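(* Let $N\ge 2$, $R\in(0,1)$, $\sigma_-,\sigma_+>0$. For every $\Phi\in\mathcal{A}$ whose first-order field $\mathbf{h}$ satisfies the first order volume preserving condition $\int_{\partial B_R} h_n=0$, the first shape derivative of $E$ at $B_R$ along $\Phi$ vanishes: $$\left.\frac{d}{dt}E\big(\Phi(t)(B_R)\big)\right|_{t=0}=0 .$$
   Context: $\Omega\subset\mathbb{R}^N$ is the open unit ball centered at the origin, and $B_R\subset\Omega$ is the concentric open ball of radius $R$. For $\omega$ with $\overline{\omega}\subset\Omega$, set $\sigma_\omega:=\sigma_-\mathbf{1}_\omega+\sigma_+\mathbf{1}_{\Omega\setminus\overline\omega}$, let $u_\omega\in H^1_0(\Omega)$ be the unique weak solution of $-\mathrm{div}(\sigma_\omega\nabla u)=1$ in $\Omega$, $u=0$ on $\partial\Omega$ (i.e. $\int_\Omega\sigma_\omega\nabla u_\omega\cdot\nabla\varphi=\int_\Omega\varphi$ for all $\varphi\in H^1_0(\Omega)$), and define the torsional rigidity functional $E(\omega):=\int_\Omega\sigma_\omega|\nabla u_\omega|^2=\int_\Omega u_\omega$. $\mathcal{A}$ is the set of all $\Phi\in C^\infty([0,1)\times\mathbb{R}^N,\mathbb{R}^N)$ such that $\Phi(0,\cdot)=\mathrm{Id}$ and there is a set $K$ compactly contained in $\Omega$ with $\Phi(t,x)=x$ for all $t\in[0,1)$ and all $x\in\mathbb{R}^N\setminus K$. Write $\Phi(t)=\Phi(t,\cdot)$ and $\Phi(t)(D)=\{\Phi(t,x):x\in D\}$. The first-order field $\mathbf{h}$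 of $\Phi$ is the smooth vector field with $\Phi(t)=\mathrm{Id}+t\mathbf{h}+o(t)$ as $t\to0$; $\mathbf{n}$ is the outward unit normal to $\partial B_R$ and $h_n:=\mathbf{h}\cdot\mathbf{n}$ on $\partial B_R$. Derivatives at $t=0$ are taken from the right. *)

theory Defs
  imports "HOL-Analysis.Analysis"
begin

text \<open>
  Smoothness relative to a set. Derivatives are taken within \<open>S\<close>, so on \<open>[0,1) \<times> \<real>\<^sup>N\<close> the
  time derivatives at \<open>t = 0\<close> are one-sided. For convex \<open>S\<close> with nonempty interior the
  derivative within \<open>S\<close> is unique, and in finite dimension continuity of all directional
  derivatives is continuity of the derivative.
\<close>

primrec Ck_on :: "nat \<Rightarrow> 'a::real_normed_vector set \<Rightarrow> ('a \<Rightarrow> 'b::real_normed_vector) \<Rightarrow> bool" where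
  "Ck_on 0 S f \<longleftrightarrow> continuous_on S f"
| "Ck_on (Suc k) S f \<longleftrightarrow>
    (\<exists>f'. (\<forall>x\<in>S. (f has_derivative f' x) (at x within S)) \<and> (\<forall>v. Ck_on k S (\<lambda>x. f' x v)))"

definition smooth_on :: "'a::real_normed_vector set \<Rightarrow> ('a \<Rightarrow> 'b::real_normed_vector) \<Rightarrow> bool" where
  "smooth_on S f \<longleftrightarrow> (\<forall>k. Ck_on k S f)"

definition test_function :: "'a::euclidean_space set \<Rightarrow> ('a \<Rightarrow> real) \<Rightarrow> bool" where
  "test_function \<Omega> \<phi> \<longleftrightarrow> smooth_on UNIV \<phi> \<and>
    compact (closure {x. \<phi> x \<noteq> 0}) \<and> closure {x. \<phi> x \<noteq> 0} \<subseteq> \<Omega>"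

definition grad :: "('a::euclidean_space \<Rightarrow> real) \<Rightarrow> 'a \<Rightarrow> 'a" where
  "grad \<phi> x = (\<Sum>i\<in>Basis. frechet_derivative \<phi> (at x) i *\<^sub>R i)"

text \<open>
  Sobolev functions are represented by functions on the whole space of which only the values
  in \<open>\<Omega>\<close>, up to null sets, matter.
\<close>

definition L2_on :: "'a::euclidean_space set \<Rightarrow> ('a \<Rightarrow> 'b::euclidean_space) \<Rightarrow> bool" where
  "L2_on \<Omega> f \<longleftrightarrow> f \<in> borel_measurable (lebesgue_on \<Omega>) \<and>
    integrable (lebesgue_on \<Omega>) (\<lambda>x. (norm (f x))\<^sup>2)"

definition has_weak_gradient ::
  "'a::euclidean_space set \<Rightarrow> ('a \<Rightarrow> real) \<Rightarrow> ('a \<Rightarrow> 'a) \<Rightarrow> bool" where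
  "has_weak_gradient \<Omega> u g \<longleftrightarrow> L2_on \<Omega> u \<and> L2_on \<Omega> g \<and>
    (\<forall>\<phi>. test_function \<Omega> \<phi> \<longrightarrow> (\<forall>i\<in>Basis.
      (LINT x|lebesgue_on \<Omega>. u x * (grad \<phi> x \<bullet> i)) = - (LINT x|lebesgue_on \<Omega>. (g x \<bullet> i) * \<phi> x)))"

definition H1 :: "'a::euclidean_space set \<Rightarrow> ('a \<Rightarrow> real) set" where
  "H1 \<Omega> = {u. \<exists>g. has_weak_gradient \<Omega> u g}"

text \<open>The weak gradient is determined only up to null sets; this picks a representative.\<close>

definition weak_grad :: "'a::euclidean_space set \<Rightarrow> ('a \<Rightarrow> real) \<Rightarrow> 'a \<Rightarrow> 'a" where
  "weak_grad \<Omega> u = (SOME g. has_weak_gradient \<Omega> u g)"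

text \<open>\<open>H\<^sup>1\<^sub>0(\<Omega>)\<close> is the closure of the test functions in the \<open>H\<^sup>1\<close> norm.\<close>

definition H10 :: "'a::euclidean_space set \<Rightarrow> ('a \<Rightarrow> real) set" where
  "H10 \<Omega> = {u \<in> H1 \<Omega>. \<exists>\<phi>. (\<forall>k. test_function \<Omega> (\<phi> k)) \<and>
    (\<lambda>k::nat. (LINT x|lebesgue_on \<Omega>. (\<phi> k x - u x)\<^sup>2)
      + (LINT x|lebesgue_on \<Omega>. (norm (grad (\<phi> k) x - weak_grad \<Omega> u x))\<^sup>2)) \<longlonglongrightarrow> 0}"

definition Omega :: "'a::euclidean_space set" where
  "Omega = ball 0 1"

definition conductivity :: "real \<Rightarrow> real \<Rightarrow> 'a::euclidean_space set \<Rightarrow> 'a \<Rightarrow> real" where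
  "conductivity \<sigma>m \<sigma>p \<omega> x = \<sigma>m * indicator \<omega> x + \<sigma>p * indicator (Omega - closure \<omega>) x"

definition weak_solution ::
  "real \<Rightarrow> real \<Rightarrow> 'a::euclidean_space set \<Rightarrow> ('a \<Rightarrow> real) \<Rightarrow> bool" where
  "weak_solution \<sigma>m \<sigma>p \<omega> u \<longleftrightarrow> u \<in> H10 Omega \<and>
    (\<forall>\<phi>\<in>H10 Omega.
      (LINT x|lebesgue_on Omega.
        conductivity \<sigma>m \<sigma>p \<omega> x * (weak_grad Omega u x \<bullet> weak_grad Omega \<phi> x))
      = (LINT x|lebesgue_on Omega. \<phi> x))"

text \<open>The weak solution is unique as an element of \<open>H\<^sup>1\<^sub>0\<close>, i.e. up to null sets.\<close>

definition torsion_function :: "real \<Rightarrow> real \<Rightarrow> 'a::euclidean_space set \<Rightarrow> 'a \<Rightarrow> real" where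
  "torsion_function \<sigma>m \<sigma>p \<omega> = (SOME u. weak_solution \<sigma>m \<sigma>p \<omega> u)"

definition torsional_rigidity :: "real \<Rightarrow> real \<Rightarrow> 'a::euclidean_space set \<Rightarrow> real" where
  "torsional_rigidity \<sigma>m \<sigma>p \<omega> =
    (LINT x|lebesgue_on Omega.
      conductivity \<sigma>m \<sigma>p \<omega> x * (norm (weak_grad Omega (torsion_function \<sigma>m \<sigma>p \<omega>) x))\<^sup>2)"

lemma torsional_rigidity_eq:
  fixes \<omega> :: "'a::euclidean_space set"
  assumes "\<exists>u. weak_solution \<sigma>m \<sigma>p \<omega> u"
  shows "torsional_rigidity \<sigma>m \<sigma>p \<omega> = (LINT x|lebesgue_on Omega. torsion_function \<sigma>m \<sigma>p \<omega> x)"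
proof -
  have "weak_solution \<sigma>m \<sigma>p \<omega> (torsion_function \<sigma>m \<sigma>p \<omega>)"
    unfolding torsion_function_def using assms by (rule someI_ex)
  then show ?thesis
    unfolding weak_solution_def torsional_rigidity_def by (auto simp: power2_norm_eq_inner)
qed

definition admissible :: "(real \<Rightarrow> 'a::euclidean_space \<Rightarrow> 'a) set" where
  "admissible = {\<Phi>. smooth_on ({0..<1} \<times> UNIV) (\<lambda>(t, x). \<Phi> t x) \<and> \<Phi> 0 = id \<and>
    (\<exists>K. compact (closure K) \<and> closure K \<subseteq> Omega \<and> (\<forall>t\<in>{0..<1}. \<forall>x. x \<notin> K \<longrightarrow> \<Phi> t x = x))}"

text \<open>
  \<open>\<Phi>(t) = Id + t h + o(t)\<close> as \<open>t \<rightarrow> 0+\<close>, read pointwise; for admissible \<open>\<Phi>\<close> the remainder is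
  then automatically uniform in \<open>x\<close>.
\<close>

definition first_order_field :: "(real \<Rightarrow> 'a::euclidean_space \<Rightarrow> 'a) \<Rightarrow> ('a \<Rightarrow> 'a) \<Rightarrow> bool" where
  "first_order_field \<Phi> h \<longleftrightarrow> smooth_on UNIV h \<and>
    (\<forall>x. ((\<lambda>t. (\<Phi> t x - (x + t *\<^sub>R h x)) /\<^sub>R t) \<longlongrightarrow> 0) (at_right 0))"

text \<open>
  Surface measure on the sphere of radius \<open>r\<close> from polar coordinates: the measure of
  \<open>A \<subseteq> sphere 0 r\<close> is \<open>N r\<^bsup>N-1\<^esup>\<close> times the volume of the part of the unit ball lying on the rays
  from the origin through \<open>A\<close>. It is a Borel measure on the whole space; the centre, which is
  not mapped into the sphere, is a null set.
\<close>

definition surface_measure :: "real \<Rightarrow> 'a::euclidean_space measure" where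
  "surface_measure r = scale_measure (ennreal (real DIM('a) * r ^ (DIM('a) - 1)))
    (distr (restrict_space lborel (ball 0 1)) borel (\<lambda>x. r *\<^sub>R sgn x))"

definition outward_normal :: "real \<Rightarrow> 'a::euclidean_space \<Rightarrow> 'a" where
  "outward_normal r x = x /\<^sub>R r"

end

theory Submission
  imports Defs
begin

text \<open>
  The torsional rigidity is compared with an explicit functional of the inclusion. Write \<open>\<sigma>\<close> for the
  conductivity of the inclusion \<open>\<omega>\<close> and \<open>g = - x / (N \<sigma>)\<close>. The field \<open>\<sigma> g = - x / N\<close> has divergence \<open>-1\<close>
  whatever \<open>\<omega>\<close> is, so \<open>\<integral>\<phi> = \<integral>\<sigma> g \<bullet> \<nabla>\<phi>\<close> for every test function, and completing the square in the
  energy whose maximum is \<open>E(\<omega>)\<close> gives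
  
      \<open>2 \<integral>\<phi> - \<integral>\<sigma> |\<nabla>\<phi>|\<^sup>2 = G(\<omega>) - \<integral>\<sigma> |\<nabla>\<phi> - g|\<^sup>2\<close>,  where  \<open>G(\<omega>) = \<integral>|x|\<^sup>2 / (N\<^sup>2 \<sigma>)\<close>.
  
  Hence \<open>E(\<omega>)\<close> lies below \<open>G(\<omega>)\<close> by exactly the squared weighted distance of \<open>g\<close> from gradients
  (\<open>torsional_rigidity_bounds\<close>). For the ball this distance is \<open>0\<close>, as \<open>g\<close> is the gradient of the
  radial torsion function. For \<open>\<Phi>(t)(B\<^sub>R)\<close> the torsion function of the ball, transported by \<open>\<Phi>(t)\<close>, has
  its kink on the new interface and its gradient differs from the new \<open>g\<close> by \<open>O(t)\<close> at every other
  point, so the squared distance is \<open>O(t\<^sup>2)\<close> (\<open>torsional_rigidity_lower_bound\<close>). Therefore \<open>E\<close> and \<open>G\<close> have the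
  same derivative at \<open>t = 0\<close>.
  
  Up to a constant, \<open>G(\<omega>)\<close> is a multiple of the second moment \<open>\<integral>\<^sub>\<omega> |x|\<^sup>2\<close> (\<open>weighted_moment\<close>). The derivative of
  the moment along \<open>\<Phi>\<close> is the integral of \<open>div (|x|\<^sup>2 h)\<close> over the ball (\<open>second_moment_derivative\<close>), which
  by \<open>divergence_theorem_ball\<close> is the flux \<open>R\<^sup>2 \<integral>h\<^sub>n\<close>. This is \<open>0\<close> by hypothesis.
  
  The quantity \<open>E\<close> is defined by choosing a weak solution, so a solution must be known to exist for each
  inclusion: \<open>weak_solution_exists\<close> obtains it as a maximiser of the energy, and \<open>weak_gradient_unique\<close>
  shows that the chosen weak gradients are the limits of the gradients of test functions. Every
  approximation by test functions goes through one lemma, \<open>mollification\<close>.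
\<close>

section \<open>Smooth functions\<close>

lemma Ck_on_imp_continuous_on: "Ck_on k S f \<Longrightarrow> continuous_on S f"
proof (cases k)
  case (Suc j)
  moreover assume "Ck_on k S f"
  ultimately obtain f' where "\<forall>x\<in>S. (f has_derivative f' x) (at x within S)" by auto
  then show ?thesis by (intro has_derivative_continuous_on) blast
qed auto

lemma Ck_on_SucD: "Ck_on (Suc k) S f \<Longrightarrow> Ck_on k S f"
proof (induction k arbitrary: f)
  case 0
  then show ?case using Ck_on_imp_continuous_on Ck_on.simps(1) by blast
next
  case (Suc k)
  then obtain f' where "\<forall>x\<in>S. (f has_derivative f' x) (at x within S)"
    "\<forall>v. Ck_on (Suc k) S (\<lambda>x. f' x v)" by (metis Ck_on.simps(2))
  with Suc.IH show ?case by (metis Ck_on.simps(2))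
qed

lemma Ck_on_const: "Ck_on k S (\<lambda>x. c)"
proof (induction k arbitrary: c)
  case (Suc k)
  show ?case unfolding Ck_on.simps(2)
    by (rule exI[of _ "\<lambda>_ _. 0"]) (auto simp: Suc)
qed auto

lemma Ck_on_bounded_linear: "bounded_linear f \<Longrightarrow> Ck_on k S f"
proof (cases k)
  case (Suc j)
  assume "bounded_linear f"
  then show ?thesis unfolding Suc Ck_on.simps(2)
    by (intro exI[of _ "\<lambda>_. f"]) (auto simp: Ck_on_const bounded_linear_imp_has_derivative)
qed (auto intro: linear_continuous_on)

lemma Ck_on_add: "Ck_on k S f \<Longrightarrow> Ck_on k S g \<Longrightarrow> Ck_on k S (\<lambda>x. f x + g x)"
proof (induction k arbitrary: f g)
  case (Suc k)
  from Suc.prems obtain f' g' where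
    f: "\<forall>x\<in>S. (f has_derivative f' x) (at x within S)" "\<And>v. Ck_on k S (\<lambda>x. f' x v)" and
    g: "\<forall>x\<in>S. (g has_derivative g' x) (at x within S)" "\<And>v. Ck_on k S (\<lambda>x. g' x v)"
    by (metis Ck_on.simps(2))
  show ?case unfolding Ck_on.simps(2)
    by (rule exI[of _ "\<lambda>x v. f' x v + g' x v"]) (use f g Suc.IH in \<open>auto intro!: derivative_intros\<close>)
qed (auto intro: continuous_intros)

lemma Ck_on_mult:
  fixes f g :: "'a::real_normed_vector \<Rightarrow> real"
  shows "Ck_on k S f \<Longrightarrow> Ck_on k S g \<Longrightarrow> Ck_on k S (\<lambda>x. f x * g x)"
proof (induction k arbitrary: f g)
  case (Suc k)
  from Suc.prems obtain f' g' where
    f: "\<forall>x\<in>S. (f has_derivative f' x) (at x within S)" "\<And>v. Ck_on k S (\<lambda>x. f' x v)" and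
    g: "\<forall>x\<in>S. (g has_derivative g' x) (at x within S)" "\<And>v. Ck_on k S (\<lambda>x. g' x v)"
    by (metis Ck_on.simps(2))
  show ?case unfolding Ck_on.simps(2)
    by (rule exI[of _ "\<lambda>x v. f x * g' x v + f' x v * g x"])
      (use f g Suc.IH Suc.prems[THEN Ck_on_SucD] in \<open>auto intro!: derivative_intros Ck_on_add\<close>)
qed (auto intro: continuous_intros)

text \<open>
  The functions \<open>s\<^sup>-\<^sup>n exp (- 1/s)\<close>, continued by \<open>0\<close> to \<open>s \<le> 0\<close>. The derivative of each of them
  is a linear combination of two others, so all derivatives of \<open>exp (- 1/s)\<close> are controlled
  by an induction that never leaves the family.
\<close>

definition flat :: "nat \<Rightarrow> real \<Rightarrow> real" where
  "flat n s = (if s > 0 then (1 / s) ^ n * exp (- (1 / s)) else 0)"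

lemma flat_tendsto_0: "(flat n \<longlongrightarrow> 0) (at 0)"
proof -
  have "((\<lambda>u. u ^ n / exp u) \<longlongrightarrow> 0) (at_top :: real filter)" by (rule tendsto_power_div_exp_0)
  then have "((\<lambda>s. (inverse s) ^ n / exp (inverse s)) \<longlongrightarrow> 0) (at_right (0::real))"
    by (rule filterlim_compose) (rule filterlim_inverse_at_top_right)
  then have "(flat n \<longlongrightarrow> 0) (at_right 0)"
    by (rule Lim_transform_eventually)
      (auto simp: eventually_at_right_field flat_def exp_minus inverse_eq_divide divide_simps intro!: exI[of _ 1])
  moreover have "(flat n \<longlongrightarrow> 0) (at_left 0)"
    by (rule Lim_transform_eventually[OF tendsto_const])
      (auto simp: eventually_at_left_field flat_def intro!: exI[of _ "-1"])
  ultimately show ?thesis by (simp add: filterlim_split_at)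
qed

lemma flat_has_real_derivative:
  "(flat n has_real_derivative flat (n + 2) s - real n * flat (n + 1) s) (at s)"
proof -
  consider "s > 0" | "s < 0" | "s = 0" by linarith
  then show ?thesis
  proof cases
    case 1
    have inv: "((\<lambda>s. 1 / s) has_real_derivative - ((1 / s)\<^sup>2)) (at s)"
      using 1 by (auto intro!: derivative_eq_intros simp: power2_eq_square)
    have "((\<lambda>s. (1 / s) ^ n * exp (- (1 / s))) has_real_derivative
        real n * (1 / s) ^ (n - Suc 0) * (- ((1 / s)\<^sup>2)) * exp (- (1 / s))
          + exp (- (1 / s)) * (1 / s)\<^sup>2 * (1 / s) ^ n) (at s)"
      by (rule DERIV_cong[OF DERIV_mult[OF DERIV_power[OF inv] DERIV_fun_exp[OF DERIV_minus[OF inv]]]]) simp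
    then have "((\<lambda>s. (1 / s) ^ n * exp (- (1 / s))) has_real_derivative
        flat (n + 2) s - real n * flat (n + 1) s) (at s)"
      by (rule DERIV_cong) (use 1 in \<open>cases n, auto simp: flat_def power2_eq_square field_simps\<close>)
    then show ?thesis
      by (rule has_field_derivative_transform_within_open[of _ _ _ "{0<..}"]) (use 1 in \<open>auto simp: flat_def\<close>)
  next
    case 2
    have "((\<lambda>s. 0) has_real_derivative flat (n + 2) s - real n * flat (n + 1) s) (at s)"
      using 2 by (auto simp: flat_def)
    then show ?thesis
      by (rule has_field_derivative_transform_within_open[of _ _ _ "{..<0}"]) (use 2 in \<open>auto simp: flat_def\<close>)
  next
    case 3
    have "(\<lambda>h. (flat n (0 + h) - flat n 0) / h) = flat (Suc n)"
      by (auto simp: flat_def fun_eq_iff)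
    then have "((\<lambda>h. (flat n (0 + h) - flat n 0) / h) \<longlongrightarrow> 0) (at 0)" using flat_tendsto_0 by simp
    then show ?thesis using 3 by (simp add: DERIV_def flat_def)
  qed
qed

lemma Ck_on_flat_ball: "Ck_on k UNIV (\<lambda>x::'a::euclidean_space. flat n (r - x \<bullet> x))"
proof (induction k arbitrary: n)
  have D: "((\<lambda>x::'a. flat n (r - x \<bullet> x)) has_derivative
      (\<lambda>v. (flat (n + 2) (r - x \<bullet> x) + (- real n) * flat (n + 1) (r - x \<bullet> x)) * ((- 2) * (x \<bullet> v)))) (at x)" for n x
  proof -
    have "((\<lambda>x::'a. r - x \<bullet> x) has_derivative (\<lambda>v. - 2 * (x \<bullet> v))) (at x)"
      by (auto intro!: derivative_eq_intros simp: inner_commute)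
    then show ?thesis
      by (rule has_derivative_eq_rhs[OF has_derivative_compose])
        (use flat_has_real_derivative[of n "r - x \<bullet> x"] in \<open>auto simp: has_field_derivative_def fun_eq_iff\<close>)
  qed
  {
    case 0
    show ?case using D by (auto intro!: has_derivative_continuous_on)
  next
    case (Suc k)
    have "Ck_on k UNIV (\<lambda>x::'a. (flat (n + 2) (r - x \<bullet> x) + (- real n) * flat (n + 1) (r - x \<bullet> x)) * ((- 2) * (x \<bullet> v)))" for v
      by (intro Ck_on_mult Ck_on_add Ck_on_const Suc.IH Ck_on_bounded_linear bounded_linear_inner_left)
    with D show ?case unfolding Ck_on.simps(2)
      by (intro exI[of _ "\<lambda>x v. (flat (n + 2) (r - x \<bullet> x) + (- real n) * flat (n + 1) (r - x \<bullet> x)) * ((- 2) * (x \<bullet> v))"]) blast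
  }
qed

text \<open>
  All derivatives of a convolution can be taken on the smooth factor. On a box, joint continuity of
  the integrand and its derivative justifies differentiation under the integral sign.
\<close>

lemma Ck_on_convolution:
  fixes \<rho> v :: "'a::euclidean_space \<Rightarrow> real"
  assumes "\<And>k. Ck_on k UNIV \<rho>" and v: "continuous_on UNIV v"
  shows "Ck_on k UNIV (\<lambda>x. integral (cbox a b) (\<lambda>y. \<rho> (x - y) * v y))"
  using assms(1)
proof (induction k arbitrary: \<rho>)
  case 0
  have "continuous_on UNIV \<rho>" using 0[of 0] by simp
  then have "continuous_on (UNIV \<times> cbox a b) (\<lambda>(x, y). \<rho> (x - y) * v y)"
    unfolding split_beta
    by (intro continuous_on_mult continuous_on_compose2[of UNIV \<rho> _ "\<lambda>p. fst p - snd p"]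
          continuous_on_compose2[OF v] continuous_intros) auto
  then show ?case by (simp add: integral_continuous_on_param)
next
  case (Suc k)
  obtain d where d: "\<And>x. (\<rho> has_derivative d x) (at x)" "\<And>v. Ck_on 0 UNIV (\<lambda>x. d x v)"
    using Suc.prems[of "Suc 0"] by auto
  have dk: "Ck_on j UNIV (\<lambda>x. d x w)" for j w
  proof -
    obtain d' where d': "\<forall>x. (\<rho> has_derivative d' x) (at x)" "\<forall>v. Ck_on j UNIV (\<lambda>x. d' x v)"
      using Suc.prems[of "Suc j"] by auto
    have "d' = d" using d d' by (metis has_derivative_unique ext)
    with d' show ?thesis by auto
  qed
  have bl: "bounded_linear (d x)" for x using d has_derivative_bounded_linear by blast
  define B where "B x y = Blinfun (\<lambda>w. v y * d (x - y) w)" for x y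
  have Bapp: "blinfun_apply (B x y) w = v y * d (x - y) w" for x y w
    unfolding B_def by (subst bounded_linear_Blinfun_apply) (auto intro!: bounded_linear_const_mult bl)
  have contd: "continuous_on UNIV (\<lambda>x. d x w)" for w using d(2) by simp
  have contB: "continuous_on (UNIV \<times> cbox a b) (\<lambda>(x, y). B x y)"
    unfolding split_beta
    by (rule continuous_on_blinfun_componentwise)
      (simp add: Bapp, intro continuous_on_mult continuous_on_compose2[OF contd, of _ "\<lambda>p. fst p - snd p"]
          continuous_on_compose2[OF v] continuous_intros; simp)
  have cr: "continuous_on UNIV \<rho>" using Suc.prems[of 0] by simp
  have der: "((\<lambda>x. integral (cbox a b) (\<lambda>y. \<rho> (x - y) * v y)) has_derivative integral (cbox a b) (B x)) (at x)" for x
  proof (rule leibniz_rule[where U = UNIV and fx = B])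
    show "((\<lambda>x. \<rho> (x - t) * v t) has_derivative blinfun_apply (B x t)) (at x within UNIV)" for x t
      by (rule has_derivative_eq_rhs[OF has_derivative_mult_left[OF has_derivative_compose[OF _ d(1)]]])
        (auto intro!: derivative_eq_intros simp: Bapp fun_eq_iff mult.commute)
    show "(\<lambda>y. \<rho> (x - y) * v y) integrable_on cbox a b" for x
      by (intro integrable_continuous continuous_on_mult continuous_on_compose2[OF cr, of _ "\<lambda>y. x - y"]
          continuous_on_subset[OF v] continuous_intros) auto
  qed (use contB in auto)
  have app: "blinfun_apply (integral (cbox a b) (B x)) w = integral (cbox a b) (\<lambda>y. d (x - y) w * v y)" for x w
  proof -
    have "B x integrable_on cbox a b"
      by (intro integrable_continuous continuous_on_compose2[OF contB, of _ "\<lambda>y. (x, y)", simplified] continuous_intros) auto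
    then have "blinfun_apply (integral (cbox a b) (B x)) w = integral (cbox a b) (\<lambda>y. blinfun_apply (B x y) w)"
      by (rule blinfun_apply_integral)
    then show ?thesis by (simp add: Bapp mult.commute)
  qed
  have "Ck_on k UNIV (\<lambda>x. blinfun_apply (integral (cbox a b) (B x)) w)" for w
    unfolding app using dk by (rule Suc.IH)
  with der show ?case unfolding Ck_on.simps(2)
    by (intro exI[of _ "\<lambda>x. blinfun_apply (integral (cbox a b) (B x))"]) auto
qed

section \<open>Gradients of test functions\<close>

lemma grad_eqI:
  assumes "(\<phi> has_derivative (\<lambda>v. g \<bullet> v)) (at x)"
  shows "grad \<phi> x = g"
  unfolding grad_def frechet_derivative_at[OF assms, symmetric] by (rule euclidean_representation)

lemma linear_basis_expansion:
  assumes "linear f"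
  shows "f v = (\<Sum>i\<in>Basis. (v \<bullet> i) *\<^sub>R f (i :: 'a::euclidean_space))"
proof -
  have "f v = f (\<Sum>i\<in>Basis. (v \<bullet> i) *\<^sub>R i)" by (simp add: euclidean_representation)
  then show ?thesis using assms by (simp add: linear_sum linear_scale)
qed

lemma linear_norm_le_of_Basis:
  fixes f :: "'a::euclidean_space \<Rightarrow> 'b::real_normed_vector"
  assumes "linear f" and "\<And>i. i \<in> Basis \<Longrightarrow> norm (f i) \<le> b i"
  shows "norm (f v) \<le> (\<Sum>i\<in>Basis. b i) * norm v"
proof -
  have "norm (f v) \<le> (\<Sum>i\<in>(Basis::'a set). norm v * b i)"
    unfolding linear_basis_expansion[OF assms(1), of v]
    by (rule sum_norm_le) (use assms(2) in \<open>auto simp: Basis_le_norm intro!: mult_mono\<close>)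
  then show ?thesis by (simp add: sum_distrib_left mult.commute)
qed

lemma operator_field_bounded_on_compact:
  fixes H :: "'a::euclidean_space \<Rightarrow> 'a \<Rightarrow> 'b::real_normed_vector"
  assumes lin: "\<And>x. linear (H x)" and cont: "\<And>v. continuous_on UNIV (\<lambda>x. H x v)" and "compact K"
  obtains C where "C \<ge> 0" "\<And>x v. x \<in> K \<Longrightarrow> norm (H x v) \<le> C * norm v"
proof -
  have "\<exists>b\<ge>0. \<forall>x\<in>K. norm (H x v) \<le> b" for v
  proof -
    have "bounded ((\<lambda>x. H x v) ` K)"
      by (intro compact_imp_bounded compact_continuous_image continuous_on_subset[OF cont] assms(3)) auto
    then obtain b where "b > 0" "\<And>x. x \<in> K \<Longrightarrow> norm (H x v) \<le> b" by (auto simp: bounded_pos)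
    then show ?thesis by (intro exI[of _ b]) auto
  qed
  then obtain b where b: "\<And>v. b v \<ge> 0" "\<And>v x. x \<in> K \<Longrightarrow> norm (H x v) \<le> b v" by metis
  show ?thesis
  proof (rule that[of "\<Sum>i\<in>Basis. b i"])
    show "(\<Sum>i\<in>(Basis :: 'a set). b i) \<ge> 0" using b(1) by (simp add: sum_nonneg)
  qed (intro linear_norm_le_of_Basis lin b(2))
qed

lemma has_derivative_grad:
  fixes \<phi> :: "'a::euclidean_space \<Rightarrow> real"
  assumes "\<phi> differentiable at x"
  shows "(\<phi> has_derivative (\<lambda>v. grad \<phi> x \<bullet> v)) (at x)"
proof -
  obtain D where D: "(\<phi> has_derivative D) (at x)" using assms by (auto simp: differentiable_def)
  then have "linear D" by (rule has_derivative_linear)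
  have "D v = (\<Sum>i\<in>Basis. D i *\<^sub>R i) \<bullet> v" for v
    using linear_basis_expansion[OF \<open>linear D\<close>, of v] by (simp add: inner_sum_left mult.commute inner_commute[of v])
  then have "D = (\<lambda>v. (\<Sum>i\<in>Basis. D i *\<^sub>R i) \<bullet> v)" by blast
  with D have "(\<phi> has_derivative (\<lambda>v. (\<Sum>i\<in>Basis. D i *\<^sub>R i) \<bullet> v)) (at x)" by simp
  with grad_eqI[OF this] show ?thesis by simp
qed

lemma test_function_continuous: "test_function \<Omega> \<phi> \<Longrightarrow> continuous_on UNIV \<phi>"
  unfolding test_function_def smooth_on_def using Ck_on_imp_continuous_on by blast

lemma test_function_has_derivative:
  "test_function \<Omega> \<phi> \<Longrightarrow> (\<phi> has_derivative (\<lambda>v. grad \<phi> x \<bullet> v)) (at x)"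
proof (rule has_derivative_grad)
  assume "test_function \<Omega> \<phi>"
  then have "Ck_on (Suc 0) UNIV \<phi>" unfolding test_function_def smooth_on_def by blast
  then show "\<phi> differentiable at x" unfolding Ck_on.simps(2) differentiable_def by auto
qed

lemma test_function_continuous_grad:
  assumes "test_function \<Omega> \<phi>"
  shows "continuous_on UNIV (grad \<phi>)"
proof -
  have "Ck_on (Suc 0) UNIV \<phi>" using assms unfolding test_function_def smooth_on_def by blast
  then obtain D where D: "\<And>x. (\<phi> has_derivative D x) (at x)" "\<And>v. continuous_on UNIV (\<lambda>x. D x v)"
    by auto
  have eq: "D x = (\<lambda>v. grad \<phi> x \<bullet> v)" for x
    using D(1) test_function_has_derivative[OF assms] by (rule has_derivative_unique)
  have "continuous_on UNIV (\<lambda>x. grad \<phi> x \<bullet> v)" for v using D(2)[of v] unfolding eq .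
  then show ?thesis by (rule continuous_on_componentwise[THEN iffD2, OF ballI])
qed

lemma test_function_outside:
  assumes "test_function \<Omega> \<phi>" "x \<notin> closure {x. \<phi> x \<noteq> 0}"
  shows "\<phi> x = 0" "grad \<phi> x = 0"
proof -
  show "\<phi> x = 0" using assms(2) closure_subset[of "{x. \<phi> x \<noteq> 0}"] by auto
  have "(\<phi> has_derivative (\<lambda>v. 0)) (at x)"
    by (rule has_derivative_transform_within_open[of "\<lambda>_. 0" _ _ _ "- closure {x. \<phi> x \<noteq> 0}"])
      (use assms(2) closure_subset[of "{x. \<phi> x \<noteq> 0}"] in auto)
  then show "grad \<phi> x = 0" by (intro grad_eqI) simp
qed

lemma has_derivative_imp_directional_limit:
  fixes F :: "'a::real_normed_vector \<Rightarrow> real"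
  assumes D: "(F has_derivative D) (at x)"
  shows "((\<lambda>t. (F (x + t *\<^sub>R e) - F x) / t) \<longlongrightarrow> D e) (at 0)"
proof -
  have "((\<lambda>t. F (x + t *\<^sub>R e)) has_derivative (\<lambda>t. D (t *\<^sub>R e))) (at 0)"
    by (rule has_derivative_compose[where f="\<lambda>t. x + t *\<^sub>R e" and g=F]) (use D in \<open>auto intro!: derivative_eq_intros\<close>)
  then have "((\<lambda>t. F (x + t *\<^sub>R e)) has_real_derivative D e) (at 0)"
    using linear_scale[OF has_derivative_linear[OF D]]
    by (simp add: has_field_derivative_def mult.commute[of _ "D e"] mult_commute_abs)
  then show ?thesis by (simp add: DERIV_def)
qed

lemma has_derivative_norm_le_of_local_Lipschitz:
  fixes f :: "'a::real_normed_vector \<Rightarrow> real"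
  assumes D: "(f has_derivative D) (at x)" and "r > 0"
    and lip: "\<And>y. y \<in> ball x r \<Longrightarrow> \<bar>f y - f x\<bar> \<le> c * norm (y - x)"
  shows "\<bar>D v\<bar> \<le> c * norm v"
proof -
  have "(\<lambda>t. (f (x + t *\<^sub>R v) - f x) / t) \<midarrow>0\<rightarrow> D v"
    by (rule has_derivative_imp_directional_limit[OF D])
  then have "(\<lambda>t. \<bar>(f (x + t *\<^sub>R v) - f x) / t\<bar>) \<midarrow>0\<rightarrow> \<bar>D v\<bar>" by (rule tendsto_rabs)
  moreover have "\<forall>\<^sub>F t in at 0. \<bar>(f (x + t *\<^sub>R v) - f x) / t\<bar> \<le> c * norm v"
    unfolding eventually_at
  proof (intro exI[of _ "r / (norm v + 1)"] conjI ballI impI)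
    show "r / (norm v + 1) > 0" using \<open>r > 0\<close> by (simp add: add_nonneg_pos)
    fix t :: real assume t: "t \<noteq> 0 \<and> dist t 0 < r / (norm v + 1)"
    have "norm v + 1 > 0" by (simp add: add_nonneg_pos)
    then have "\<bar>t\<bar> * (norm v + 1) < r" using t by (simp add: field_simps)
    then have "\<bar>t\<bar> * norm v < r" by (simp add: distrib_left)
    then have "\<bar>f (x + t *\<^sub>R v) - f x\<bar> \<le> c * norm (x + t *\<^sub>R v - x)"
      by (intro lip) (simp add: dist_norm)
    then show "\<bar>(f (x + t *\<^sub>R v) - f x) / t\<bar> \<le> c * norm v"
      using t by (simp add: abs_divide divide_le_eq mult_ac)
  qed
  ultimately show ?thesis by (rule tendsto_upperbound) simp
qed

section \<open>Mollification\<close>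

lemma lborel_integral_reflect_shift:
  fixes f :: "'a::euclidean_space \<Rightarrow> 'b::{banach,second_countable_topology}"
  assumes "f \<in> borel_measurable borel"
  shows "(LINT y|lborel. f (x - y)) = (LINT y|lborel. f y)"
proof -
  have eq: "lborel = distr lborel borel (\<lambda>y. x - y)"
    using lborel_affine[of "-1" x] by (simp add: density_1)
  show ?thesis using assms by (subst (2) eq) (simp add: integral_distr)
qed

lemma integrable_continuous_compact_support:
  fixes f :: "'a::euclidean_space \<Rightarrow> 'b::{banach,second_countable_topology}"
  assumes "continuous_on UNIV f" "compact K" "\<And>x. x \<notin> K \<Longrightarrow> f x = 0"
  shows "integrable lborel f"
proof -
  have "integrable lborel (\<lambda>x. indicator K x *\<^sub>R f x)"
    by (rule borel_integrable_compact) (use assms(2) continuous_on_subset[OF assms(1)] in auto)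
  moreover have "(\<lambda>x. indicator K x *\<^sub>R f x) = f" using assms(3) by (auto simp: indicator_def fun_eq_iff)
  ultimately show ?thesis by simp
qed

lemma bump_exists:
  assumes "d > 0"
  obtains \<rho> :: "'a::euclidean_space \<Rightarrow> real" where "\<And>k. Ck_on k UNIV \<rho>" "\<And>x. \<rho> x \<ge> 0"
    "\<And>x. norm x \<ge> d \<Longrightarrow> \<rho> x = 0" "integrable lborel \<rho>" "(LINT x|lborel. \<rho> x) = 1"
proof -
  define \<beta> where "\<beta> x = flat 0 (d\<^sup>2 - x \<bullet> x)" for x :: 'a
  have nn: "\<beta> x \<ge> 0" for x by (simp add: \<beta>_def flat_def)
  have iff: "x \<bullet> x < d\<^sup>2 \<longleftrightarrow> norm x < d" for x :: 'a
    using \<open>d > 0\<close> norm_lt_square[of x d] by (simp add: power2_eq_square)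
  then have zero: "norm x \<ge> d \<Longrightarrow> \<beta> x = 0" and pos: "norm x < d \<Longrightarrow> \<beta> x > 0" for x
    by (auto simp: \<beta>_def flat_def not_less[symmetric])
  have Ck: "Ck_on k UNIV \<beta>" for k unfolding \<beta>_def by (rule Ck_on_flat_ball)
  have int: "integrable lborel \<beta>"
    by (rule integrable_continuous_compact_support[of _ "cball 0 d"])
      (use Ck[of 0] zero in auto)
  have "(LINT x|lborel. \<beta> x) \<noteq> 0"
  proof
    assume "(LINT x|lborel. \<beta> x) = 0"
    then have "AE x in lborel. \<beta> x = 0" using integral_nonneg_eq_0_iff_AE[OF int] nn by auto
    then have "AE x in lborel. x \<notin> ball (0::'a) d" by eventually_elim (use pos in fastforce)
    then have "ball (0::'a) d \<in> null_sets lborel"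
      by (subst (asm) AE_iff_null_sets[symmetric]) auto
    then have "negligible (ball (0::'a) d)"
      by (simp add: negligible_iff_null_sets null_sets_completionI)
    then show False using open_not_negligible[of "ball (0::'a) d"] \<open>d > 0\<close> by auto
  qed
  moreover have "(LINT x|lborel. \<beta> x) \<ge> 0" using nn by (intro integral_nonneg_AE) auto
  ultimately have I: "(LINT x|lborel. \<beta> x) > 0" by simp
  show ?thesis
  proof (rule that[of "\<lambda>x. inverse (LINT x|lborel. \<beta> x) * \<beta> x"])
    show "Ck_on k UNIV (\<lambda>x. inverse (LINT x|lborel. \<beta> x) * \<beta> x)" for k
      by (intro Ck_on_mult Ck_on_const Ck)
    show "integrable lborel (\<lambda>x. inverse (LINT x|lborel. \<beta> x) * \<beta> x)" using int by simp
    show "(LINT x|lborel. inverse (LINT x|lborel. \<beta> x) * \<beta> x) = 1" using I by simp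
  qed (use I nn zero in auto)
qed

lemma continuous_on_of_Lipschitz:
  fixes f :: "'a::real_normed_vector \<Rightarrow> 'b::real_normed_vector"
  assumes "\<And>x y. norm (f x - f y) \<le> c * norm (x - y)" "c > 0"
  shows "continuous_on S f"
  unfolding continuous_on_iff
proof (intro ballI allI impI)
  fix x and e :: real assume "e > 0"
  show "\<exists>d>0. \<forall>x'\<in>S. dist x' x < d \<longrightarrow> dist (f x') (f x) < e"
  proof (intro exI[of _ "e / c"] conjI ballI impI)
    show "e / c > 0" using \<open>e > 0\<close> assms(2) by simp
    fix y assume "dist y x < e / c"
    then have "c * norm (y - x) < e" using assms(2) by (simp add: dist_norm field_simps)
    then show "dist (f y) (f x) < e" using assms(1)[of y x] by (simp add: dist_norm)
  qed
qed

text \<open>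
  The approximation \<open>\<rho> * v\<close> of a Lipschitz function by test functions. The last property replaces
  any statement about convergence of gradients: averaging does not increase Lipschitz constants,
  and it commutes with subtracting a linear function, so wherever \<open>v\<close> is \<open>c\<close>-Lipschitz close to the
  linear function \<open>g \<bullet> y\<close>, the gradient of the mollification is within \<open>c\<close> of \<open>g\<close>.
\<close>

lemma mollification:
  fixes v :: "'a::euclidean_space \<Rightarrow> real"
  assumes lip: "\<And>x y. \<bar>v x - v y\<bar> \<le> L * norm (x - y)"
    and \<Omega>: "open \<Omega>" "compact C" "C \<subseteq> \<Omega>" and out: "\<And>x. x \<notin> C \<Longrightarrow> v x = 0" and "\<delta> > 0"
  obtains \<phi> where "test_function \<Omega> \<phi>" "\<And>x. \<bar>\<phi> x - v x\<bar> \<le> L * \<delta>"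
    "\<And>x g c. c \<ge> 0 \<Longrightarrow> (\<And>y z. y \<in> ball x \<delta> \<Longrightarrow> z \<in> ball x \<delta> \<Longrightarrow>
        \<bar>v y - v z - g \<bullet> (y - z)\<bar> \<le> c * norm (y - z)) \<Longrightarrow> norm (grad \<phi> x - g) \<le> c"
proof -
  have "L \<ge> 0"
  proof -
    obtain i :: 'a where "i \<in> Basis" by fastforce
    with lip[of i 0] show ?thesis by (metis abs_ge_zero diff_zero mult.right_neutral norm_Basis order_trans)
  qed
  have contv: "continuous_on UNIV v"
  proof (rule continuous_on_of_Lipschitz)
    show "norm (v x - v y) \<le> (L + 1) * norm (x - y)" for x y
      using lip[of x y] norm_ge_zero[of "x - y"] by (simp add: distrib_right del: norm_ge_zero)
  qed (use \<open>L \<ge> 0\<close> in simp)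
  obtain e where e: "e > 0" "(\<Union>x\<in>C. cball x e) \<subseteq> \<Omega>"
    using compact_subset_open_imp_cball_epsilon_subset[OF \<Omega>(2,1,3)] by blast
  define d where "d = min (\<delta> / 2) e"
  have d: "d > 0" "d \<le> \<delta> / 2" "d \<le> e" using e \<open>\<delta> > 0\<close> by (auto simp: d_def)
  obtain \<rho> :: "'a \<Rightarrow> real" where \<rho>: "\<And>k. Ck_on k UNIV \<rho>" "\<And>x. \<rho> x \<ge> 0"
    "\<And>x. norm x \<ge> d \<Longrightarrow> \<rho> x = 0" "integrable lborel \<rho>" "(LINT x|lborel. \<rho> x) = 1"
    using bump_exists[OF \<open>d > 0\<close>] by blast
  have cont\<rho>: "continuous_on UNIV \<rho>" using \<rho>(1)[of 0] by simp
  obtain a where a: "C \<subseteq> cbox (-a) a" using bounded_subset_cbox_symmetric compact_imp_bounded[OF \<Omega>(2)] by blast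
  define \<phi> where "\<phi> x = integral (cbox (-a) a) (\<lambda>y. \<rho> (x - y) * v y)" for x
  have contc: "continuous_on S (\<lambda>y. \<rho> (x - y) * v y)" for x S
    by (intro continuous_on_mult continuous_on_compose2[OF cont\<rho>, of _ "\<lambda>y. x - y"]
          continuous_on_subset[OF contv] continuous_intros) auto
  have contr: "continuous_on S (\<lambda>z. \<rho> z * v (x - z))" for x S
    by (intro continuous_on_mult continuous_on_compose2[OF contv, of _ "\<lambda>y. x - y"]
          continuous_on_subset[OF cont\<rho>] continuous_intros) auto
  have \<phi>_lborel: "\<phi> x = (LINT z|lborel. \<rho> z * v (x - z))" for x
  proof -
    have "set_integrable lborel (cbox (-a) a) (\<lambda>y. \<rho> (x - y) * v y)"
      unfolding set_integrable_def by (rule borel_integrable_compact) (auto intro: contc)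
    from set_borel_integral_eq_integral(2)[OF this]
    have "\<phi> x = (LINT y|lborel. indicator (cbox (-a) a) y *\<^sub>R (\<rho> (x - y) * v y))"
      by (simp add: \<phi>_def set_lebesgue_integral_def)
    also have "\<dots> = (LINT y|lborel. \<rho> (x - y) * v (x - (x - y)))"
      by (rule Bochner_Integration.integral_cong) (use a out in \<open>auto simp: indicator_def\<close>)
    also have "\<dots> = (LINT z|lborel. \<rho> z * v (x - z))"
      by (rule lborel_integral_reflect_shift) (intro borel_measurable_continuous_onI contr)
    finally show ?thesis .
  qed
  have intr: "integrable lborel (\<lambda>z. \<rho> z * v (x - z))" for x
    by (rule integrable_continuous_compact_support[of _ "cball 0 d"]) (rule contr, simp, simp add: \<rho>(3))
  \<comment> \<open>averaging with the weight \<open>\<rho>\<close> does not increase a bound that holds on \<open>ball 0 d\<close>\<close>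
  have avg: "\<bar>LINT z|lborel. \<rho> z * f z\<bar> \<le> c"
    if "integrable lborel (\<lambda>z. \<rho> z * f z)" "\<And>z. norm z < d \<Longrightarrow> \<bar>f z\<bar> \<le> c" for f c
  proof -
    have le: "\<bar>\<rho> z\<bar> * \<bar>f z\<bar> \<le> \<rho> z * c" for z
      using \<rho>(2)[of z] \<rho>(3)[of z] that(2)[of z] by (cases "norm z < d") (auto intro: mult_left_mono)
    have "\<bar>LINT z|lborel. \<rho> z * f z\<bar> \<le> (LINT z|lborel. \<rho> z * c)"
      by (rule integral_abs_bound_integral)
        (use that(1) \<rho>(4) le in \<open>auto simp: abs_mult\<close>)
    then show ?thesis using \<rho>(5) by simp
  qed
  have smooth: "smooth_on UNIV \<phi>"
    unfolding smooth_on_def \<phi>_def using Ck_on_convolution[OF \<rho>(1) contv] by blast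
  have nz: "\<exists>y\<in>C. norm (x - y) < d" if "\<phi> x \<noteq> 0" for x
  proof (rule ccontr)
    assume "\<not> (\<exists>y\<in>C. norm (x - y) < d)"
    then have "\<rho> z * v (x - z) = 0" for z
      using \<rho>(3)[of z] out[of "x - z"] by (cases "norm z < d") force+
    then have "\<phi> x = (LINT z::'a|lborel. 0)" by (simp only: \<phi>_lborel)
    then show False using that by simp
  qed
  define K where "K = {x + y | x y. x \<in> C \<and> y \<in> cball 0 d}"
  have "compact K" unfolding K_def by (intro compact_sums \<Omega>(2) compact_cball)
  have sub: "{x. \<phi> x \<noteq> 0} \<subseteq> K"
  proof
    fix x assume "x \<in> {x. \<phi> x \<noteq> 0}"
    then obtain y where "y \<in> C" "norm (x - y) < d" using nz by auto
    then show "x \<in> K" unfolding K_def by (intro CollectI exI[of _ y] exI[of _ "x - y"]) auto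
  qed
  then have cl: "closure {x. \<phi> x \<noteq> 0} \<subseteq> K" using \<open>compact K\<close> by (simp add: closure_minimal compact_imp_closed)
  have "K \<subseteq> \<Omega>" using e(2) d(3) unfolding K_def by (fastforce simp: dist_norm)
  have test: "test_function \<Omega> \<phi>"
    unfolding test_function_def
  proof (intro conjI smooth)
    show "compact (closure {x. \<phi> x \<noteq> 0})"
      using \<open>compact K\<close> sub bounded_subset compact_closure compact_imp_bounded by blast
  qed (use cl \<open>K \<subseteq> \<Omega>\<close> in auto)
  have close: "\<bar>\<phi> x - v x\<bar> \<le> L * \<delta>" for x
  proof -
    have "\<phi> x - v x = (LINT z|lborel. \<rho> z * v (x - z)) - (LINT z|lborel. \<rho> z * v x)"
      using \<rho>(5) by (simp add: \<phi>_lborel)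
    also have "\<dots> = (LINT z|lborel. \<rho> z * (v (x - z) - v x))"
      using intr \<rho>(4) by (simp add: right_diff_distrib)
    also have "\<bar>\<dots>\<bar> \<le> L * \<delta>"
    proof (rule avg)
      show "integrable lborel (\<lambda>z. \<rho> z * (v (x - z) - v x))"
        using intr \<rho>(4) by (simp add: right_diff_distrib)
      fix z :: 'a assume "norm z < d"
      then have "L * norm (x - z - x) \<le> L * \<delta>" using d(1,2) \<open>L \<ge> 0\<close> by (intro mult_left_mono) auto
      then show "\<bar>v (x - z) - v x\<bar> \<le> L * \<delta>" using lip order_trans by blast
    qed
    finally show ?thesis .
  qed
  have gr: "norm (grad \<phi> x - g) \<le> c"
    if "c \<ge> 0" and loc: "\<And>y z. y \<in> ball x \<delta> \<Longrightarrow> z \<in> ball x \<delta> \<Longrightarrow> \<bar>v y - v z - g \<bullet> (y - z)\<bar> \<le> c * norm (y - z)"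
    for x g c
  proof -
    have D: "((\<lambda>y. \<phi> y - g \<bullet> y) has_derivative (\<lambda>w. (grad \<phi> x - g) \<bullet> w)) (at x)"
      by (rule has_derivative_eq_rhs[OF has_derivative_diff[OF test_function_has_derivative[OF test]]])
        (auto intro!: derivative_eq_intros simp: inner_diff_left)
    have "\<bar>(\<phi> y - g \<bullet> y) - (\<phi> x - g \<bullet> x)\<bar> \<le> c * norm (y - x)" if y: "y \<in> ball x (\<delta> / 2)" for y
    proof -
      have "(\<phi> y - g \<bullet> y) - (\<phi> x - g \<bullet> x)
          = (LINT z|lborel. \<rho> z * v (y - z)) - (LINT z|lborel. \<rho> z * v (x - z)) - (LINT z|lborel. \<rho> z * (g \<bullet> (y - x)))"
        using \<rho>(5) by (simp add: \<phi>_lborel inner_diff_right)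
      also have "\<dots> = (LINT z|lborel. \<rho> z * (v (y - z) - v (x - z) - g \<bullet> (y - x)))"
        using intr \<rho>(4) by (simp add: right_diff_distrib)
      also have "\<bar>\<dots>\<bar> \<le> c * norm (y - x)"
      proof (rule avg)
        show "integrable lborel (\<lambda>z. \<rho> z * (v (y - z) - v (x - z) - g \<bullet> (y - x)))"
          using intr \<rho>(4) by (simp add: right_diff_distrib)
        fix z :: 'a assume z: "norm z < d"
        have "dist x (y - z) \<le> dist x y + norm z"
          using norm_triangle_ineq[of "x - y" z] by (simp add: dist_norm algebra_simps)
        then have "y - z \<in> ball x \<delta>" "x - z \<in> ball x \<delta>" using y z d by (auto simp: dist_norm)
        from loc[OF this] show "\<bar>v (y - z) - v (x - z) - g \<bullet> (y - x)\<bar> \<le> c * norm (y - x)" by simp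
      qed
      finally show ?thesis .
    qed
    from has_derivative_norm_le_of_local_Lipschitz[OF D half_gt_zero[OF \<open>\<delta> > 0\<close>] this, where v="grad \<phi> x - g"]
    have "norm (grad \<phi> x - g) * norm (grad \<phi> x - g) \<le> c * norm (grad \<phi> x - g)"
      by (simp add: dot_square_norm power2_eq_square)
    then show ?thesis using \<open>c \<ge> 0\<close> by (cases "grad \<phi> x = g") auto
  qed
  show ?thesis using that[OF test close gr] by blast
qed

section \<open>Integration by parts\<close>

lemma lborel_integral_translation:
  fixes f :: "'a::euclidean_space \<Rightarrow> 'b::{banach,second_countable_topology}"
  assumes "f \<in> borel_measurable borel"
  shows "(LINT y|lborel. f (y + x)) = (LINT y|lborel. f y)"
proof -
  have eq: "lborel = distr lborel borel (\<lambda>y. y + x)"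
    using lborel_affine[of "1" x] by (simp add: density_1 add.commute)
  show ?thesis using assms by (subst (2) eq) (simp add: integral_distr)
qed

text \<open>
  By translation invariance every difference quotient of \<open>F\<close> has integral \<open>0\<close>. They are dominated
  because \<open>F\<close> is Lipschitz with compact support, so the limit has integral \<open>0\<close> as well. The form with
  derivatives almost everywhere serves the piecewise linear cut-off in \<open>divergence_theorem_ball\<close>.
\<close>

lemma integral_directional_derivative_eq_0:
  fixes F F' :: "'a::euclidean_space \<Rightarrow> real"
  assumes lip: "\<And>x y. \<bar>F x - F y\<bar> \<le> L * norm (x - y)"
    and contF: "continuous_on UNIV F" and K: "compact K" "\<And>x. x \<notin> K \<Longrightarrow> F x = 0"
    and meas[measurable]: "F' \<in> borel_measurable lborel"
    and lim: "AE x in lborel. ((\<lambda>t. (F (x + t *\<^sub>R e) - F x) / t) \<longlongrightarrow> F' x) (at 0)"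
  shows "integrable lborel F'" "(LINT x|lborel. F' x) = 0"
proof -
  have intF: "integrable lborel F" using integrable_continuous_compact_support contF K by blast
  have [measurable]: "F \<in> borel_measurable borel" by (rule borel_measurable_continuous_onI[OF contF])
  obtain B where B: "\<And>x. x \<in> K \<Longrightarrow> norm x \<le> B" using compact_imp_bounded[OF K(1)] by (auto simp: bounded_iff)
  define t where "t n = inverse (real (Suc n))" for n
  have t: "t n > 0" "t n \<le> 1" for n by (auto simp: t_def field_simps)
  have t0: "t \<longlonglongrightarrow> 0" unfolding t_def by (rule LIMSEQ_inverse_real_of_nat)
  have tn: "t n \<noteq> 0" for n using t(1)[of n] by simp
  have "filterlim t (at 0) sequentially" using t0 tn by (simp add: filterlim_at)
  define s where "s n x = (F (x + t n *\<^sub>R e) - F x) / t n" for n x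
  have intF2: "integrable lborel (\<lambda>x. F (x + a))" for a
  proof -
    have "integrable (distr lborel borel (\<lambda>y. y + a)) F"
      using lborel_affine[of "1" a] intF by (simp add: density_1 add.commute)
    then show ?thesis by (simp add: integrable_distr_eq)
  qed
  have int0: "(LINT x|lborel. s n x) = 0" for n
    using lborel_integral_translation[of F "t n *\<^sub>R e"] intF intF2 unfolding s_def by simp
  define w where "w x = L * norm e * indicator (cball 0 (B + norm e)) x" for x :: 'a
  have dom: "norm (s n x) \<le> w x" for n x
  proof (cases "norm x \<le> B + norm e")
    case True
    have "\<bar>F (x + t n *\<^sub>R e) - F x\<bar> \<le> L * norm (t n *\<^sub>R e)" using lip[of "x + t n *\<^sub>R e" x] by simp
    then show ?thesis using True t[of n] by (simp add: s_def w_def field_simps)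
  next
    case False
    have "norm x \<le> norm (x + t n *\<^sub>R e) + norm (t n *\<^sub>R e)"
      using norm_triangle_ineq4[of "x + t n *\<^sub>R e" "t n *\<^sub>R e"] by simp
    moreover have "norm (t n *\<^sub>R e) \<le> norm e" using t[of n] by (simp add: mult_left_le_one_le)
    ultimately have "x + t n *\<^sub>R e \<notin> K" using False B by fastforce
    moreover have "x \<notin> K" using False B norm_ge_zero[of e] by fastforce
    ultimately show ?thesis using False K(2) by (simp add: s_def w_def)
  qed
  have intw: "integrable lborel w" unfolding w_def
    by (intro integrable_mult_right integrable_real_indicator)
      (use emeasure_lborel_cball_finite[of "0::'a" "B + norm e"] in auto)
  have limAE: "AE x in lborel. (\<lambda>n. s n x) \<longlonglongrightarrow> F' x"
    using lim by eventually_elim (auto simp: s_def intro: filterlim_compose[OF _ \<open>filterlim t (at 0) sequentially\<close>])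
  have sm: "s n \<in> borel_measurable lborel" for n unfolding s_def by measurable
  show "integrable lborel F'"
    by (rule integrable_dominated_convergence[where s=s and w=w]) (use meas sm intw limAE dom in auto)
  have "(\<lambda>n. LINT x|lborel. s n x) \<longlonglongrightarrow> (LINT x|lborel. F' x)"
    by (rule integral_dominated_convergence[where w=w]) (use meas sm intw limAE dom in auto)
  then show "(LINT x|lborel. F' x) = 0" unfolding int0 by (rule LIMSEQ_unique[OF _ tendsto_const])
qed

lemma integral_partial_derivative_C1_eq_0:
  fixes F :: "'a::euclidean_space \<Rightarrow> real"
  assumes D: "\<And>x. (F has_derivative (\<lambda>v. G x \<bullet> v)) (at x)" and contG: "continuous_on UNIV G"
    and K: "compact K" "\<And>x. x \<notin> K \<Longrightarrow> F x = 0"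
  shows "integrable lborel (\<lambda>x. G x \<bullet> e)" "(LINT x|lborel. G x \<bullet> e) = 0"
proof -
  have G0: "G x = 0" if "x \<notin> K" for x
  proof -
    have "((\<lambda>_. 0) has_derivative (\<lambda>v. G x \<bullet> v)) (at x)"
      by (rule has_derivative_transform_within_open[OF D, of "- K"])
        (use that K compact_imp_closed in auto)
    then have "(\<lambda>v. G x \<bullet> v) = (\<lambda>v. 0)" by (rule has_derivative_unique) simp
    then show ?thesis by (metis inner_eq_zero_iff)
  qed
  have "bounded (G ` K)"
    by (intro compact_imp_bounded compact_continuous_image continuous_on_subset[OF contG] K) auto
  then obtain L where L: "\<And>x. x \<in> K \<Longrightarrow> norm (G x) \<le> L" "L > 0" by (auto simp: bounded_pos)
  then have L': "norm (G x) \<le> L" for x using G0[of x] by (cases "x \<in> K") auto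
  have lip: "\<bar>F x - F y\<bar> \<le> L * norm (x - y)" for x y
  proof -
    have "norm (F x - F y) \<le> L * norm (x - y)"
    proof (rule differentiable_bound[where S=UNIV and f'="\<lambda>x v. G x \<bullet> v"])
      show "onorm (\<lambda>v. G z \<bullet> v) \<le> L" for z
      proof (rule onorm_le)
        fix v
        have "norm (G z \<bullet> v) \<le> norm (G z) * norm v" by (simp add: Cauchy_Schwarz_ineq2)
        also have "\<dots> \<le> L * norm v" by (intro mult_right_mono L') simp
        finally show "norm (G z \<bullet> v) \<le> L * norm v" .
      qed
    qed (use D in auto)
    then show ?thesis by simp
  qed
  have contF: "continuous_on UNIV F" using D by (intro has_derivative_continuous_on) auto
  have m: "(\<lambda>x. G x \<bullet> e) \<in> borel_measurable lborel"
    using borel_measurable_continuous_onI[OF contG] by (simp add: borel_measurable_inner)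
  have l: "AE x in lborel. ((\<lambda>t. (F (x + t *\<^sub>R e) - F x) / t) \<longlongrightarrow> G x \<bullet> e) (at 0)"
    by (intro AE_I2 has_derivative_imp_directional_limit D)
  show "integrable lborel (\<lambda>x. G x \<bullet> e)" "(LINT x|lborel. G x \<bullet> e) = 0"
    using integral_directional_derivative_eq_0[OF lip contF K m l] by auto
qed

section \<open>Square integrable functions\<close>

lemma L2_on_add_scaleR:
  assumes "L2_on \<Omega> f" "L2_on \<Omega> g"
  shows "L2_on \<Omega> (\<lambda>x. f x + c *\<^sub>R g x)"
proof -
  have [measurable]: "f \<in> borel_measurable (lebesgue_on \<Omega>)" "g \<in> borel_measurable (lebesgue_on \<Omega>)"
    using assms by (auto simp: L2_on_def)
  have "integrable (lebesgue_on \<Omega>) (\<lambda>x. 2 * (norm (f x))\<^sup>2 + 2 * c\<^sup>2 * (norm (g x))\<^sup>2)"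
    using assms by (auto simp: L2_on_def)
  then have "integrable (lebesgue_on \<Omega>) (\<lambda>x. (norm (f x + c *\<^sub>R g x))\<^sup>2)"
  proof (rule Bochner_Integration.integrable_bound)
    show "AE x in lebesgue_on \<Omega>. norm ((norm (f x + c *\<^sub>R g x))\<^sup>2) \<le> norm (2 * (norm (f x))\<^sup>2 + 2 * c\<^sup>2 * (norm (g x))\<^sup>2)"
    proof (rule AE_I2)
      fix x
      have "(norm (f x + c *\<^sub>R g x))\<^sup>2 \<le> (norm (f x) + \<bar>c\<bar> * norm (g x))\<^sup>2"
        using norm_triangle_ineq[of "f x" "c *\<^sub>R g x"] by (intro power_mono) auto
      also have "\<dots> \<le> 2 * (norm (f x))\<^sup>2 + 2 * (\<bar>c\<bar> * norm (g x))\<^sup>2"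
        using sum_squares_bound[of "norm (f x)" "\<bar>c\<bar> * norm (g x)"] by (simp add: power2_sum)
      finally show "norm ((norm (f x + c *\<^sub>R g x))\<^sup>2) \<le> norm (2 * (norm (f x))\<^sup>2 + 2 * c\<^sup>2 * (norm (g x))\<^sup>2)"
        by (simp add: power_mult_distrib)
    qed
  qed measurable
  then show ?thesis by (simp add: L2_on_def)
qed

lemma L2_on_diff: "L2_on \<Omega> f \<Longrightarrow> L2_on \<Omega> g \<Longrightarrow> L2_on \<Omega> (\<lambda>x. f x - g x)"
  using L2_on_add_scaleR[of \<Omega> f g "-1"] by simp

lemma L2_on_inner_integrable:
  assumes "L2_on \<Omega> f" "L2_on \<Omega> g"
  shows "integrable (lebesgue_on \<Omega>) (\<lambda>x. f x \<bullet> g x)"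
proof -
  have [measurable]: "f \<in> borel_measurable (lebesgue_on \<Omega>)" "g \<in> borel_measurable (lebesgue_on \<Omega>)"
    using assms by (auto simp: L2_on_def)
  have "integrable (lebesgue_on \<Omega>) (\<lambda>x. (norm (f x))\<^sup>2 + (norm (g x))\<^sup>2)"
    using assms by (auto simp: L2_on_def)
  then show ?thesis
  proof (rule Bochner_Integration.integrable_bound)
    show "AE x in lebesgue_on \<Omega>. norm (f x \<bullet> g x) \<le> norm ((norm (f x))\<^sup>2 + (norm (g x))\<^sup>2)"
    proof (rule AE_I2)
      fix x
      have "\<bar>f x \<bullet> g x\<bar> \<le> norm (f x) * norm (g x)" by (rule Cauchy_Schwarz_ineq2)
      also have "\<dots> \<le> (norm (f x))\<^sup>2 + (norm (g x))\<^sup>2"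
        using sum_squares_bound[of "norm (f x)" "norm (g x)"] mult_nonneg_nonneg[of "norm (f x)" "norm (g x)"]
        by (simp del: mult_nonneg_nonneg)
      finally show "norm (f x \<bullet> g x) \<le> norm ((norm (f x))\<^sup>2 + (norm (g x))\<^sup>2)" by simp
    qed
  qed measurable
qed

lemma L2_on_bounded_mult:
  assumes "L2_on \<Omega> f" "a \<in> borel_measurable (lebesgue_on \<Omega>)" "\<And>x. \<bar>a x\<bar> \<le> A"
  shows "L2_on \<Omega> (\<lambda>x. a x *\<^sub>R f x)"
proof -
  have [measurable]: "f \<in> borel_measurable (lebesgue_on \<Omega>)" "a \<in> borel_measurable (lebesgue_on \<Omega>)"
    using assms by (auto simp: L2_on_def)
  have "integrable (lebesgue_on \<Omega>) (\<lambda>x. A\<^sup>2 * (norm (f x))\<^sup>2)"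
    using assms by (auto simp: L2_on_def)
  then have "integrable (lebesgue_on \<Omega>) (\<lambda>x. (norm (a x *\<^sub>R f x))\<^sup>2)"
  proof (rule Bochner_Integration.integrable_bound)
    show "AE x in lebesgue_on \<Omega>. norm ((norm (a x *\<^sub>R f x))\<^sup>2) \<le> norm (A\<^sup>2 * (norm (f x))\<^sup>2)"
      using assms(3) by (intro AE_I2) (auto simp: power_mult_distrib abs_le_square_iff[symmetric] intro!: mult_right_mono
        order_trans[OF assms(3) abs_ge_self])
  qed measurable
  then show ?thesis by (simp add: L2_on_def)
qed

lemma L2_on_bounded:
  assumes "\<Omega> \<in> lmeasurable" "f \<in> borel_measurable (lebesgue_on \<Omega>)" "\<And>x. x \<in> \<Omega> \<Longrightarrow> norm (f x) \<le> B"
  shows "L2_on \<Omega> f"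
proof -
  have [measurable]: "f \<in> borel_measurable (lebesgue_on \<Omega>)" by fact
  interpret finite_measure "lebesgue_on \<Omega>"
    using assms(1) by (simp add: finite_measure_lebesgue_on)
  have "integrable (lebesgue_on \<Omega>) (\<lambda>x. (norm (f x))\<^sup>2)"
  proof (rule integrable_const_bound[where B="B\<^sup>2"])
    show "AE x in lebesgue_on \<Omega>. norm ((norm (f x))\<^sup>2) \<le> B\<^sup>2"
      using assms(3) by (intro AE_I2) (auto intro: power_mono)
  qed measurable
  then show ?thesis by (simp add: L2_on_def)
qed

text \<open>
  The integral of \<open>|f - s g|\<^sup>2\<close> is a nonnegative quadratic polynomial in \<open>s\<close>.
\<close>

lemma L2_on_Cauchy_Schwarz:
  assumes "L2_on \<Omega> f" "L2_on \<Omega> g"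
  shows "(LINT x|lebesgue_on \<Omega>. f x \<bullet> g x)\<^sup>2
    \<le> (LINT x|lebesgue_on \<Omega>. (norm (f x))\<^sup>2) * (LINT x|lebesgue_on \<Omega>. (norm (g x))\<^sup>2)" (is "?I\<^sup>2 \<le> ?F * ?G")
proof -
  have i: "integrable (lebesgue_on \<Omega>) (\<lambda>x. (norm (f x))\<^sup>2)" "integrable (lebesgue_on \<Omega>) (\<lambda>x. (norm (g x))\<^sup>2)"
    using assms by (auto simp: L2_on_def)
  have q: "0 \<le> ?F - 2 * s * ?I + s\<^sup>2 * ?G" for s
  proof -
    have "0 \<le> (LINT x|lebesgue_on \<Omega>. (norm (f x - s *\<^sub>R g x))\<^sup>2)" by simp
    also have "\<dots> = (LINT x|lebesgue_on \<Omega>. (norm (f x))\<^sup>2 - 2 * s * (f x \<bullet> g x) + s\<^sup>2 * (norm (g x))\<^sup>2)"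
      unfolding power2_norm_eq_inner
      by (rule Bochner_Integration.integral_cong[OF refl])
        (simp add: inner_diff_left inner_diff_right inner_commute[of "g _" "f _"] algebra_simps power2_eq_square)
    also have "\<dots> = ?F - 2 * s * ?I + s\<^sup>2 * ?G"
      using i L2_on_inner_integrable[OF assms] by simp
    finally show ?thesis .
  qed
  have G: "?G \<ge> 0" by simp
  show ?thesis
  proof (cases "?G = 0")
    case True
    have "?I = 0"
    proof (rule ccontr)
      assume "?I \<noteq> 0"
      then show False using q[of "(?F + 1) / (2 * ?I)"] True by (simp add: field_simps)
    qed
    then show ?thesis using True by simp
  next
    case False
    then have "?G > 0" using G by linarith
    have "0 \<le> ?F - ?I\<^sup>2 / ?G"
      using q[of "?I / ?G"] \<open>?G > 0\<close> by (simp add: power2_eq_square field_simps)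
    then show ?thesis using \<open>?G > 0\<close> by (simp add: field_simps)
  qed
qed

text \<open>
  Every equation below that passes to the limit along test functions is linear in the converging
  sequence, so it suffices to pair the sequence with a fixed square integrable function.
\<close>

lemma L2_on_weak_limit:
  assumes f: "\<And>k. L2_on \<Omega> (f k)" "L2_on \<Omega> F" "L2_on \<Omega> p"
    and lim: "(\<lambda>k. LINT x|lebesgue_on \<Omega>. (norm (f k x - F x))\<^sup>2) \<longlonglongrightarrow> 0"
  shows "(\<lambda>k. LINT x|lebesgue_on \<Omega>. f k x \<bullet> p x) \<longlonglongrightarrow> (LINT x|lebesgue_on \<Omega>. F x \<bullet> p x)"
proof -
  let ?P = "LINT x|lebesgue_on \<Omega>. (norm (p x))\<^sup>2"
  have "(\<lambda>k. (LINT x|lebesgue_on \<Omega>. f k x \<bullet> p x) - (LINT x|lebesgue_on \<Omega>. F x \<bullet> p x)) \<longlonglongrightarrow> 0"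
  proof (rule Lim_null_comparison)
    show "\<forall>\<^sub>F k in sequentially. norm ((LINT x|lebesgue_on \<Omega>. f k x \<bullet> p x) - (LINT x|lebesgue_on \<Omega>. F x \<bullet> p x))
        \<le> sqrt ((LINT x|lebesgue_on \<Omega>. (norm (f k x - F x))\<^sup>2) * ?P)"
    proof (rule always_eventually, rule allI)
      fix k
      have "(LINT x|lebesgue_on \<Omega>. f k x \<bullet> p x) - (LINT x|lebesgue_on \<Omega>. F x \<bullet> p x)
        = (LINT x|lebesgue_on \<Omega>. (f k x - F x) \<bullet> p x)"
        using L2_on_inner_integrable[OF f(1)[of k] f(3)] L2_on_inner_integrable[OF f(2,3)]
        by (simp add: inner_diff_left)
      with L2_on_Cauchy_Schwarz[OF L2_on_diff[OF f(1)[of k] f(2)] f(3)]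
      show "norm ((LINT x|lebesgue_on \<Omega>. f k x \<bullet> p x) - (LINT x|lebesgue_on \<Omega>. F x \<bullet> p x))
        \<le> sqrt ((LINT x|lebesgue_on \<Omega>. (norm (f k x - F x))\<^sup>2) * ?P)"
        by (simp add: real_le_rsqrt)
    qed
    show "(\<lambda>k. sqrt ((LINT x|lebesgue_on \<Omega>. (norm (f k x - F x))\<^sup>2) * ?P)) \<longlonglongrightarrow> 0"
      using tendsto_real_sqrt[OF tendsto_mult[OF lim tendsto_const[of ?P]]] by simp
  qed
  then show ?thesis by (simp add: LIM_zero_iff)
qed

text \<open>
  The increments of a sequence with geometric Cauchy rate have summable \<open>L\<^sup>1\<close> norms, because the
  domain has finite measure; hence the sequence converges almost everywhere, and Fatou's lemma
  turns the Cauchy rate into a rate of convergence to the limit. The maximising sequences below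
  can be chosen with such a rate.
\<close>

lemma L2_on_complete:
  fixes f :: "nat \<Rightarrow> 'a::euclidean_space \<Rightarrow> 'b::euclidean_space"
  assumes \<Omega>: "\<Omega> \<in> lmeasurable" and f: "\<And>k. L2_on \<Omega> (f k)"
    and Cauchy: "\<And>k l. k \<le> l \<Longrightarrow> (LINT x|lebesgue_on \<Omega>. (norm (f l x - f k x))\<^sup>2) \<le> C * (1 / 4) ^ k"
  obtains F where "L2_on \<Omega> F" "(\<lambda>k. LINT x|lebesgue_on \<Omega>. (norm (f k x - F x))\<^sup>2) \<longlonglongrightarrow> 0"
proof -
  let ?M = "lebesgue_on \<Omega>"
  have [measurable]: "f k \<in> borel_measurable ?M" for k using f by (auto simp: L2_on_def)
  interpret finite_measure ?M using \<Omega> by (simp add: finite_measure_lebesgue_on)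
  define m where "m = measure ?M (space ?M)"
  have "C \<ge> 0" using Cauchy[of 0 0] by simp
  define d where "d k x = norm (f (Suc k) x - f k x)" for k x
  have [measurable]: "d k \<in> borel_measurable ?M" for k unfolding d_def by measurable
  have L2d: "L2_on \<Omega> (d k)" for k
    using L2_on_diff[OF f f, of "Suc k" k] by (simp add: L2_on_def d_def)
  have L21: "L2_on \<Omega> (\<lambda>_. 1::real)" by (rule L2_on_bounded[OF \<Omega>, of _ 1]) auto
  have id: "integrable ?M (d k)" for k using L2_on_inner_integrable[OF L2d L21, of k] by simp
  have Id: "(LINT x|?M. d k x) \<le> sqrt (C * m) * (1 / 2) ^ k" for k
  proof -
    have "(LINT x|?M. d k x)\<^sup>2 \<le> (LINT x|?M. (d k x)\<^sup>2) * m"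
      using L2_on_Cauchy_Schwarz[OF L2d L21, of k] by (simp add: m_def)
    also have "\<dots> \<le> (C * (1 / 4) ^ k) * m"
      using Cauchy[of k "Suc k"] by (intro mult_right_mono) (auto simp: d_def m_def)
    also have "\<dots> = (sqrt (C * m) * (1 / 2) ^ k)\<^sup>2"
    proof -
      have "((1 / 2) ^ k)\<^sup>2 = (1 / 4 :: real) ^ k"
        by (simp add: power_mult[symmetric] mult.commute[of k]) (simp add: power_mult power2_eq_square)
      moreover have "C * m \<ge> 0" using \<open>C \<ge> 0\<close> by (simp add: m_def)
      ultimately show ?thesis by (simp add: power_mult_distrib)
    qed
    finally show ?thesis
      by (rule power2_le_imp_le) (use \<open>C \<ge> 0\<close> in \<open>simp add: m_def\<close>)
  qed
  have "(\<integral>\<^sup>+x. (\<Sum>k. ennreal (d k x)) \<partial>?M) = (\<Sum>k. \<integral>\<^sup>+x. ennreal (d k x) \<partial>?M)"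
    by (rule nn_integral_suminf) measurable
  also have "\<dots> \<le> (\<Sum>k. ennreal (sqrt (C * m) * (1 / 2) ^ k))"
  proof (rule suminf_le)
    show "(\<integral>\<^sup>+x. ennreal (d k x) \<partial>?M) \<le> ennreal (sqrt (C * m) * (1 / 2) ^ k)" for k
    proof -
      have "(\<integral>\<^sup>+x. ennreal (d k x) \<partial>?M) = ennreal (LINT x|?M. d k x)"
        by (rule nn_integral_eq_integral[OF id]) (simp add: d_def)
      then show ?thesis using ennreal_leI[OF Id[of k]] by simp
    qed
  qed auto
  also have "\<dots> < \<infinity>"
  proof -
    have "summable (\<lambda>k. sqrt (C * m) * (1 / 2) ^ k)" by (intro summable_mult summable_geometric) simp
    then have "(\<Sum>k. ennreal (sqrt (C * m) * (1 / 2) ^ k)) = ennreal (\<Sum>k. sqrt (C * m) * (1 / 2) ^ k)"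
      using \<open>C \<ge> 0\<close> by (intro suminf_ennreal2) (auto simp: m_def)
    then show ?thesis by simp
  qed
  finally have "AE x in ?M. (\<Sum>k. ennreal (d k x)) \<noteq> \<infinity>"
    by (intro nn_integral_noteq_infinite) auto
  then have "AE x in ?M. convergent (\<lambda>k. f k x)"
  proof eventually_elim
    case (elim x)
    then have "summable (\<lambda>k. d k x)"
      by (intro summable_suminf_not_top) (auto simp: d_def)
    then have "summable (\<lambda>k. f (Suc k) x - f k x)" unfolding d_def by (rule summable_norm_cancel)
    then have "convergent (\<lambda>n. \<Sum>k<n. f (Suc k) x - f k x)" by (simp add: summable_iff_convergent)
    then have "convergent (\<lambda>n. f n x - f 0 x)" unfolding sum_lessThan_telescope[of "\<lambda>k. f k x"] .
    from convergent_add[OF this convergent_const[of "f 0 x"]] show ?case by simp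
  qed
  then have conv: "AE x in ?M. (\<lambda>k. f k x) \<longlonglongrightarrow> lim (\<lambda>k. f k x)"
    by eventually_elim (simp add: convergent_LIMSEQ_iff)
  define F where "F x = lim (\<lambda>k. f k x)" for x
  have [measurable]: "F \<in> borel_measurable ?M" unfolding F_def by measurable
  have conv: "AE x in ?M. (\<lambda>k. f k x) \<longlonglongrightarrow> F x" using conv by (simp add: F_def)
  have iff: "integrable ?M (\<lambda>x. (norm (f l x - f k x))\<^sup>2)" for k l
    using L2_on_diff[OF f f] by (simp add: L2_on_def)
  have Fatou: "(\<integral>\<^sup>+x. ennreal ((norm (f k x - F x))\<^sup>2) \<partial>?M) \<le> ennreal (C * (1 / 4) ^ k)" for k
  proof -
    have "(\<integral>\<^sup>+x. ennreal ((norm (f k x - F x))\<^sup>2) \<partial>?M)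
        = (\<integral>\<^sup>+x. liminf (\<lambda>l. ennreal ((norm (f l x - f k x))\<^sup>2)) \<partial>?M)"
    proof (rule nn_integral_cong_AE)
      show "AE x in ?M. ennreal ((norm (f k x - F x))\<^sup>2) = liminf (\<lambda>l. ennreal ((norm (f l x - f k x))\<^sup>2))"
        using conv
      proof eventually_elim
        case (elim x)
        have "(\<lambda>l. ennreal ((norm (f l x - f k x))\<^sup>2)) \<longlonglongrightarrow> ennreal ((norm (F x - f k x))\<^sup>2)"
          by (intro tendsto_ennrealI tendsto_intros elim)
        from lim_imp_Liminf[OF trivial_limit_sequentially this]
        show ?case by (simp add: norm_minus_commute)
      qed
    qed
    also have "\<dots> \<le> liminf (\<lambda>l. \<integral>\<^sup>+x. ennreal ((norm (f l x - f k x))\<^sup>2) \<partial>?M)"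
      by (rule nn_integral_liminf) measurable
    also have "\<dots> \<le> ennreal (C * (1 / 4) ^ k)"
    proof (rule order_trans[OF Liminf_le_Limsup Limsup_bounded])
      show "\<forall>\<^sub>F l in sequentially. (\<integral>\<^sup>+x. ennreal ((norm (f l x - f k x))\<^sup>2) \<partial>?M) \<le> ennreal (C * (1 / 4) ^ k)"
        using eventually_ge_at_top[of k]
        by eventually_elim (subst nn_integral_eq_integral[OF iff], auto intro!: ennreal_leI Cauchy)
    qed simp
    finally show ?thesis .
  qed
  have dF: "integrable ?M (\<lambda>x. (norm (f k x - F x))\<^sup>2)" for k
  proof (rule integrableI_bounded)
    show "(\<integral>\<^sup>+x. ennreal (norm ((norm (f k x - F x))\<^sup>2)) \<partial>?M) < \<infinity>"
      using Fatou[of k] by (simp add: le_less_trans[OF _ ennreal_less_top])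
  qed measurable
  have dFle: "(LINT x|?M. (norm (f k x - F x))\<^sup>2) \<le> C * (1 / 4) ^ k" for k
  proof -
    have "ennreal (LINT x|?M. (norm (f k x - F x))\<^sup>2) \<le> ennreal (C * (1 / 4) ^ k)"
      using Fatou[of k] by (subst (asm) nn_integral_eq_integral[OF dF]) auto
    then show ?thesis using \<open>C \<ge> 0\<close> by simp
  qed
  have "L2_on \<Omega> (\<lambda>x. f 0 x - F x)" using dF[of 0] by (simp add: L2_on_def)
  from L2_on_diff[OF f this, of 0] have "L2_on \<Omega> F" by simp
  moreover have "(\<lambda>k. LINT x|?M. (norm (f k x - F x))\<^sup>2) \<longlonglongrightarrow> 0"
  proof (rule Lim_null_comparison)
    show "\<forall>\<^sub>F k in sequentially. norm (LINT x|?M. (norm (f k x - F x))\<^sup>2) \<le> C * (1 / 4) ^ k"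
      using dFle by simp
    show "(\<lambda>k. C * (1 / 4) ^ k) \<longlonglongrightarrow> 0"
      by (intro tendsto_mult_right_zero LIMSEQ_power_zero) simp
  qed
  ultimately show ?thesis by (rule that)
qed

section \<open>Test functions on the unit ball\<close>

lemma open_Omega: "open (Omega :: 'a::euclidean_space set)" by (simp add: Omega_def)
lemma Omega_lmeasurable: "(Omega :: 'a::euclidean_space set) \<in> lmeasurable" by (simp add: Omega_def)

lemma integral_lebesgue_on_eq_lborel:
  fixes f :: "'a::euclidean_space \<Rightarrow> real"
  assumes "\<Omega> \<in> sets lebesgue" "f \<in> borel_measurable borel" "\<And>x. x \<notin> \<Omega> \<Longrightarrow> f x = 0"
  shows "(LINT x|lebesgue_on \<Omega>. f x) = (LINT x|lborel. f x)"
proof -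
  have "(LINT x|lebesgue_on \<Omega>. f x) = (LINT x|lebesgue. indicator \<Omega> x *\<^sub>R f x)"
    using assms(1) by (subst integral_restrict_space) auto
  also have "\<dots> = (LINT x|lebesgue. f x)"
    by (rule Bochner_Integration.integral_cong[OF refl]) (use assms(3) in \<open>auto simp: indicator_def\<close>)
  also have "\<dots> = (LINT x|lborel. f x)" using assms(2) by (intro integral_completion) simp
  finally show ?thesis .
qed

lemma borel_measurable_lebesgue_on_continuous:
  fixes f :: "'a::euclidean_space \<Rightarrow> 'b::euclidean_space"
  assumes "continuous_on UNIV f"
  shows "f \<in> borel_measurable (lebesgue_on \<Omega>)"
  using borel_measurable_continuous_onI[OF assms]
  by (intro measurable_restrict_space1 measurable_completion) simp

lemma L2_on_Omega_continuous:
  fixes f :: "'a::euclidean_space \<Rightarrow> 'b::euclidean_space"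
  assumes "continuous_on UNIV f"
  shows "L2_on Omega f"
proof -
  have "compact (f ` cball 0 1)"
    by (intro compact_continuous_image continuous_on_subset[OF assms] compact_cball) auto
  then obtain B where B: "\<And>x. norm x \<le> 1 \<Longrightarrow> norm (f x) \<le> B"
    using compact_imp_bounded by (fastforce simp: bounded_iff)
  show ?thesis
    by (rule L2_on_bounded[OF Omega_lmeasurable, of _ B])
      (use B in \<open>auto simp: Omega_def intro: borel_measurable_lebesgue_on_continuous[OF assms]\<close>)
qed

lemma L2_on_test_function:
  assumes "test_function \<Omega> \<phi>"
  shows "L2_on Omega \<phi>" "L2_on Omega (grad \<phi>)"
  by (rule L2_on_Omega_continuous, rule test_function_continuous[OF assms])
    (rule L2_on_Omega_continuous, rule test_function_continuous_grad[OF assms])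

lemma test_function_add_scaleR:
  assumes "test_function \<Omega> \<phi>" "test_function \<Omega> \<psi>"
  shows "test_function \<Omega> (\<lambda>x. \<phi> x + c * \<psi> x)" "grad (\<lambda>x. \<phi> x + c * \<psi> x) = (\<lambda>x. grad \<phi> x + c *\<^sub>R grad \<psi> x)"
proof -
  let ?S = "closure {x. \<phi> x \<noteq> 0} \<union> closure {x. \<psi> x \<noteq> 0}"
  have "{x. \<phi> x + c * \<psi> x \<noteq> 0} \<subseteq> {x. \<phi> x \<noteq> 0} \<union> {x. \<psi> x \<noteq> 0}" by auto
  also have "\<dots> \<subseteq> ?S" by (intro Un_mono closure_subset)
  finally have sub: "closure {x. \<phi> x + c * \<psi> x \<noteq> 0} \<subseteq> ?S" by (intro closure_minimal) auto
  have cS: "compact ?S" using assms unfolding test_function_def by (intro compact_Un) blast+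
  then have "compact (closure {x. \<phi> x + c * \<psi> x \<noteq> 0})"
    unfolding compact_eq_bounded_closed[of "closure _"] using bounded_subset[OF compact_imp_bounded[OF cS] sub] by simp
  moreover have "smooth_on UNIV (\<lambda>x. \<phi> x + c * \<psi> x)"
    using assms unfolding test_function_def smooth_on_def
    by (intro allI Ck_on_add Ck_on_mult Ck_on_const) blast+
  ultimately show "test_function \<Omega> (\<lambda>x. \<phi> x + c * \<psi> x)"
    using sub assms unfolding test_function_def by blast
  show "grad (\<lambda>x. \<phi> x + c * \<psi> x) = (\<lambda>x. grad \<phi> x + c *\<^sub>R grad \<psi> x)"
  proof
    fix x
    have "((\<lambda>x. \<phi> x + c * \<psi> x) has_derivative (\<lambda>v. (grad \<phi> x + c *\<^sub>R grad \<psi> x) \<bullet> v)) (at x)"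
      by (rule has_derivative_eq_rhs[OF has_derivative_add[OF test_function_has_derivative[OF assms(1)]
          has_derivative_mult_right[OF test_function_has_derivative[OF assms(2)]]]])
        (auto simp: inner_add_left)
    then show "grad (\<lambda>x. \<phi> x + c * \<psi> x) x = grad \<phi> x + c *\<^sub>R grad \<psi> x" by (rule grad_eqI)
  qed
qed

lemma integral_by_parts_test_function:
  fixes \<phi> :: "'a::euclidean_space \<Rightarrow> real"
  assumes \<phi>: "test_function Omega \<phi>"
    and a: "\<And>x. (a has_derivative (\<lambda>v. A x \<bullet> v)) (at x)" "continuous_on UNIV A"
  shows "(LINT x|lebesgue_on Omega. a x * (grad \<phi> x \<bullet> e)) = - (LINT x|lebesgue_on Omega. (A x \<bullet> e) * \<phi> x)"
proof -
  define K where "K = closure {x. \<phi> x \<noteq> 0}"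
  have K: "compact K" "K \<subseteq> Omega" using \<phi> by (auto simp: test_function_def K_def)
  have out: "\<phi> x = 0" "grad \<phi> x = 0" if "x \<notin> Omega" for x
    using test_function_outside[OF \<phi>, of x] that K(2) by (auto simp: K_def)
  have ca: "continuous_on UNIV a" using a(1) by (intro has_derivative_continuous_on) auto
  note cont = ca a(2) test_function_continuous[OF \<phi>] test_function_continuous_grad[OF \<phi>]
  let ?G = "\<lambda>x. a x *\<^sub>R grad \<phi> x + \<phi> x *\<^sub>R A x"
  have D: "((\<lambda>x. a x * \<phi> x) has_derivative (\<lambda>v. ?G x \<bullet> v)) (at x)" for x
    by (rule has_derivative_eq_rhs[OF has_derivative_mult[OF a(1) test_function_has_derivative[OF \<phi>]]])
      (auto simp: inner_add_left)
  have "continuous_on UNIV ?G" by (intro continuous_intros cont)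
  moreover have "a x * \<phi> x = 0" if "x \<notin> K" for x
  proof -
    have "\<phi> x = 0" using that unfolding K_def by (rule test_function_outside(1)[OF \<phi>])
    then show ?thesis by simp
  qed
  ultimately have "(LINT x|lborel. ?G x \<bullet> e) = 0"
    by (intro integral_partial_derivative_C1_eq_0(2)[OF D _ K(1)])
  then have "(LINT x|lborel. a x * (grad \<phi> x \<bullet> e) + (A x \<bullet> e) * \<phi> x) = 0"
    by (simp add: inner_add_left mult.commute)
  moreover have "(LINT x|lebesgue_on Omega. a x * (grad \<phi> x \<bullet> e) + (A x \<bullet> e) * \<phi> x)
      = (LINT x|lborel. a x * (grad \<phi> x \<bullet> e) + (A x \<bullet> e) * \<phi> x)"
  proof (rule integral_lebesgue_on_eq_lborel)
    show "(\<lambda>x. a x * (grad \<phi> x \<bullet> e) + (A x \<bullet> e) * \<phi> x) \<in> borel_measurable borel"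
      by (intro borel_measurable_continuous_onI continuous_intros cont)
  qed (use Omega_lmeasurable out in auto)
  moreover have "(LINT x|lebesgue_on Omega. a x * (grad \<phi> x \<bullet> e) + (A x \<bullet> e) * \<phi> x)
    = (LINT x|lebesgue_on Omega. a x * (grad \<phi> x \<bullet> e)) + (LINT x|lebesgue_on Omega. (A x \<bullet> e) * \<phi> x)"
  proof (rule Bochner_Integration.integral_add)
    have "L2_on Omega a" "L2_on Omega (\<lambda>x. grad \<phi> x \<bullet> e)" "L2_on Omega (\<lambda>x. A x \<bullet> e)" "L2_on Omega \<phi>"
      by (intro L2_on_Omega_continuous continuous_intros cont)+
    then show "integrable (lebesgue_on Omega) (\<lambda>x. a x * (grad \<phi> x \<bullet> e))"
      "integrable (lebesgue_on Omega) (\<lambda>x. (A x \<bullet> e) * \<phi> x)"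
      using L2_on_inner_integrable by force+
  qed
  ultimately show ?thesis by simp
qed

lemma has_weak_gradient_test_function:
  fixes \<phi> :: "'a::euclidean_space \<Rightarrow> real"
  assumes "test_function Omega \<phi>"
  shows "has_weak_gradient Omega \<phi> (grad \<phi>)"
  unfolding has_weak_gradient_def
  using L2_on_test_function[OF assms] integral_by_parts_test_function[OF _ test_function_has_derivative[OF assms]
    test_function_continuous_grad[OF assms]] by auto

text \<open>
  The vector field \<open>x / N\<close> has divergence \<open>1\<close>. This identity turns the linear term of the energy into
  a gradient term, which is what makes the completion of the square below possible.
\<close>

lemma integral_test_function:
  fixes \<phi> :: "'a::euclidean_space \<Rightarrow> real"
  assumes \<phi>: "test_function Omega \<phi>"
  shows "(LINT x|lebesgue_on Omega. \<phi> x) = - (1 / DIM('a)) * (LINT x|lebesgue_on Omega. x \<bullet> grad \<phi> x)"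
proof -
  have i: "integrable (lebesgue_on Omega) (\<lambda>x. (x \<bullet> i) * (grad \<phi> x \<bullet> i))" for i
    using L2_on_inner_integrable[OF L2_on_Omega_continuous L2_on_Omega_continuous,
        of "\<lambda>x. x \<bullet> i" "\<lambda>x. grad \<phi> x \<bullet> i"]
    by (simp add: continuous_intros test_function_continuous_grad[OF \<phi>])
  have "(LINT x|lebesgue_on Omega. x \<bullet> grad \<phi> x) = (LINT x|lebesgue_on Omega. (\<Sum>i\<in>Basis. (x \<bullet> i) * (grad \<phi> x \<bullet> i)))"
    by (simp add: euclidean_inner[symmetric])
  also have "\<dots> = (\<Sum>i\<in>Basis. LINT x|lebesgue_on Omega. (x \<bullet> i) * (grad \<phi> x \<bullet> i))"
    using i by (intro Bochner_Integration.integral_sum) auto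
  also have "\<dots> = (\<Sum>i\<in>(Basis::'a set). - (LINT x|lebesgue_on Omega. \<phi> x))"
  proof (rule sum.cong[OF refl])
    fix i :: 'a assume "i \<in> Basis"
    have "((\<lambda>x. x \<bullet> i) has_derivative (\<lambda>v. i \<bullet> v)) (at x)" for x
      by (auto intro!: derivative_eq_intros simp: inner_commute)
    from integral_by_parts_test_function[OF \<phi> this, of i] \<open>i \<in> Basis\<close>
    show "(LINT x|lebesgue_on Omega. (x \<bullet> i) * (grad \<phi> x \<bullet> i)) = - (LINT x|lebesgue_on Omega. \<phi> x)"
      by simp
  qed
  finally show ?thesis by simp
qed

text \<open>
  With \<open>1 = \<partial>\<^sub>i x\<^sub>i\<close>, integration by parts bounds the integral of \<open>\<phi>\<^sup>2\<close> by that of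
  \<open>2 |\<phi>| |x\<^sub>i| |\<partial>\<^sub>i \<phi>|\<close>, where \<open>|x\<^sub>i| \<le> 1\<close>; half of \<open>\<phi>\<^sup>2\<close> is then absorbed.
\<close>

lemma Poincare_test_function:
  fixes \<phi> :: "'a::euclidean_space \<Rightarrow> real"
  assumes \<phi>: "test_function Omega \<phi>"
  shows "(LINT x|lebesgue_on Omega. (norm (\<phi> x))\<^sup>2) \<le> 4 * (LINT x|lebesgue_on Omega. (norm (grad \<phi> x))\<^sup>2)"
proof -
  obtain i :: 'a where i: "i \<in> Basis" by fastforce
  note cont = test_function_continuous[OF \<phi>] test_function_continuous_grad[OF \<phi>]
  have I: "integrable (lebesgue_on Omega) (\<lambda>x. (\<phi> x)\<^sup>2)" "integrable (lebesgue_on Omega) (\<lambda>x. (norm (grad \<phi> x))\<^sup>2)"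
    using L2_on_test_function[OF \<phi>] by (auto simp: L2_on_def)
  have I': "integrable (lebesgue_on Omega) (\<lambda>x. \<phi> x * (x \<bullet> i) * (grad \<phi> x \<bullet> i))"
    using L2_on_inner_integrable[OF L2_on_Omega_continuous L2_on_Omega_continuous,
        of "\<lambda>x. \<phi> x * (x \<bullet> i)" "\<lambda>x. grad \<phi> x \<bullet> i"]
    by (simp add: continuous_intros cont)
  have D: "((\<lambda>x. \<phi> x * (x \<bullet> i)) has_derivative (\<lambda>v. ((x \<bullet> i) *\<^sub>R grad \<phi> x + \<phi> x *\<^sub>R i) \<bullet> v)) (at x)" for x
    by (rule has_derivative_eq_rhs[OF has_derivative_mult[OF test_function_has_derivative[OF \<phi>]
          has_derivative_inner_left[OF has_derivative_ident]]])
      (auto simp: fun_eq_iff inner_add_left inner_commute[of i] mult.commute)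
  have "continuous_on UNIV (\<lambda>x. (x \<bullet> i) *\<^sub>R grad \<phi> x + \<phi> x *\<^sub>R i)" by (intro continuous_intros cont)
  from integral_by_parts_test_function[OF \<phi> D this, of i]
  have "(LINT x|lebesgue_on Omega. \<phi> x * (x \<bullet> i) * (grad \<phi> x \<bullet> i))
    = - (LINT x|lebesgue_on Omega. \<phi> x * (x \<bullet> i) * (grad \<phi> x \<bullet> i) + (\<phi> x)\<^sup>2)"
    using i by (simp add: inner_add_left algebra_simps power2_eq_square)
  then have "(LINT x|lebesgue_on Omega. (\<phi> x)\<^sup>2) = - 2 * (LINT x|lebesgue_on Omega. \<phi> x * (x \<bullet> i) * (grad \<phi> x \<bullet> i))"
    using I I' by simp
  also have "\<dots> = (LINT x|lebesgue_on Omega. - 2 * (\<phi> x * (x \<bullet> i) * (grad \<phi> x \<bullet> i)))" by simp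
  also have "\<dots> \<le> (LINT x|lebesgue_on Omega. (\<phi> x)\<^sup>2 / 2 + 2 * (norm (grad \<phi> x))\<^sup>2)"
  proof (rule integral_mono)
    fix x :: 'a assume "x \<in> space (lebesgue_on Omega)"
    then have x: "norm x < 1" by (simp add: Omega_def)
    have "\<bar>x \<bullet> i\<bar> \<le> 1" using Basis_le_norm[OF i, of x] x by simp
    moreover have "\<bar>grad \<phi> x \<bullet> i\<bar> \<le> norm (grad \<phi> x)" by (rule Basis_le_norm[OF i])
    ultimately have "\<bar>(x \<bullet> i) * (grad \<phi> x \<bullet> i)\<bar> \<le> 1 * norm (grad \<phi> x)"
      unfolding abs_mult by (intro mult_mono) auto
    then have "\<bar>\<phi> x\<bar> * \<bar>(x \<bullet> i) * (grad \<phi> x \<bullet> i)\<bar> \<le> \<bar>\<phi> x\<bar> * norm (grad \<phi> x)" by (intro mult_left_mono) auto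
    moreover have "- 2 * (\<phi> x * (x \<bullet> i) * (grad \<phi> x \<bullet> i)) \<le> 2 * (\<bar>\<phi> x\<bar> * \<bar>(x \<bullet> i) * (grad \<phi> x \<bullet> i)\<bar>)"
      unfolding abs_mult[symmetric] by (simp add: mult.assoc)
    moreover have "2 * (\<bar>\<phi> x\<bar> * norm (grad \<phi> x)) \<le> (\<phi> x)\<^sup>2 / 2 + 2 * (norm (grad \<phi> x))\<^sup>2"
      using sum_squares_bound[of "\<bar>\<phi> x\<bar>" "2 * norm (grad \<phi> x)"] by (simp add: power_mult_distrib)
    ultimately show "- 2 * (\<phi> x * (x \<bullet> i) * (grad \<phi> x \<bullet> i)) \<le> (\<phi> x)\<^sup>2 / 2 + 2 * (norm (grad \<phi> x))\<^sup>2" by linarith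
  qed (use I I' in auto)
  also have "\<dots> = (LINT x|lebesgue_on Omega. (\<phi> x)\<^sup>2) / 2 + 2 * (LINT x|lebesgue_on Omega. (norm (grad \<phi> x))\<^sup>2)"
    using I by simp
  finally show ?thesis by simp
qed

section \<open>Uniqueness of weak gradients\<close>

text \<open>
  The indicator of \<open>C\<close> is the limit of the Lipschitz functions \<open>max 0 (1 - n dist(x, C))\<close>, each of
  which is approximated uniformly within \<open>1/n\<close> by a test function.
\<close>

lemma integral_zero_on_compact:
  fixes f :: "'a::euclidean_space \<Rightarrow> real"
  assumes \<Omega>: "open \<Omega>" "\<Omega> \<in> lmeasurable" and f: "L2_on \<Omega> f"
    and 0: "\<And>\<phi>. test_function \<Omega> \<phi> \<Longrightarrow> (LINT x|lebesgue_on \<Omega>. f x * \<phi> x) = 0"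
    and C: "compact C" "C \<subseteq> \<Omega>"
  shows "(LINT x|lebesgue_on \<Omega>. f x * indicator C x) = 0"
proof (cases "C = {}")
  case False
  obtain e where e: "e > 0" "(\<Union>x\<in>C. cball x e) \<subseteq> \<Omega>"
    using compact_subset_open_imp_cball_epsilon_subset[OF C(1) \<Omega>(1) C(2)] by blast
  obtain k0 where k0: "k0 > 0" "1 / real k0 < e"
    using real_arch_inverse[of e] e(1) by (auto simp: inverse_eq_divide)
  define n where "n k = real (k + k0)" for k
  have n: "n k > 0" "1 / n k \<le> 1 / k0" for k using k0 by (auto simp: n_def frac_le)
  have n_lim: "(\<lambda>k. 1 / n k) \<longlonglongrightarrow> 0"
    unfolding n_def using LIMSEQ_ignore_initial_segment[OF lim_1_over_n, of k0] by simp
  define v where "v k x = max 0 (1 - n k * infdist x C)" for k x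
  have "\<exists>\<phi>. test_function \<Omega> \<phi> \<and> (\<forall>x. \<bar>\<phi> x - v k x\<bar> \<le> 1 / n k)" for k
  proof -
    have lip: "\<bar>v k x - v k y\<bar> \<le> n k * norm (x - y)" for x y
    proof -
      have "\<bar>infdist x C - infdist y C\<bar> \<le> dist x y"
        using infdist_triangle[of x C y] infdist_triangle[of y C x] by (simp add: dist_commute abs_le_iff)
      then have "n k * \<bar>infdist x C - infdist y C\<bar> \<le> n k * norm (x - y)"
        using n(1)[of k] by (simp add: dist_norm)
      moreover have "\<bar>v k x - v k y\<bar> \<le> \<bar>n k * infdist x C - n k * infdist y C\<bar>"
        unfolding v_def by (auto simp: max_def abs_if)
      moreover have "\<bar>n k * infdist x C - n k * infdist y C\<bar> = n k * \<bar>infdist x C - infdist y C\<bar>"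
        using n(1)[of k] by (simp add: abs_mult flip: right_diff_distrib)
      ultimately show ?thesis by linarith
    qed
    let ?S = "{x. infdist x C \<le> 1 / n k}"
    have S: "compact ?S" using compact_infdist_le[OF False C(1)] n(1)[of k] by simp
    have S\<Omega>: "?S \<subseteq> \<Omega>"
    proof
      fix x assume "x \<in> ?S"
      then have "infdist x C \<le> e" using n(2)[of k] k0 by simp
      moreover obtain y where "y \<in> C" "infdist x C = dist x y"
        using infdist_attains_inf[OF compact_imp_closed[OF C(1)] False] by blast
      ultimately have "x \<in> cball y e" by (simp add: dist_commute)
      then show "x \<in> \<Omega>" using e(2) \<open>y \<in> C\<close> by blast
    qed
    have out: "v k x = 0" if "x \<notin> ?S" for x
    proof -
      have "1 / n k < infdist x C" using that by simp
      then have "1 < n k * infdist x C" using n(1)[of k] by (simp add: field_simps)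
      then show ?thesis by (simp add: v_def)
    qed
    have "1 / (n k)\<^sup>2 > 0" using n(1)[of k] by simp
    from mollification[OF lip \<Omega>(1) S S\<Omega> out this]
    obtain \<phi> where "test_function \<Omega> \<phi>" "\<And>x. \<bar>\<phi> x - v k x\<bar> \<le> n k * (1 / (n k)\<^sup>2)" by metis
    then show ?thesis using n(1)[of k] by (auto simp: power2_eq_square)
  qed
  then obtain \<phi> where \<phi>: "\<And>k. test_function \<Omega> (\<phi> k)" "\<And>k x. \<bar>\<phi> k x - v k x\<bar> \<le> 1 / n k" by metis
  have v_lim: "(\<lambda>k. v k x) \<longlonglongrightarrow> indicator C x" for x
  proof (cases "x \<in> C")
    case True
    then show ?thesis by (simp add: v_def)
  next
    case nC: False
    then have pos: "infdist x C > 0" using C(1) compact_imp_closed infdist_pos_not_in_closed False by metis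
    then have "\<forall>\<^sub>F k in sequentially. 1 / n k < infdist x C" using n_lim order_tendstoD(2) by blast
    then have "\<forall>\<^sub>F k in sequentially. indicator C x = v k x"
    proof eventually_elim
      case (elim k)
      then have "1 < n k * infdist x C" using n(1)[of k] by (simp add: field_simps)
      then show ?case using nC by (simp add: v_def)
    qed
    then show ?thesis by (rule Lim_transform_eventually[OF tendsto_const])
  qed
  have \<phi>_lim: "(\<lambda>k. \<phi> k x) \<longlonglongrightarrow> indicator C x" for x
  proof -
    have "(\<lambda>k. \<phi> k x - v k x) \<longlonglongrightarrow> 0"
      by (rule Lim_null_comparison[OF _ n_lim]) (use \<phi>(2) in auto)
    from tendsto_add[OF this v_lim[of x]] show ?thesis by simp
  qed
  have bd: "\<bar>\<phi> k x\<bar> \<le> 1 / k0 + 1" for k x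
  proof -
    have "0 \<le> v k x" "v k x \<le> 1" using n(1)[of k] infdist_nonneg[of x C] by (auto simp: v_def)
    then show ?thesis using \<phi>(2)[of k x] n(2)[of k] by linarith
  qed
  have fm[measurable]: "f \<in> borel_measurable (lebesgue_on \<Omega>)" using f by (simp add: L2_on_def)
  have m[measurable]: "\<phi> k \<in> borel_measurable (lebesgue_on \<Omega>)" for k
    using test_function_continuous[OF \<phi>(1)] by (rule borel_measurable_lebesgue_on_continuous)
  have Cm: "indicator C \<in> borel_measurable (lebesgue_on \<Omega>)"
  proof -
    have "C \<in> sets lebesgue" using C(1) by (simp add: borel_compact)
    then show ?thesis by (intro measurable_restrict_space1) (simp add: borel_measurable_indicator)
  qed
  have "integrable (lebesgue_on \<Omega>) f"
    using L2_on_inner_integrable[OF f L2_on_bounded[OF \<Omega>(2), of "\<lambda>_. 1::real" 1]] by simp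
  then have dom: "integrable (lebesgue_on \<Omega>) (\<lambda>x. \<bar>f x\<bar> * (1 / k0 + 1))" by simp
  have "(\<lambda>k. LINT x|lebesgue_on \<Omega>. f x * \<phi> k x) \<longlonglongrightarrow> (LINT x|lebesgue_on \<Omega>. f x * indicator C x)"
  proof (rule integral_dominated_convergence[OF _ _ dom])
    show "AE x in lebesgue_on \<Omega>. norm (f x * \<phi> k x) \<le> \<bar>f x\<bar> * (1 / k0 + 1)" for k
      using bd by (intro AE_I2) (auto simp: abs_mult intro: mult_left_mono)
    show "AE x in lebesgue_on \<Omega>. (\<lambda>k. f x * \<phi> k x) \<longlonglongrightarrow> f x * indicator C x"
      using \<phi>_lim by (intro AE_I2 tendsto_mult_left)
    show "(\<lambda>x. f x * indicator C x) \<in> borel_measurable (lebesgue_on \<Omega>)"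
      using fm Cm by (rule borel_measurable_times)
  qed measurable
  then show ?thesis using 0[OF \<phi>(1)] by (simp add: LIMSEQ_const_iff)
qed simp

text \<open>
  The integral of \<open>f\<close> vanishes over every compact subset of \<open>{f > 0}\<close>, so each of them is a null
  set; inner regularity carries this over to \<open>{f > 0}\<close>.
\<close>

lemma AE_nonpos_of_integral_test_functions_0:
  fixes f :: "'a::euclidean_space \<Rightarrow> real"
  assumes \<Omega>: "open \<Omega>" "bounded \<Omega>" and f: "L2_on \<Omega> f"
    and 0: "\<And>\<phi>. test_function \<Omega> \<phi> \<Longrightarrow> (LINT x|lebesgue_on \<Omega>. f x * \<phi> x) = 0"
  shows "AE x in lebesgue_on \<Omega>. f x \<le> 0"
proof -
  have \<Omega>m: "\<Omega> \<in> lmeasurable" using \<Omega> by (simp add: bounded_set_imp_lmeasurable borel_open)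
  have fm[measurable]: "f \<in> borel_measurable (lebesgue_on \<Omega>)" using f by (simp add: L2_on_def)
  define A where "A = {x \<in> \<Omega>. f x > 0}"
  have "{x \<in> space (lebesgue_on \<Omega>). f x > 0} \<in> sets (lebesgue_on \<Omega>)" by measurable
  then have A: "A \<in> sets (lebesgue_on \<Omega>)" by (simp add: A_def)
  then have Al: "A \<in> sets lebesgue" using \<Omega>m by (simp add: sets_restrict_space_iff)
  have null: "T \<in> null_sets lebesgue" if T: "closed T" "T \<subseteq> A" for T
  proof -
    have "T \<subseteq> \<Omega>" using T by (auto simp: A_def)
    then have "compact T" using T(1) \<Omega>(2) bounded_subset compact_eq_bounded_closed by blast
    note z = integral_zero_on_compact[OF \<Omega>(1) \<Omega>m f 0 this \<open>T \<subseteq> \<Omega>\<close>]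
    have Ts: "T \<in> sets (lebesgue_on \<Omega>)"
      using \<open>compact T\<close> \<open>T \<subseteq> \<Omega>\<close> \<Omega>m by (simp add: sets_restrict_space_iff borel_compact)
    have "integrable (lebesgue_on \<Omega>) f"
      using L2_on_inner_integrable[OF f L2_on_bounded[OF \<Omega>m, of "\<lambda>_. 1::real" 1]] by simp
    then have i: "integrable (lebesgue_on \<Omega>) (\<lambda>x. f x * indicator T x)"
      using integrable_mult_indicator[OF Ts, of f] by (simp add: mult.commute)
    have "AE x in lebesgue_on \<Omega>. 0 \<le> f x * indicator T x"
      using T(2) by (intro AE_I2) (auto simp: A_def indicator_def)
    with integral_nonneg_eq_0_iff_AE[OF i] z have "AE x in lebesgue_on \<Omega>. f x * indicator T x = 0" by simp
    then have "AE x in lebesgue_on \<Omega>. x \<notin> T"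
      by eventually_elim (use T(2) in \<open>auto simp: A_def indicator_def split: if_splits\<close>)
    then have "T \<in> null_sets (lebesgue_on \<Omega>)" using Ts by (subst AE_iff_null_sets) auto
    then show ?thesis using \<Omega>m by (simp add: null_sets_restrict_space)
  qed
  have small: "emeasure lebesgue A \<le> ennreal e" if "e > 0" for e
  proof -
    obtain T where T: "closed T" "T \<subseteq> A" "A - T \<in> lmeasurable" "emeasure lebesgue (A - T) < ennreal e"
      using sets_lebesgue_inner_closed[OF Al \<open>e > 0\<close>] by blast
    have "A = (A - T) \<union> T" using T(2) by auto
    then have "emeasure lebesgue A = emeasure lebesgue (A - T)"
      using emeasure_Un_null_set[OF fmeasurableD[OF T(3)] null[OF T(1,2)]] by simp
    then show ?thesis using T(4) by simp
  qed
  have "emeasure lebesgue A \<le> 0" by (rule ennreal_le_epsilon) (simp add: small)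
  then have "A \<in> null_sets lebesgue" by (intro null_setsI Al) simp
  moreover have "A \<subseteq> \<Omega>" unfolding A_def by blast
  ultimately have "A \<in> null_sets (lebesgue_on \<Omega>)"
    using \<Omega>m by (simp add: null_sets_restrict_space)
  then have "AE x in lebesgue_on \<Omega>. x \<notin> A" by (rule AE_not_in)
  then show ?thesis using AE_space by eventually_elim (auto simp: A_def)
qed

text \<open>
  The definitions choose a weak gradient arbitrarily. This lemma says that the choice does not
  matter, so that the limit of the gradients of a sequence of test functions is the chosen one.
\<close>

lemma weak_gradient_unique:
  fixes u :: "'a::euclidean_space \<Rightarrow> real"
  assumes \<Omega>: "open \<Omega>" "bounded \<Omega>"
    and g: "has_weak_gradient \<Omega> u g" and g': "has_weak_gradient \<Omega> u g'"
  shows "AE x in lebesgue_on \<Omega>. g x = g' x"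
proof -
  have le: "AE x in lebesgue_on \<Omega>. (g x - g' x) \<bullet> i \<le> 0"
    if i: "i \<in> Basis" and g: "has_weak_gradient \<Omega> u g" and g': "has_weak_gradient \<Omega> u g'" for i g g'
  proof (rule AE_nonpos_of_integral_test_functions_0[OF \<Omega>])
    have \<Omega>m: "\<Omega> \<in> lmeasurable" using \<Omega> by (simp add: bounded_set_imp_lmeasurable borel_open)
    have L: "L2_on \<Omega> g" "L2_on \<Omega> g'" using g g' by (auto simp: has_weak_gradient_def)
    have comp: "L2_on \<Omega> (\<lambda>x. h x \<bullet> i)" if "L2_on \<Omega> h" for h :: "'a \<Rightarrow> 'a"
    proof -
      have [measurable]: "h \<in> borel_measurable (lebesgue_on \<Omega>)" using that by (simp add: L2_on_def)
      have "integrable (lebesgue_on \<Omega>) (\<lambda>x. (norm (h x \<bullet> i))\<^sup>2)"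
      proof (rule Bochner_Integration.integrable_bound)
        show "integrable (lebesgue_on \<Omega>) (\<lambda>x. (norm (h x))\<^sup>2)" using that by (simp add: L2_on_def)
        show "AE x in lebesgue_on \<Omega>. norm ((norm (h x \<bullet> i))\<^sup>2) \<le> norm ((norm (h x))\<^sup>2)"
        proof (rule AE_I2)
          fix x
          have "\<bar>h x \<bullet> i\<bar>\<^sup>2 \<le> (norm (h x))\<^sup>2" by (intro power_mono Basis_le_norm i) simp
          then show "norm ((norm (h x \<bullet> i))\<^sup>2) \<le> norm ((norm (h x))\<^sup>2)" by simp
        qed
      qed measurable
      then show ?thesis by (simp add: L2_on_def)
    qed
    show "L2_on \<Omega> (\<lambda>x. (g x - g' x) \<bullet> i)" using comp[OF L2_on_diff[OF L]] .
    fix \<phi> assume \<phi>: "test_function \<Omega> \<phi>"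
    have "L2_on \<Omega> \<phi>"
    proof -
      have "compact (\<phi> ` closure \<Omega>)"
        by (intro compact_continuous_image continuous_on_subset[OF test_function_continuous[OF \<phi>]])
          (use \<Omega> in \<open>auto simp: compact_closure\<close>)
      then obtain B where "\<And>x. x \<in> closure \<Omega> \<Longrightarrow> norm (\<phi> x) \<le> B"
        using compact_imp_bounded by (fastforce simp: bounded_iff)
      then show ?thesis
        using test_function_continuous[OF \<phi>] closure_subset[of \<Omega>]
        by (intro L2_on_bounded[OF \<Omega>m] borel_measurable_lebesgue_on_continuous) auto
    qed
    then have "integrable (lebesgue_on \<Omega>) (\<lambda>x. (g x \<bullet> i) * \<phi> x)" "integrable (lebesgue_on \<Omega>) (\<lambda>x. (g' x \<bullet> i) * \<phi> x)"
      using L2_on_inner_integrable[OF comp[OF L(1)]] L2_on_inner_integrable[OF comp[OF L(2)]] by auto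
    then have "(LINT x|lebesgue_on \<Omega>. ((g x - g' x) \<bullet> i) * \<phi> x)
      = (LINT x|lebesgue_on \<Omega>. (g x \<bullet> i) * \<phi> x) - (LINT x|lebesgue_on \<Omega>. (g' x \<bullet> i) * \<phi> x)"
      by (simp add: inner_diff_left left_diff_distrib)
    also have "\<dots> = 0"
    proof -
      have "(LINT x|lebesgue_on \<Omega>. u x * (grad \<phi> x \<bullet> i)) = - (LINT x|lebesgue_on \<Omega>. (g x \<bullet> i) * \<phi> x)"
        "(LINT x|lebesgue_on \<Omega>. u x * (grad \<phi> x \<bullet> i)) = - (LINT x|lebesgue_on \<Omega>. (g' x \<bullet> i) * \<phi> x)"
        using g g' i \<phi> unfolding has_weak_gradient_def by blast+
      then show ?thesis by simp
    qed
    finally show "(LINT x|lebesgue_on \<Omega>. ((g x - g' x) \<bullet> i) * \<phi> x) = 0" .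
  qed
  have "AE x in lebesgue_on \<Omega>. \<forall>i\<in>Basis. (g x - g' x) \<bullet> i \<le> 0 \<and> (g' x - g x) \<bullet> i \<le> 0"
    by (intro AE_finite_allI finite_Basis AE_conjI le g g')
  then show ?thesis
  proof eventually_elim
    case (elim x)
    show ?case
    proof (rule euclidean_eqI)
      fix i :: 'a assume "i \<in> Basis"
      then have "(g x - g' x) \<bullet> i \<le> 0 \<and> (g' x - g x) \<bullet> i \<le> 0" using elim by blast
      then show "g x \<bullet> i = g' x \<bullet> i" by (simp add: inner_diff_left)
    qed
  qed
qed

section \<open>Existence of weak solutions\<close>

lemma weak_gradient_Omega_unique:
  assumes "has_weak_gradient Omega u g" "has_weak_gradient Omega u g'"
  shows "AE x in lebesgue_on Omega. g x = (g' x :: 'a::euclidean_space)"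
  using assms by (intro weak_gradient_unique) (auto simp: Omega_def)

lemma has_weak_gradient_weak_grad: "u \<in> H1 \<Omega> \<Longrightarrow> has_weak_gradient \<Omega> u (weak_grad \<Omega> u)"
  unfolding H1_def weak_grad_def mem_Collect_eq by (rule someI_ex[of "has_weak_gradient \<Omega> u"])

lemma H10I:
  fixes u :: "'a::euclidean_space \<Rightarrow> real"
  assumes g: "has_weak_gradient Omega u g" and \<phi>: "\<And>k. test_function Omega (\<phi> k)"
    and lim: "(\<lambda>k. LINT x|lebesgue_on Omega. (norm (\<phi> k x - u x))\<^sup>2) \<longlonglongrightarrow> 0"
      "(\<lambda>k. LINT x|lebesgue_on Omega. (norm (grad (\<phi> k) x - g x))\<^sup>2) \<longlonglongrightarrow> 0"
  shows "u \<in> H10 Omega" "AE x in lebesgue_on Omega. weak_grad Omega u x = g x"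
proof -
  have H1: "u \<in> H1 Omega" using g by (auto simp: H1_def)
  note w = has_weak_gradient_weak_grad[OF H1]
  show ae: "AE x in lebesgue_on Omega. weak_grad Omega u x = g x"
    by (rule weak_gradient_Omega_unique[OF w g])
  have [measurable]: "weak_grad Omega u \<in> borel_measurable (lebesgue_on Omega)" "g \<in> borel_measurable (lebesgue_on Omega)"
    "grad (\<phi> k) \<in> borel_measurable (lebesgue_on Omega)" for k
    using w g L2_on_test_function(2)[OF \<phi>, of k] by (auto simp: has_weak_gradient_def L2_on_def)
  have "(LINT x|lebesgue_on Omega. (norm (grad (\<phi> k) x - weak_grad Omega u x))\<^sup>2)
      = (LINT x|lebesgue_on Omega. (norm (grad (\<phi> k) x - g x))\<^sup>2)" for k
    by (rule integral_cong_AE) (use ae in \<open>auto elim!: eventually_mono\<close>)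
  with tendsto_add[OF lim]
  have "(\<lambda>k. (LINT x|lebesgue_on Omega. (\<phi> k x - u x)\<^sup>2)
      + (LINT x|lebesgue_on Omega. (norm (grad (\<phi> k) x - weak_grad Omega u x))\<^sup>2)) \<longlonglongrightarrow> 0"
    by simp
  with H1 \<phi> show "u \<in> H10 Omega" by (auto simp: H10_def)
qed

lemma H10E:
  fixes u :: "'a::euclidean_space \<Rightarrow> real"
  assumes "u \<in> H10 Omega"
  obtains \<phi> where "\<And>k. test_function Omega (\<phi> k)"
    "(\<lambda>k. LINT x|lebesgue_on Omega. (norm (\<phi> k x - u x))\<^sup>2) \<longlonglongrightarrow> 0"
    "(\<lambda>k. LINT x|lebesgue_on Omega. (norm (grad (\<phi> k) x - weak_grad Omega u x))\<^sup>2) \<longlonglongrightarrow> 0"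
    "L2_on Omega u" "L2_on Omega (weak_grad Omega u)"
proof -
  have H1: "u \<in> H1 Omega" using assms by (simp add: H10_def)
  have L2: "L2_on Omega u" "L2_on Omega (weak_grad Omega u)"
    using has_weak_gradient_weak_grad[OF H1] by (auto simp: has_weak_gradient_def)
  obtain \<phi> where \<phi>: "\<And>k. test_function Omega (\<phi> k)"
    and lim: "(\<lambda>k. (LINT x|lebesgue_on Omega. (norm (\<phi> k x - u x))\<^sup>2)
      + (LINT x|lebesgue_on Omega. (norm (grad (\<phi> k) x - weak_grad Omega u x))\<^sup>2)) \<longlonglongrightarrow> 0"
    using assms by (auto simp: H10_def)
  have "(\<lambda>k. LINT x|lebesgue_on Omega. (norm (\<phi> k x - u x))\<^sup>2) \<longlonglongrightarrow> 0"
    by (rule Lim_null_comparison[OF _ lim]) simp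
  moreover have "(\<lambda>k. LINT x|lebesgue_on Omega. (norm (grad (\<phi> k) x - weak_grad Omega u x))\<^sup>2) \<longlonglongrightarrow> 0"
    by (rule Lim_null_comparison[OF _ lim]) simp
  ultimately show ?thesis using that[of \<phi>] \<phi> L2 by blast
qed

lemma test_function_in_H10:
  fixes \<phi> :: "'a::euclidean_space \<Rightarrow> real"
  assumes "test_function Omega \<phi>"
  shows "\<phi> \<in> H10 Omega" "AE x in lebesgue_on Omega. weak_grad Omega \<phi> x = grad \<phi> x"
proof -
  have "(\<lambda>k::nat. LINT x|lebesgue_on Omega. (norm (\<phi> x - \<phi> x))\<^sup>2) \<longlonglongrightarrow> 0"
    "(\<lambda>k::nat. LINT x|lebesgue_on Omega. (norm (grad \<phi> x - grad \<phi> x))\<^sup>2) \<longlonglongrightarrow> 0" by simp_all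
  note H10I[OF has_weak_gradient_test_function[OF assms] assms this]
  then show "\<phi> \<in> H10 Omega" "AE x in lebesgue_on Omega. weak_grad Omega \<phi> x = grad \<phi> x" .
qed

lemma integral_H10:
  fixes u :: "'a::euclidean_space \<Rightarrow> real"
  assumes "u \<in> H10 Omega"
  shows "(LINT x|lebesgue_on Omega. u x) = - (1 / DIM('a)) * (LINT x|lebesgue_on Omega. x \<bullet> weak_grad Omega u x)"
proof -
  obtain \<phi> where \<phi>: "\<And>k. test_function Omega (\<phi> k)"
    "(\<lambda>k. LINT x|lebesgue_on Omega. (norm (\<phi> k x - u x))\<^sup>2) \<longlonglongrightarrow> 0"
    "(\<lambda>k. LINT x|lebesgue_on Omega. (norm (grad (\<phi> k) x - weak_grad Omega u x))\<^sup>2) \<longlonglongrightarrow> 0"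
    and L2: "L2_on Omega u" "L2_on Omega (weak_grad Omega u)"
    using H10E[OF assms] by blast
  have 1: "L2_on Omega (\<lambda>_::'a. 1::real)" "L2_on Omega (\<lambda>x::'a. x)"
    by (intro L2_on_Omega_continuous continuous_intros)+
  have "(\<lambda>k. LINT x|lebesgue_on Omega. \<phi> k x) \<longlonglongrightarrow> (LINT x|lebesgue_on Omega. u x)"
    using L2_on_weak_limit[OF L2_on_test_function(1)[OF \<phi>(1)] L2(1) 1(1) \<phi>(2)] by simp
  moreover have "(\<lambda>k. LINT x|lebesgue_on Omega. x \<bullet> grad (\<phi> k) x) \<longlonglongrightarrow> (LINT x|lebesgue_on Omega. x \<bullet> weak_grad Omega u x)"
    using L2_on_weak_limit[OF L2_on_test_function(2)[OF \<phi>(1)] L2(2) 1(2) \<phi>(3)]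
    by (simp only: inner_commute)
  then have "(\<lambda>k. LINT x|lebesgue_on Omega. \<phi> k x) \<longlonglongrightarrow> - (1 / DIM('a)) * (LINT x|lebesgue_on Omega. x \<bullet> weak_grad Omega u x)"
    unfolding integral_test_function[OF \<phi>(1)] by (intro tendsto_intros)
  ultimately show ?thesis by (rule LIMSEQ_unique)
qed

text \<open>
  The left-hand side is the energy density after the linear term has been rewritten by means of
  the field \<open>x / N\<close>. Its maximiser \<open>\<xi> = - x / (N s)\<close> is the gradient of the torsion function when the
  coefficient is radial.
\<close>

lemma complete_square:
  fixes x \<xi> :: "'a::real_inner" and s N :: real
  assumes "s \<noteq> 0" "N \<noteq> 0"
  shows "- (2 / N) * (x \<bullet> \<xi>) - s * (norm \<xi>)\<^sup>2
    = (norm x)\<^sup>2 / (N\<^sup>2 * s) - s * (norm (\<xi> + (1 / (N * s)) *\<^sub>R x))\<^sup>2"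
  unfolding power2_norm_eq_inner using assms
  by (simp add: inner_add_left inner_add_right inner_commute[of \<xi> x] field_simps power2_eq_square)

lemma linear_le_quadratic_imp_0:
  fixes X b :: real
  assumes "b \<ge> 0" and q: "\<And>s. 2 * s * X \<le> s\<^sup>2 * b"
  shows "X = 0"
proof -
  define y where "y = X / (b + 1)"
  have X: "X = y * (b + 1)" using assms(1) by (simp add: y_def)
  have "2 * y * X \<le> y\<^sup>2 * b" by (rule q)
  also have "\<dots> \<le> y\<^sup>2 * (b + 1)" by (intro mult_left_mono) auto
  finally have "2 * (y\<^sup>2 * (b + 1)) \<le> y\<^sup>2 * (b + 1)" by (simp add: X power2_eq_square algebra_simps)
  then have "y\<^sup>2 * (b + 1) \<le> 0" by linarith
  then have "y\<^sup>2 \<le> 0" using assms(1) by (simp add: mult_le_0_iff)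
  then show ?thesis using X by simp
qed

text \<open>
  The direct method. The concave energy \<open>J \<phi> = 2 \<integral>\<phi> - \<integral>a |\<nabla>\<phi>|\<^sup>2\<close> is bounded above on test functions; a
  maximising sequence is Cauchy by the parallelogram identity and the Poincare inequality, and its
  limit satisfies the Euler-Lagrange equation. The coefficient is bounded below only almost
  everywhere because a conductivity vanishes on the interface.
\<close>

lemma weak_solution_exists:
  fixes a :: "'a::euclidean_space \<Rightarrow> real"
  assumes am[measurable]: "a \<in> borel_measurable (lebesgue_on Omega)" and aA: "\<And>x. \<bar>a x\<bar> \<le> A"
    and m: "m > 0" "AE x in lebesgue_on Omega. m \<le> a x"
  shows "\<exists>u\<in>H10 Omega. \<forall>\<phi>\<in>H10 Omega.
    (LINT x|lebesgue_on Omega. a x * (weak_grad Omega u x \<bullet> weak_grad Omega \<phi> x)) = (LINT x|lebesgue_on Omega. \<phi> x)"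
proof -
  let ?M = "lebesgue_on Omega :: 'a measure"
  define N where "N = real DIM('a)"
  have N: "N \<ge> 1" unfolding N_def using DIM_positive[where 'a='a] by simp
  interpret finite_measure ?M by (rule finite_measure_lebesgue_on[OF Omega_lmeasurable])
  define B where "B g p = (LINT x|?M. a x * (g x \<bullet> p x))" for g p :: "'a \<Rightarrow> 'a"
  define l where "l \<phi> = (LINT x|?M. \<phi> x)" for \<phi> :: "'a \<Rightarrow> real"
  define J where "J \<phi> = 2 * l \<phi> - B (grad \<phi>) (grad \<phi>)" for \<phi>
  define T where "T = {\<phi>. test_function (Omega :: 'a set) \<phi>}"
  note L2T = L2_on_test_function
  have Bint: "integrable ?M (\<lambda>x. a x * (g x \<bullet> p x))" if "L2_on Omega g" "L2_on Omega p" for g p :: "'a \<Rightarrow> 'a"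
    using L2_on_inner_integrable[OF L2_on_bounded_mult[OF that(1) am aA] that(2)] by simp
  have lint: "integrable ?M \<phi>" if "\<phi> \<in> T" for \<phi>
    using L2_on_inner_integrable[OF L2T(1) L2_on_Omega_continuous[OF continuous_on_const, of 1], of Omega \<phi>] that
    by (simp add: T_def)
  have B_add: "B (\<lambda>x. g x + c *\<^sub>R p x) q = B g q + c * B p q"
    if "L2_on Omega g" "L2_on Omega p" "L2_on Omega q" for g p q c
    using Bint[OF that(1,3)] Bint[OF that(2,3)] by (simp add: B_def inner_add_left distrib_left mult.left_commute)
  have B_comm: "B g p = B p g" for g p by (simp add: B_def inner_commute)
  have B_quad: "B (\<lambda>x. g x + c *\<^sub>R p x) (\<lambda>x. g x + c *\<^sub>R p x) = B g g + 2 * c * B g p + c\<^sup>2 * B p p"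
    if "L2_on Omega g" "L2_on Omega p" for g p c
  proof -
    let ?S = "\<lambda>x. g x + c *\<^sub>R p x"
    have "B ?S ?S = B g ?S + c * B p ?S" by (intro B_add that L2_on_add_scaleR)
    moreover have "B g ?S = B g g + c * B p g" "B p ?S = B g p + c * B p p"
      unfolding B_comm[of g ?S] B_comm[of p ?S] by (intro B_add that)+
    ultimately show ?thesis unfolding B_comm[of p g] by (simp add: algebra_simps power2_eq_square)
  qed
  have B_pos: "m * (LINT x|?M. (norm (g x))\<^sup>2) \<le> B g g" if "L2_on Omega g" for g
  proof -
    have "(LINT x|?M. m * (norm (g x))\<^sup>2) \<le> B g g" unfolding B_def
    proof (rule integral_mono_AE[OF _ Bint[OF that that]])
      show "AE x in ?M. m * (norm (g x))\<^sup>2 \<le> a x * (g x \<bullet> g x)"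
        using m(2) by eventually_elim (simp add: power2_norm_eq_inner mult_right_mono)
    qed (use that in \<open>simp add: L2_on_def\<close>)
    then show ?thesis by simp
  qed
  have l_add: "l (\<lambda>x. \<phi> x + c * \<psi> x) = l \<phi> + c * l \<psi>" if "\<phi> \<in> T" "\<psi> \<in> T" for \<phi> \<psi> c
    using lint[OF that(1)] lint[OF that(2)] by (simp add: l_def)
  have T_add: "(\<lambda>x. \<phi> x + c * \<psi> x) \<in> T" "grad (\<lambda>x. \<phi> x + c * \<psi> x) = (\<lambda>x. grad \<phi> x + c *\<^sub>R grad \<psi> x)"
    if "\<phi> \<in> T" "\<psi> \<in> T" for \<phi> \<psi> c
    using test_function_add_scaleR[of Omega \<phi> \<psi> c] that by (auto simp: T_def)
  have L2g: "L2_on Omega (grad \<phi>)" "L2_on Omega \<phi>" if "\<phi> \<in> T" for \<phi> using L2T that by (auto simp: T_def)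
  have J_add: "J (\<lambda>x. \<phi> x + c * \<psi> x) = J \<phi> + 2 * c * (l \<psi> - B (grad \<phi>) (grad \<psi>)) - c\<^sup>2 * B (grad \<psi>) (grad \<psi>)"
    if "\<phi> \<in> T" "\<psi> \<in> T" for \<phi> \<psi> c
    by (simp add: J_def T_add(2)[OF that] B_quad[OF L2g(1)[OF that(1)] L2g(1)[OF that(2)]] l_add[OF that] algebra_simps)
  \<comment> \<open>The square completed pointwise leaves at most \<open>|x|\<^sup>2 / (N\<^sup>2 m)\<close>.\<close>
  have J_bdd: "J \<phi> \<le> (LINT x|?M. 1 / m)" if "\<phi> \<in> T" for \<phi>
  proof -
    have i: "integrable ?M (\<lambda>x. x \<bullet> grad \<phi> x)"
      by (intro L2_on_inner_integrable L2g(1) that L2_on_Omega_continuous continuous_on_id)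
    have "J \<phi> = (LINT x|?M. - (2 / N) * (x \<bullet> grad \<phi> x) - a x * (grad \<phi> x \<bullet> grad \<phi> x))"
      using that i Bint[OF L2g(1) L2g(1), OF that that]
      by (simp add: J_def l_def B_def T_def integral_test_function N_def)
    also have "\<dots> \<le> (LINT x|?M. 1 / m)"
    proof (rule integral_mono_AE)
      show "integrable ?M (\<lambda>x. - (2 / N) * (x \<bullet> grad \<phi> x) - a x * (grad \<phi> x \<bullet> grad \<phi> x))"
        using i Bint[OF L2g(1) L2g(1), OF that that] by simp
      show "AE x in ?M. - (2 / N) * (x \<bullet> grad \<phi> x) - a x * (grad \<phi> x \<bullet> grad \<phi> x) \<le> 1 / m"
        using m(2) AE_space
      proof eventually_elim
        case (elim x)
        then have x: "norm x < 1" by (simp add: Omega_def)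
        have "- (2 / N) * (x \<bullet> grad \<phi> x) - a x * (norm (grad \<phi> x))\<^sup>2 \<le> (norm x)\<^sup>2 / (N\<^sup>2 * a x)"
          using complete_square[of "a x" N x "grad \<phi> x"] elim m(1) N by simp
        also have "\<dots> \<le> 1 / m"
        proof (rule frac_le)
          show "(norm x)\<^sup>2 \<le> 1" using x by (simp add: abs_square_le_1)
          have "1 * m \<le> N\<^sup>2 * a x" using elim m(1) N by (intro mult_mono) (auto intro: one_le_power)
          then show "m \<le> N\<^sup>2 * a x" by simp
        qed (use m in auto)
        finally show ?case by (simp add: power2_norm_eq_inner)
      qed
    qed simp
    finally show ?thesis .
  qed
  define S where "S = (SUP \<phi>\<in>T. J \<phi>)"
  have "(\<lambda>_. 0) \<in> T" by (simp add: T_def test_function_def smooth_on_def Ck_on_const)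
  then have ne: "T \<noteq> {}" by blast
  have bdd: "bdd_above (J ` T)" using J_bdd by (auto intro!: bdd_aboveI)
  have S: "J \<phi> \<le> S" if "\<phi> \<in> T" for \<phi> unfolding S_def using that bdd by (rule cSUP_upper)
  have "\<exists>\<phi>\<in>T. J \<phi> > S - (1 / 4) ^ k" for k :: nat
    unfolding S_def by (rule less_cSUP_iff[OF ne bdd, THEN iffD1]) simp
  then obtain \<phi> where \<phi>: "\<And>k. \<phi> k \<in> T" "\<And>k. J (\<phi> k) > S - (1 / 4) ^ k" by metis
  \<comment> \<open>The midpoint of two near-maximisers has energy at most \<open>S\<close>, so they are close in the form \<open>B\<close>.\<close>
  have CB: "B (\<lambda>x. grad (\<phi> l) x + (-1) *\<^sub>R grad (\<phi> k) x) (\<lambda>x. grad (\<phi> l) x + (-1) *\<^sub>R grad (\<phi> k) x) \<le> 4 * (1 / 4) ^ k"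
    if "k \<le> l" for k l
  proof -
    define \<psi> where "\<psi> x = \<phi> l x + (-1) * \<phi> k x" for x
    have \<psi>: "\<psi> \<in> T" unfolding \<psi>_def using T_add(1)[OF \<phi>(1) \<phi>(1)] .
    have g\<psi>: "grad \<psi> = (\<lambda>x. grad (\<phi> l) x + (-1) *\<^sub>R grad (\<phi> k) x)"
      unfolding \<psi>_def using T_add(2)[OF \<phi>(1) \<phi>(1)] .
    have e: "\<phi> l = (\<lambda>x. \<phi> k x + 1 * \<psi> x)" by (simp add: \<psi>_def)
    have "J (\<phi> l) = J (\<phi> k) + 2 * (LINT x|?M. \<psi> x) - 2 * B (grad (\<phi> k)) (grad \<psi>) - B (grad \<psi>) (grad \<psi>)"
      using J_add[OF \<phi>(1)[of k] \<psi>, of 1] unfolding e[symmetric] by (simp add: l_def)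
    moreover have "J (\<lambda>x. \<phi> k x + (1 / 2) * \<psi> x)
        = J (\<phi> k) + (LINT x|?M. \<psi> x) - B (grad (\<phi> k)) (grad \<psi>) - B (grad \<psi>) (grad \<psi>) / 4"
      using J_add[OF \<phi>(1)[of k] \<psi>, of "1 / 2"] by (simp add: l_def power2_eq_square)
    moreover have "J (\<lambda>x. \<phi> k x + (1 / 2) * \<psi> x) \<le> S" by (intro S T_add(1) \<phi>(1) \<psi>)
    moreover have "J (\<phi> k) > S - (1 / 4) ^ k" "J (\<phi> l) > S - (1 / 4) ^ l" by (rule \<phi>(2))+
    moreover have "(1 / 4 :: real) ^ l \<le> (1 / 4) ^ k" using that by (intro power_decreasing) auto
    ultimately show ?thesis unfolding g\<psi>[symmetric] by linarith
  qed
  have gC: "(LINT x|?M. (norm (grad (\<phi> l) x - grad (\<phi> k) x))\<^sup>2) \<le> (4 / m) * (1 / 4) ^ k" if "k \<le> l" for k l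
    using order_trans[OF B_pos CB[OF that]] L2_on_add_scaleR[OF L2g(1)[OF \<phi>(1)] L2g(1)[OF \<phi>(1)], of l "-1" k] m(1)
    by (simp add: field_simps)
  have uC: "(LINT x|?M. (norm (\<phi> l x - \<phi> k x))\<^sup>2) \<le> (16 / m) * (1 / 4) ^ k" if "k \<le> l" for k l
  proof -
    have "test_function Omega (\<lambda>x. \<phi> l x + (-1) * \<phi> k x)" using T_add(1)[OF \<phi>(1)[of l] \<phi>(1)[of k], of "-1"] by (simp add: T_def)
    from Poincare_test_function[OF this]
    have "(LINT x|?M. (norm (\<phi> l x - \<phi> k x))\<^sup>2) \<le> 4 * (LINT x|?M. (norm (grad (\<phi> l) x - grad (\<phi> k) x))\<^sup>2)"
      unfolding T_add(2)[OF \<phi>(1)[of l] \<phi>(1)[of k], of "-1"] by simp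
    then show ?thesis using gC[OF that] by linarith
  qed
  obtain u where u: "L2_on Omega u" "(\<lambda>k. LINT x|?M. (norm (\<phi> k x - u x))\<^sup>2) \<longlonglongrightarrow> 0"
    using L2_on_complete[OF Omega_lmeasurable L2g(2)[OF \<phi>(1)] uC] by blast
  obtain g where g: "L2_on Omega g" "(\<lambda>k. LINT x|?M. (norm (grad (\<phi> k) x - g x))\<^sup>2) \<longlonglongrightarrow> 0"
    using L2_on_complete[OF Omega_lmeasurable L2g(1)[OF \<phi>(1)] gC] by blast
  have wg: "has_weak_gradient Omega u g"
    unfolding has_weak_gradient_def
  proof (intro conjI u(1) g(1) allI impI ballI)
    fix \<psi> :: "'a \<Rightarrow> real" and i :: 'a assume \<psi>: "test_function Omega \<psi>" and "i \<in> Basis"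
    have c: "L2_on Omega (\<lambda>x. grad \<psi> x \<bullet> i)" "L2_on Omega (\<lambda>x. \<psi> x *\<^sub>R i)"
      using test_function_continuous[OF \<psi>] test_function_continuous_grad[OF \<psi>]
      by (intro L2_on_Omega_continuous continuous_intros; simp)+
    have "(\<lambda>k. LINT x|?M. \<phi> k x * (grad \<psi> x \<bullet> i)) \<longlonglongrightarrow> (LINT x|?M. u x * (grad \<psi> x \<bullet> i))"
      using L2_on_weak_limit[OF L2g(2)[OF \<phi>(1)] u(1) c(1) u(2)] by simp
    moreover have "(\<lambda>k. LINT x|?M. (grad (\<phi> k) x \<bullet> i) * \<psi> x) \<longlonglongrightarrow> (LINT x|?M. (g x \<bullet> i) * \<psi> x)"
      using L2_on_weak_limit[OF L2g(1)[OF \<phi>(1)] g(1) c(2) g(2)] by (simp add: mult.commute)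
    then have "(\<lambda>k. - (LINT x|?M. (grad (\<phi> k) x \<bullet> i) * \<psi> x)) \<longlonglongrightarrow> - (LINT x|?M. (g x \<bullet> i) * \<psi> x)"
      by (rule tendsto_minus)
    moreover have "(LINT x|?M. \<phi> k x * (grad \<psi> x \<bullet> i)) = - (LINT x|?M. (grad (\<phi> k) x \<bullet> i) * \<psi> x)" for k
      using has_weak_gradient_test_function[of "\<phi> k"] \<phi>(1)[of k] \<psi> \<open>i \<in> Basis\<close>
      by (simp add: T_def has_weak_gradient_def)
    ultimately show "(LINT x|?M. u x * (grad \<psi> x \<bullet> i)) = - (LINT x|?M. (g x \<bullet> i) * \<psi> x)"
      by (simp add: LIMSEQ_unique)
  qed
  have uH: "u \<in> H10 Omega" and ug: "AE x in ?M. weak_grad Omega u x = g x"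
    using H10I[OF wg _ u(2) g(2)] \<phi>(1) by (auto simp: T_def)
  have L2a: "L2_on Omega (\<lambda>x. a x *\<^sub>R p x)" if "L2_on Omega p" for p :: "'a \<Rightarrow> 'a"
    using L2_on_bounded_mult[OF that am aA] .
  have EL: "B g (grad \<psi>) = l \<psi>" if \<psi>: "\<psi> \<in> T" for \<psi>
  proof -
    have lim: "(\<lambda>k. B (grad (\<phi> k)) (grad \<psi>)) \<longlonglongrightarrow> B g (grad \<psi>)"
      using L2_on_weak_limit[OF L2g(1)[OF \<phi>(1)] g(1) L2a[OF L2g(1)[OF \<psi>]] g(2)] by (simp add: B_def)
    let ?X = "l \<psi> - B g (grad \<psi>)" and ?b = "B (grad \<psi>) (grad \<psi>)"
    have "0 \<le> m * (LINT x|?M. (norm (grad \<psi> x))\<^sup>2)" using m(1) by simp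
    then have b: "?b \<ge> 0" using B_pos[OF L2g(1)[OF \<psi>]] by linarith
    \<comment> \<open>A variation of \<open>\<phi> k\<close> in direction \<open>\<psi>\<close> gains at most the defect \<open>(1/4)\<^sup>k\<close>; the defect vanishes in the limit.\<close>
    have q: "2 * s * ?X \<le> s\<^sup>2 * ?b" for s
    proof (rule LIMSEQ_le)
      show "(\<lambda>k. 2 * s * (l \<psi> - B (grad (\<phi> k)) (grad \<psi>))) \<longlonglongrightarrow> 2 * s * ?X"
        by (intro tendsto_intros lim)
      show "(\<lambda>k. s\<^sup>2 * ?b + (1 / 4) ^ k) \<longlonglongrightarrow> s\<^sup>2 * ?b"
        using tendsto_add[OF tendsto_const LIMSEQ_power_zero[of "1/4::real"], of "s\<^sup>2 * ?b"] by simp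
      have "2 * s * (l \<psi> - B (grad (\<phi> k)) (grad \<psi>)) \<le> s\<^sup>2 * ?b + (1 / 4) ^ k" for k
        using S[OF T_add(1)[OF \<phi>(1)[of k] \<psi>, of s]] \<phi>(2)[of k] unfolding J_add[OF \<phi>(1)[of k] \<psi>] by linarith
      then show "\<exists>N. \<forall>k\<ge>N. 2 * s * (l \<psi> - B (grad (\<phi> k)) (grad \<psi>)) \<le> s\<^sup>2 * ?b + (1 / 4) ^ k" by blast
    qed
    have "?X = 0" by (rule linear_le_quadratic_imp_0[OF b q])
    then show ?thesis by simp
  qed
  have "B (weak_grad Omega u) (weak_grad Omega \<psi>) = l \<psi>" if \<psi>: "\<psi> \<in> H10 Omega" for \<psi>
  proof -
    obtain \<theta> where \<theta>: "\<And>k. test_function Omega (\<theta> k)"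
      "(\<lambda>k. LINT x|?M. (norm (\<theta> k x - \<psi> x))\<^sup>2) \<longlonglongrightarrow> 0"
      "(\<lambda>k. LINT x|?M. (norm (grad (\<theta> k) x - weak_grad Omega \<psi> x))\<^sup>2) \<longlonglongrightarrow> 0"
      and L2: "L2_on Omega \<psi>" "L2_on Omega (weak_grad Omega \<psi>)"
      using H10E[OF \<psi>] by blast
    have "(\<lambda>k. l (\<theta> k)) \<longlonglongrightarrow> l \<psi>"
      using L2_on_weak_limit[OF L2T(1)[OF \<theta>(1)] L2(1) L2_on_Omega_continuous[OF continuous_on_const, of 1] \<theta>(2)]
      by (simp add: l_def)
    moreover have "(\<lambda>k. B g (grad (\<theta> k))) \<longlonglongrightarrow> B g (weak_grad Omega \<psi>)"
      using L2_on_weak_limit[OF L2T(2)[OF \<theta>(1)] L2(2) L2a[OF g(1)] \<theta>(3)]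
      by (simp add: B_def inner_commute)
    moreover have "B g (grad (\<theta> k)) = l (\<theta> k)" for k using EL \<theta>(1) by (simp add: T_def)
    ultimately have "B g (weak_grad Omega \<psi>) = l \<psi>" by (simp add: LIMSEQ_unique)
    moreover have "B (weak_grad Omega u) (weak_grad Omega \<psi>) = B g (weak_grad Omega \<psi>)"
      unfolding B_def
    proof (rule integral_cong_AE)
      have [measurable]: "g \<in> borel_measurable ?M" "weak_grad Omega \<psi> \<in> borel_measurable ?M"
        "weak_grad Omega u \<in> borel_measurable ?M"
        using g(1) L2(2) H10E[OF uH] by (auto simp: L2_on_def)
      show "(\<lambda>x. a x * (weak_grad Omega u x \<bullet> weak_grad Omega \<psi> x)) \<in> borel_measurable ?M"
        "(\<lambda>x. a x * (g x \<bullet> weak_grad Omega \<psi> x)) \<in> borel_measurable ?M" by measurable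
    qed (use ug in \<open>auto elim!: eventually_mono\<close>)
    ultimately show ?thesis by simp
  qed
  then show ?thesis using uH by (auto simp: B_def l_def)
qed

section \<open>Two-sided bounds for the torsional rigidity\<close>

lemma conductivity_measurable:
  fixes \<omega> :: "'a::euclidean_space set"
  assumes "\<omega> \<in> sets lebesgue"
  shows "conductivity \<sigma>m \<sigma>p \<omega> \<in> borel_measurable (lebesgue_on Omega)"
proof -
  have "conductivity \<sigma>m \<sigma>p \<omega> \<in> borel_measurable lebesgue"
    unfolding conductivity_def[abs_def]
    by (intro borel_measurable_add borel_measurable_times borel_measurable_const borel_measurable_indicator
        assms sets.Diff) (auto simp: Omega_def)
  then show ?thesis by (rule measurable_restrict_space1)
qed

lemma AE_lebesgue_on_Omega_not_in:
  assumes "negligible S"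
  shows "AE x in lebesgue_on Omega. x \<notin> S"
proof -
  have "AE x in lebesgue. x \<notin> S" using assms by (intro AE_not_in) (simp add: negligible_iff_null_sets)
  then show ?thesis
    using Omega_lmeasurable by (subst AE_restrict_space_iff) (auto elim: eventually_mono)
qed

lemma AE_conductivity:
  assumes "negligible (closure \<omega> - \<omega>)"
  shows "AE x in lebesgue_on Omega. conductivity \<sigma>m \<sigma>p \<omega> x = (if x \<in> \<omega> then \<sigma>m else \<sigma>p)"
  using AE_lebesgue_on_Omega_not_in[OF assms] AE_space
proof eventually_elim
  case (elim x)
  then show ?case using closure_subset[of \<omega>] by (auto simp: conductivity_def)
qed

text \<open>
  Both bounds come from the completed square. Testing with the solution itself and dropping the
  square gives the upper bound; testing with \<open>\<phi>\<close> and using that the solution maximises the energy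
  gives the lower one. The gap is the squared distance, weighted by \<open>a\<close>, of \<open>- x / (N a)\<close> from the
  gradients of test functions, and so is of second order along a deformation of a centred ball.
\<close>

lemma torsional_rigidity_bounds:
  fixes \<omega> :: "'a::euclidean_space set"
  assumes \<sigma>: "\<sigma>m > 0" "\<sigma>p > 0" and \<omega>: "\<omega> \<in> sets lebesgue" "negligible (closure \<omega> - \<omega>)"
  defines "a \<equiv> conductivity \<sigma>m \<sigma>p \<omega>" and "N \<equiv> real DIM('a)"
  shows "torsional_rigidity \<sigma>m \<sigma>p \<omega> \<le> (LINT x|lebesgue_on Omega. (norm x)\<^sup>2 / (N\<^sup>2 * a x))"
    and "\<And>\<phi>. test_function Omega \<phi> \<Longrightarrow>
      (LINT x|lebesgue_on Omega. (norm x)\<^sup>2 / (N\<^sup>2 * a x))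
        - (LINT x|lebesgue_on Omega. a x * (norm (grad \<phi> x + (1 / (N * a x)) *\<^sub>R x))\<^sup>2)
      \<le> torsional_rigidity \<sigma>m \<sigma>p \<omega>"
proof -
  let ?M = "lebesgue_on Omega :: 'a measure"
  interpret finite_measure ?M by (rule finite_measure_lebesgue_on[OF Omega_lmeasurable])
  have N: "N \<ge> 1" "N > 0" unfolding N_def using DIM_positive[where 'a='a] by simp_all
  define m where "m = min \<sigma>m \<sigma>p"
  have m: "m > 0" using \<sigma> by (simp add: m_def)
  have am[measurable]: "a \<in> borel_measurable ?M" unfolding a_def by (rule conductivity_measurable[OF \<omega>(1)])
  have aA: "\<bar>a x\<bar> \<le> \<sigma>m + \<sigma>p" for x
    using \<sigma> by (auto simp: a_def conductivity_def indicator_def)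
  have ae: "AE x in ?M. m \<le> a x"
    using AE_conductivity[OF \<omega>(2), of \<sigma>m \<sigma>p] unfolding a_def by eventually_elim (simp add: m_def)
  define u where "u = torsion_function \<sigma>m \<sigma>p \<omega>"
  have "\<exists>u. weak_solution \<sigma>m \<sigma>p \<omega> u"
    using weak_solution_exists[OF am aA m ae] unfolding weak_solution_def a_def by blast
  then have "weak_solution \<sigma>m \<sigma>p \<omega> u"
    unfolding u_def torsion_function_def by (rule someI_ex)
  then have uH: "u \<in> H10 Omega"
    and EL: "\<And>\<phi>. \<phi> \<in> H10 Omega \<Longrightarrow>
      (LINT x|?M. a x * (weak_grad Omega u x \<bullet> weak_grad Omega \<phi> x)) = (LINT x|?M. \<phi> x)"
    by (auto simp: weak_solution_def a_def)
  let ?g = "weak_grad Omega u"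
  have L2g: "L2_on Omega ?g" by (rule H10E[OF uH])
  have E_def: "torsional_rigidity \<sigma>m \<sigma>p \<omega> = (LINT x|?M. a x * (norm (?g x))\<^sup>2)"
    by (simp add: torsional_rigidity_def a_def u_def)
  have E_u: "torsional_rigidity \<sigma>m \<sigma>p \<omega> = (LINT x|?M. u x)"
    unfolding E_def using EL[OF uH] by (simp add: power2_norm_eq_inner)
  have Bint: "integrable ?M (\<lambda>x. a x * (f x \<bullet> p x))" if "L2_on Omega f" "L2_on Omega p" for f p :: "'a \<Rightarrow> 'a"
    using L2_on_inner_integrable[OF L2_on_bounded_mult[OF that(1) am aA] that(2)] by simp
  have Bint2: "integrable ?M (\<lambda>x. a x * (norm (f x))\<^sup>2)" if "L2_on Omega f" for f :: "'a \<Rightarrow> 'a"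
    using Bint[OF that that] by (simp add: power2_norm_eq_inner)
  have xint: "integrable ?M (\<lambda>x. x \<bullet> f x)" if "L2_on Omega f" for f :: "'a \<Rightarrow> 'a"
    by (intro L2_on_inner_integrable that L2_on_Omega_continuous continuous_on_id)
  have Gint: "integrable ?M (\<lambda>x. (norm x)\<^sup>2 / (N\<^sup>2 * a x))"
  proof (rule integrable_const_bound[where B="1 / (N\<^sup>2 * m)"])
    show "AE x in ?M. norm ((norm x)\<^sup>2 / (N\<^sup>2 * a x)) \<le> 1 / (N\<^sup>2 * m)"
      using ae AE_space
    proof eventually_elim
      case (elim x)
      then have "(norm x)\<^sup>2 \<le> 1" by (simp add: Omega_def abs_square_le_1)
      then show ?case using elim m N by (auto intro!: frac_le mult_left_mono)
    qed
  qed (use borel_measurable_lebesgue_on_continuous[OF continuous_on_id, of Omega] in measurable)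
  have sq: "(LINT x|?M. - (2 / N) * (x \<bullet> f x) - a x * (norm (f x))\<^sup>2)
      = (LINT x|?M. (norm x)\<^sup>2 / (N\<^sup>2 * a x)) - (LINT x|?M. a x * (norm (f x + (1 / (N * a x)) *\<^sub>R x))\<^sup>2)"
    if f: "L2_on Omega f" for f
  proof -
    have [measurable]: "f \<in> borel_measurable ?M" using f by (simp add: L2_on_def)
    have [measurable]: "(\<lambda>x. x) \<in> borel_measurable ?M"
      by (rule borel_measurable_lebesgue_on_continuous[OF continuous_on_id])
    have eq: "AE x in ?M. a x * (norm (f x + (1 / (N * a x)) *\<^sub>R x))\<^sup>2
        = (norm x)\<^sup>2 / (N\<^sup>2 * a x) - (- (2 / N) * (x \<bullet> f x) - a x * (norm (f x))\<^sup>2)"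
      using ae
    proof eventually_elim
      case (elim x)
      then show ?case using complete_square[of "a x" N x "f x"] m N by simp
    qed
    have "(LINT x|?M. a x * (norm (f x + (1 / (N * a x)) *\<^sub>R x))\<^sup>2)
      = (LINT x|?M. (norm x)\<^sup>2 / (N\<^sup>2 * a x) - (- (2 / N) * (x \<bullet> f x) - a x * (norm (f x))\<^sup>2))"
      by (rule integral_cong_AE[OF _ _ eq]) measurable
    also have "\<dots> = (LINT x|?M. (norm x)\<^sup>2 / (N\<^sup>2 * a x))
        - (LINT x|?M. - (2 / N) * (x \<bullet> f x) - a x * (norm (f x))\<^sup>2)"
      using Gint xint[OF f] Bint2[OF f] by (intro Bochner_Integration.integral_diff) auto
    finally show ?thesis by simp
  qed
  have J: "(LINT x|?M. - (2 / N) * (x \<bullet> f x) - a x * (norm (f x))\<^sup>2)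
      = - (2 / N) * (LINT x|?M. x \<bullet> f x) - (LINT x|?M. a x * (norm (f x))\<^sup>2)" if f: "L2_on Omega f" for f
    using xint[OF f] Bint2[OF f] by simp
  have nonneg: "0 \<le> (LINT x|?M. a x * (norm (f x))\<^sup>2)" for f :: "'a \<Rightarrow> 'a"
    by (rule integral_nonneg_AE) (use ae m in \<open>auto elim!: eventually_mono\<close>)
  have "torsional_rigidity \<sigma>m \<sigma>p \<omega> = 2 * (LINT x|?M. u x) - (LINT x|?M. a x * (norm (?g x))\<^sup>2)"
    using E_u E_def by simp
  also have "\<dots> = - (2 / N) * (LINT x|?M. x \<bullet> ?g x) - (LINT x|?M. a x * (norm (?g x))\<^sup>2)"
    unfolding integral_H10[OF uH] by (simp add: N_def)
  also have "\<dots> \<le> (LINT x|?M. (norm x)\<^sup>2 / (N\<^sup>2 * a x))"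
    unfolding J[OF L2g, symmetric] sq[OF L2g] using nonneg by simp
  finally show "torsional_rigidity \<sigma>m \<sigma>p \<omega> \<le> (LINT x|?M. (norm x)\<^sup>2 / (N\<^sup>2 * a x))" .
  fix \<phi> :: "'a \<Rightarrow> real" assume \<phi>: "test_function Omega \<phi>"
  note L2\<phi> = L2_on_test_function(2)[OF \<phi>]
  have cross: "(LINT x|?M. a x * (?g x \<bullet> grad \<phi> x)) = (LINT x|?M. \<phi> x)"
  proof -
    have wg\<phi>: "L2_on Omega (weak_grad Omega \<phi>)" by (rule H10E[OF test_function_in_H10(1)[OF \<phi>]])
    have [measurable]: "?g \<in> borel_measurable ?M" "grad \<phi> \<in> borel_measurable ?M" "weak_grad Omega \<phi> \<in> borel_measurable ?M"
      using L2g L2\<phi> wg\<phi> unfolding L2_on_def by blast+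
    have "(LINT x|?M. a x * (?g x \<bullet> grad \<phi> x)) = (LINT x|?M. a x * (?g x \<bullet> weak_grad Omega \<phi> x))"
    proof (rule integral_cong_AE)
      show "AE x in ?M. a x * (?g x \<bullet> grad \<phi> x) = a x * (?g x \<bullet> weak_grad Omega \<phi> x)"
        using test_function_in_H10(2)[OF \<phi>] by eventually_elim simp
    qed measurable
    then show ?thesis using EL[OF test_function_in_H10(1)[OF \<phi>]] by simp
  qed
  have "0 \<le> (LINT x|?M. a x * (norm (?g x - grad \<phi> x))\<^sup>2)" by (rule nonneg)
  also have "\<dots> = (LINT x|?M. a x * (norm (?g x))\<^sup>2 - 2 * (a x * (?g x \<bullet> grad \<phi> x)) + a x * (norm (grad \<phi> x))\<^sup>2)"
    unfolding power2_norm_eq_inner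
    by (rule Bochner_Integration.integral_cong[OF refl])
      (simp add: inner_diff_left inner_diff_right inner_commute[of "grad \<phi> _" "?g _"] algebra_simps)
  also have "\<dots> = torsional_rigidity \<sigma>m \<sigma>p \<omega> - 2 * (LINT x|?M. \<phi> x) + (LINT x|?M. a x * (norm (grad \<phi> x))\<^sup>2)"
    using Bint2[OF L2g] Bint[OF L2g L2\<phi>] Bint2[OF L2\<phi>] by (simp add: E_def cross)
  finally have "2 * (LINT x|?M. \<phi> x) - (LINT x|?M. a x * (norm (grad \<phi> x))\<^sup>2) \<le> torsional_rigidity \<sigma>m \<sigma>p \<omega>" by simp
  moreover have "2 * (LINT x|?M. \<phi> x) - (LINT x|?M. a x * (norm (grad \<phi> x))\<^sup>2)
      = - (2 / N) * (LINT x|?M. x \<bullet> grad \<phi> x) - (LINT x|?M. a x * (norm (grad \<phi> x))\<^sup>2)"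
    unfolding integral_test_function[OF \<phi>] by (simp add: N_def)
  ultimately show "(LINT x|?M. (norm x)\<^sup>2 / (N\<^sup>2 * a x))
        - (LINT x|?M. a x * (norm (grad \<phi> x + (1 / (N * a x)) *\<^sub>R x))\<^sup>2)
      \<le> torsional_rigidity \<sigma>m \<sigma>p \<omega>"
    unfolding J[OF L2\<phi>, symmetric] sq[OF L2\<phi>] by simp
qed

section \<open>First-order expansion of an admissible deformation\<close>

text \<open>
  The functions \<open>q v t x\<close> in the proof are the mixed derivatives of \<open>\<Phi>\<close> in time and in the spatial
  direction \<open>v\<close>. They are continuous up to \<open>t = 0\<close> and vanish off a compact set, hence are uniformly
  continuous for \<open>t \<le> 1/2\<close>, which makes \<open>D\<^sub>x\<Phi>(t) = I + t q(0) + o(t)\<close> uniform in \<open>x\<close>. The quotients \<open>(\<Phi>(t) - Id) / t\<close>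
  then converge to \<open>h\<close> with uniformly convergent derivatives, so \<open>q(0)\<close> is the derivative of \<open>h\<close>.
\<close>

lemma admissible_expansion:
  fixes \<Phi> :: "real \<Rightarrow> 'a::euclidean_space \<Rightarrow> 'a"
  assumes adm: "\<Phi> \<in> admissible" and fo: "first_order_field \<Phi> h"
  obtains D H K where
    "\<And>t x. t \<in> {0..<1} \<Longrightarrow> (\<Phi> t has_derivative D t x) (at x)"
    "\<And>t v. t \<in> {0..<1} \<Longrightarrow> continuous_on UNIV (\<lambda>x. D t x v)"
    "\<And>x. (h has_derivative H x) (at x)"
    "\<And>v. continuous_on UNIV (\<lambda>x. H x v)"
    "\<And>e. e > 0 \<Longrightarrow> \<exists>d>0. d < 1 \<and> (\<forall>t\<in>{0<..<d}. \<forall>x v. norm (D t x v - v - t *\<^sub>R H x v) \<le> e * t * norm v)"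
    "compact K" "K \<subseteq> Omega" "\<And>x. x \<notin> K \<Longrightarrow> h x = 0" "\<And>x v. x \<notin> K \<Longrightarrow> H x v = 0"
    "\<And>t x. t \<in> {0..<1} \<Longrightarrow> x \<notin> K \<Longrightarrow> \<Phi> t x = x"
proof -
  define S :: "(real \<times> 'a) set" where "S = {0..<1} \<times> UNIV"
  define F where "F = (\<lambda>(t, x). \<Phi> t x)"
  have sm: "\<And>k. Ck_on k S F" and \<Phi>0: "\<Phi> 0 = id"
    using adm by (auto simp: admissible_def smooth_on_def S_def F_def)
  obtain K0 where K0: "compact (closure K0)" "closure K0 \<subseteq> Omega" "\<And>t x. t \<in> {0..<1} \<Longrightarrow> x \<notin> K0 \<Longrightarrow> \<Phi> t x = x"
    using adm by (auto simp: admissible_def)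
  define K where "K = closure K0"
  have K: "compact K" "K \<subseteq> Omega" using K0 by (auto simp: K_def)
  have out: "\<Phi> t x = x" if "t \<in> {0..<1}" "x \<notin> K" for t x
    using that K0(3) closure_subset[of K0] by (auto simp: K_def)
  obtain F' where F': "\<And>p. p \<in> S \<Longrightarrow> (F has_derivative F' p) (at p within S)" and F'1: "\<And>w. Ck_on (Suc 0) S (\<lambda>p. F' p w)"
    using sm[of "Suc (Suc 0)"] unfolding Ck_on.simps(2)[of "Suc 0"] by blast
  define D where "D t x v = F' (t, x) (0, v)" for t x v
  have "\<forall>v. \<exists>G. (\<forall>p\<in>S. ((\<lambda>p. F' p (0, v)) has_derivative G p) (at p within S)) \<and> (\<forall>w. continuous_on S (\<lambda>p. G p w))"
    using F'1 unfolding Ck_on.simps by blast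
  then obtain G where G: "\<And>v p. p \<in> S \<Longrightarrow> ((\<lambda>p. F' p (0, v)) has_derivative G v p) (at p within S)"
      "\<And>v w. continuous_on S (\<lambda>p. G v p w)" by metis
  define q where "q v t x = G v (t, x) (1, 0)" for v t x
  have DD: "(\<Phi> t has_derivative D t x) (at x)" if t: "t \<in> {0..<1}" for t x
  proof -
    have "(F has_derivative F' (t, x)) (at (t, x) within range (Pair t))"
      by (rule has_derivative_subset[OF F']) (use t in \<open>auto simp: S_def\<close>)
    from has_derivative_in_compose[of "Pair t" "\<lambda>v. (0, v)" x UNIV,
        OF has_derivative_Pair[OF has_derivative_const has_derivative_ident] this]
    have "((\<lambda>x. F (t, x)) has_derivative (\<lambda>v. F' (t, x) (0, v))) (at x)" .
    then show ?thesis by (simp add: F_def D_def[abs_def])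
  qed
  have contD: "continuous_on UNIV (\<lambda>x. D t x v)" if t: "t \<in> {0..<1}" for t v
  proof -
    have c: "continuous_on S (\<lambda>p. F' p (0, v))" using F'1 by (rule Ck_on_imp_continuous_on)
    have "continuous_on UNIV (\<lambda>x::'a. (t, x))" by (intro continuous_intros)
    moreover have "range (\<lambda>x::'a. (t, x)) \<subseteq> S" using t by (auto simp: S_def)
    ultimately show ?thesis unfolding D_def by (rule continuous_on_compose2[OF c])
  qed
  have contq: "continuous_on S (\<lambda>p. q v (fst p) (snd p))" for v using G(2)[of v "(1, 0)"] by (simp add: q_def)
  have Dt: "((\<lambda>t. D t x v) has_vector_derivative q v t x) (at t within {0..<1})" if t: "t \<in> {0..<1}" for t x v
  proof -
    have "((\<lambda>p. F' p (0, v)) has_derivative G v (t, x)) (at (t, x) within (\<lambda>t. (t, x)) ` {0..<1})"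
      by (rule has_derivative_subset[OF G(1)]) (use t in \<open>auto simp: S_def\<close>)
    from has_derivative_in_compose[of "\<lambda>t. (t, x)" "\<lambda>s. (s, 0)" t "{0..<1}",
        OF has_derivative_Pair[OF has_derivative_ident has_derivative_const] this]
    have d: "((\<lambda>t. F' (t, x) (0, v)) has_derivative (\<lambda>s. G v (t, x) (s, 0))) (at t within {0..<1})" .
    have "G v (t, x) (s, 0) = s *\<^sub>R q v t x" for s
      using linear_scale[OF has_derivative_linear[OF G(1)[of "(t, x)" v]], of s "(1, 0)"] t
      by (simp add: q_def S_def)
    with d show ?thesis by (simp add: has_vector_derivative_def D_def)
  qed
  have D0: "D 0 x v = v" for x v
  proof -
    have "((\<lambda>x. x) has_derivative D 0 x) (at x)" using DD[of 0 x] by (simp add: \<Phi>0 id_def)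
    then have "D 0 x = (\<lambda>v. v)" using has_derivative_ident has_derivative_unique by blast
    then show ?thesis by simp
  qed
  have Dout: "D t x v = v" if "t \<in> {0..<1}" "x \<notin> K" for t x v
  proof -
    have "((\<lambda>x. x) has_derivative D t x) (at x)"
      by (rule has_derivative_transform_within_open[OF DD[OF that(1)], of "- K"])
        (use that out K(1) compact_imp_closed in auto)
    then have "D t x = (\<lambda>v. v)" using has_derivative_ident has_derivative_unique by blast
    then show ?thesis by simp
  qed
  have qout: "q v t x = 0" if "t \<in> {0..<1}" "x \<notin> K" for t x v
  proof -
    have "((\<lambda>t. v) has_vector_derivative q v t x) (at t within {0..<1})"
      by (rule has_vector_derivative_transform[OF that(1) _ Dt[OF that(1)]]) (use Dout that in auto)
    then show ?thesis
      by (rule vector_derivative_unique_within[OF _ _ has_vector_derivative_const, rotated])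
        (use that(1) in \<open>auto simp: trivial_limit_within islimpt_Ico\<close>)
  qed
  have est: "\<exists>d>0. d < 1 \<and> (\<forall>t\<in>{0<..<d}. \<forall>x. norm (D t x v - v - t *\<^sub>R q v 0 x) \<le> e * t)" if "e > 0" for e v
  proof -
    have "uniformly_continuous_on ({0..1/2} \<times> K) (\<lambda>p. q v (fst p) (snd p))"
      by (intro compact_uniformly_continuous continuous_on_subset[OF contq] compact_Times K)
        (auto simp: S_def)
    then obtain d where d: "d > 0" "\<And>p p'. p \<in> {0..1/2} \<times> K \<Longrightarrow> p' \<in> {0..1/2} \<times> K \<Longrightarrow> dist p' p < d \<Longrightarrow>
        dist (q v (fst p') (snd p')) (q v (fst p) (snd p)) < e"
      using \<open>e > 0\<close> unfolding uniformly_continuous_on_def by metis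
    have qe: "norm (q v s x - q v 0 x) \<le> e" if s: "0 \<le> s" "s < d" "s \<le> 1/2" for s x
    proof (cases "x \<in> K")
      case True
      then show ?thesis using d(2)[of "(0, x)" "(s, x)"] s
        by (auto simp: dist_Pair_Pair dist_norm intro: less_imp_le)
    next
      case False
      then show ?thesis using qout[of s x] qout[of 0 x] s \<open>e > 0\<close> by simp
    qed
    have "norm (D t x v - v - t *\<^sub>R q v 0 x) \<le> e * t" if t: "0 < t" "t < min d (1/2)" for t x
    proof -
      have "norm ((D t x v - t *\<^sub>R q v 0 x) - (D 0 x v - 0 *\<^sub>R q v 0 x)) \<le> e * norm (t - 0)"
      proof (rule differentiable_bound[where S="{0..t}" and f'="\<lambda>s r. r *\<^sub>R (q v s x - q v 0 x)"])
        fix s assume s: "s \<in> {0..t}"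
        have "((\<lambda>t. D t x v) has_vector_derivative q v s x) (at s within {0..t})"
          by (rule has_vector_derivative_within_subset[OF Dt]) (use s t in auto)
        then show "((\<lambda>t. D t x v - t *\<^sub>R q v 0 x) has_derivative (\<lambda>r. r *\<^sub>R (q v s x - q v 0 x))) (at s within {0..t})"
          unfolding has_vector_derivative_def by (auto intro!: derivative_eq_intros simp: scaleR_diff_right)
        show "onorm (\<lambda>r. r *\<^sub>R (q v s x - q v 0 x)) \<le> e"
          using qe[of s x] s t by (intro onorm_le) (auto simp: mult.commute[of e] intro: mult_left_mono)
      qed (use t in auto)
      then show ?thesis using t by (simp add: D0 algebra_simps)
    qed
    then show ?thesis using d(1) by (intro exI[of _ "min d (1/2)"]) auto
  qed
  define H where "H x v = (\<Sum>i\<in>Basis. (v \<bullet> i) *\<^sub>R q i 0 x)" for x v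
  have Hout: "H x v = 0" if "x \<notin> K" for x v using qout[of 0 x] that by (simp add: H_def)
  have exp: "\<exists>d>0. d < 1 \<and> (\<forall>t\<in>{0<..<d}. \<forall>x v. norm (D t x v - v - t *\<^sub>R H x v) \<le> e * t * norm v)" if "e > 0" for e
  proof -
    have "\<forall>i\<in>Basis. \<exists>d>0. d < 1 \<and> (\<forall>t\<in>{0<..<d}. \<forall>x. norm (D t x i - i - t *\<^sub>R q i 0 x) \<le> (e / DIM('a)) * t)"
      using est[of "e / DIM('a)"] that by simp
    then obtain d where d: "\<And>i. i \<in> Basis \<Longrightarrow> d i > 0 \<and> d i < 1 \<and> (\<forall>t\<in>{0<..<d i}. \<forall>x. norm (D t x i - i - t *\<^sub>R q i 0 x) \<le> (e / DIM('a)) * t)"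
      by metis
    define d0 where "d0 = Min (d ` (Basis :: 'a set))"
    have d0: "d0 > 0" "d0 < 1" using d by (auto simp: d0_def Min_gr_iff Min_less_iff ex_in_conv)
    have le: "d0 \<le> d i" if "i \<in> Basis" for i using that by (simp add: d0_def)
    have "norm (D t x v - v - t *\<^sub>R H x v) \<le> e * t * norm v" if t: "t \<in> {0<..<d0}" for t x v
    proof -
      have lin: "linear (D t x)" using DD[of t x] t d0 by (intro has_derivative_linear) auto
      have "D t x v - v - t *\<^sub>R H x v
          = (\<Sum>i\<in>Basis. (v \<bullet> i) *\<^sub>R D t x i) - (\<Sum>i\<in>Basis. (v \<bullet> i) *\<^sub>R i) - t *\<^sub>R H x v"
        using linear_basis_expansion[OF lin, of v] by (simp add: euclidean_representation)
      also have "\<dots> = (\<Sum>i\<in>Basis. (v \<bullet> i) *\<^sub>R (D t x i - i - t *\<^sub>R q i 0 x))"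
        by (simp add: H_def sum_subtractf scaleR_sum_right scaleR_diff_right mult.commute)
      also have "norm \<dots> \<le> (\<Sum>i\<in>(Basis::'a set). norm v * ((e / DIM('a)) * t))"
      proof (rule sum_norm_le)
        fix i :: 'a assume i: "i \<in> Basis"
        then show "norm ((v \<bullet> i) *\<^sub>R (D t x i - i - t *\<^sub>R q i 0 x)) \<le> norm v * ((e / DIM('a)) * t)"
          unfolding norm_scaleR using d[OF i] le[OF i] t by (intro mult_mono) (auto simp: Basis_le_norm)
      qed
      also have "\<dots> = e * t * norm v" by simp
      finally show ?thesis .
    qed
    then show ?thesis using d0 by blast
  qed
  define s where "s n = inverse (real (Suc (Suc n)))" for n
  have s: "0 < s n" "s n < 1" for n by (auto simp: s_def field_simps)
  have s0: "s \<longlonglongrightarrow> 0" unfolding s_def using LIMSEQ_Suc[OF LIMSEQ_inverse_real_of_nat] .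
  have hlim: "(\<lambda>n. (\<Phi> (s n) x - x) /\<^sub>R s n) \<longlonglongrightarrow> h x" for x
  proof -
    have "filterlim s (at_right 0) sequentially"
      using s0 s by (auto simp: filterlim_at intro!: always_eventually less_imp_neq[THEN not_sym])
    moreover have "((\<lambda>t. (\<Phi> t x - (x + t *\<^sub>R h x)) /\<^sub>R t) \<longlongrightarrow> 0) (at_right 0)"
      using fo by (simp add: first_order_field_def)
    ultimately have "(\<lambda>n. (\<Phi> (s n) x - (x + s n *\<^sub>R h x)) /\<^sub>R s n) \<longlonglongrightarrow> 0" by (rule filterlim_compose[rotated])
    moreover have "(\<Phi> (s n) x - (x + s n *\<^sub>R h x)) /\<^sub>R s n = (\<Phi> (s n) x - x) /\<^sub>R s n - h x" for n
      using s(1)[of n] by (simp add: scaleR_diff_right scaleR_add_right)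
    ultimately show ?thesis by (simp add: LIM_zero_iff)
  qed
  have "\<exists>g. \<forall>x\<in>UNIV. (\<lambda>n. (\<Phi> (s n) x - x) /\<^sub>R s n) \<longlonglongrightarrow> g x \<and> (g has_derivative H x) (at x within UNIV)"
  proof (rule has_derivative_sequence[where f'="\<lambda>n x v. (D (s n) x v - v) /\<^sub>R s n" and ?x0.0=0])
    show "((\<lambda>x. (\<Phi> (s n) x - x) /\<^sub>R s n) has_derivative (\<lambda>v. (D (s n) x v - v) /\<^sub>R s n)) (at x within UNIV)" for n x
      using DD[of "s n" x] s[of n] by (auto intro!: derivative_eq_intros)
    show "(\<lambda>n. (\<Phi> (s n) 0 - 0) /\<^sub>R s n) \<longlonglongrightarrow> h 0" by (rule hlim)
    fix e :: real assume "e > 0"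
    then obtain d where d: "d > 0" "\<And>t x v. t \<in> {0<..<d} \<Longrightarrow> norm (D t x v - v - t *\<^sub>R H x v) \<le> e * t * norm v"
      using exp[of e] by blast
    have "\<forall>\<^sub>F n in sequentially. s n < d" using s0 d(1) by (rule order_tendstoD)
    then show "\<forall>\<^sub>F n in sequentially. \<forall>x\<in>UNIV. \<forall>v. norm ((D (s n) x v - v) /\<^sub>R s n - H x v) \<le> e * norm v"
    proof eventually_elim
      case (elim n)
      have "norm ((D (s n) x v - v) /\<^sub>R s n - H x v) \<le> e * norm v" for x v
      proof -
        have "(D (s n) x v - v) /\<^sub>R s n - H x v = (D (s n) x v - v - s n *\<^sub>R H x v) /\<^sub>R s n"
          using s(1)[of n] by (simp add: scaleR_diff_right)
        also have "norm \<dots> = norm (D (s n) x v - v - s n *\<^sub>R H x v) / s n"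
          using s(1)[of n] by (simp add: divide_inverse mult.commute)
        also have "\<dots> \<le> e * norm v"
          using d(2)[of "s n" x v] s(1)[of n] elim by (simp add: divide_le_eq mult.commute mult.left_commute)
        finally show ?thesis .
      qed
      then show ?case by blast
    qed
  qed auto
  then obtain g where g: "\<And>x. (\<lambda>n. (\<Phi> (s n) x - x) /\<^sub>R s n) \<longlonglongrightarrow> g x" "\<And>x. (g has_derivative H x) (at x)" by auto
  have "g = h" using LIMSEQ_unique[OF g(1) hlim] by auto
  with g(2) have hH: "(h has_derivative H x) (at x)" for x by simp
  have hout: "h x = 0" if "x \<notin> K" for x
  proof -
    have "(\<lambda>n. (\<Phi> (s n) x - x) /\<^sub>R s n) = (\<lambda>n. 0)" using out[of "s _" x] s that by (auto simp: less_imp_le)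
    with hlim[of x] show ?thesis by (simp add: LIMSEQ_const_iff)
  qed
  have contH: "continuous_on UNIV (\<lambda>x. H x v)" for v
  proof -
    have "continuous_on UNIV (\<lambda>x. q i 0 x)" for i
    proof -
      have "continuous_on UNIV (\<lambda>x::'a. (0::real, x))" by (intro continuous_intros)
      moreover have "range (\<lambda>x::'a. (0::real, x)) \<subseteq> S" by (auto simp: S_def)
      ultimately have "continuous_on UNIV (\<lambda>x. q i (fst (0::real, x)) (snd (0::real, x)))"
        by (rule continuous_on_compose2[OF contq])
      then show ?thesis by simp
    qed
    then show ?thesis unfolding H_def by (intro continuous_intros)
  qed
  show ?thesis by (rule that[OF DD contD hH contH exp K hout Hout out])
qed

section \<open>The divergence theorem on a ball\<close>

lemma integral_scale_measure:
  fixes f :: "'a \<Rightarrow> real"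
  assumes "c \<ge> 0" "f \<in> borel_measurable M"
  shows "(LINT x|scale_measure (ennreal c) M. f x) = c * (LINT x|M. f x)"
proof -
  have "scale_measure (ennreal c) M = density M (\<lambda>_. ennreal c)"
    by (rule measure_eqI) (auto simp: emeasure_density_const)
  then show ?thesis using assms by (simp add: integral_density)
qed

lemma lborel_integral_scale:
  fixes f :: "'a::euclidean_space \<Rightarrow> real"
  assumes "c > 0" "f \<in> borel_measurable borel"
  shows "(LINT x|lborel. f x) = c ^ DIM('a) * (LINT x|lborel. f (c *\<^sub>R x))"
proof -
  have "(LINT x|lborel. f x) = (LINT x|density (distr lborel borel (\<lambda>x. 0 + c *\<^sub>R x)) (\<lambda>_. ennreal (\<bar>c\<bar> ^ DIM('a))). f x)"
    using lborel_affine[of c "0::'a"] assms(1) by simp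
  also have "\<dots> = c ^ DIM('a) * (LINT x|lborel. f (c *\<^sub>R x))"
    using assms by (simp add: integral_density integral_distr)
  finally show ?thesis .
qed

lemma integrable_bounded_on_cball:
  fixes f :: "'a::euclidean_space \<Rightarrow> real"
  assumes [measurable]: "f \<in> borel_measurable borel" and "\<And>x. norm x \<le> R \<Longrightarrow> \<bar>f x\<bar> \<le> B" "\<And>x. norm x > R \<Longrightarrow> f x = 0"
  shows "integrable lborel f"
proof (rule Bochner_Integration.integrable_bound)
  show "integrable lborel (\<lambda>x. B * indicator (cball (0::'a) R) x)"
    by (intro integrable_mult_right integrable_real_indicator)
      (use emeasure_lborel_cball_finite[of "0::'a" R] in auto)
  show "AE x in lborel. norm (f x) \<le> norm (B * indicator (cball (0::'a) R) x)"
    using assms(2,3) by (intro AE_I2) (fastforce simp: indicator_def not_le)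
qed simp

lemma surface_measure_integral:
  fixes W :: "'a::euclidean_space \<Rightarrow> 'a"
  assumes R: "R > 0" and [measurable]: "W \<in> borel_measurable borel"
  shows "(LINT x:sphere 0 R|surface_measure R. W x \<bullet> outward_normal R x)
    = real DIM('a) * R ^ (DIM('a) - 1) * (LINT x|lborel. indicator (ball 0 1) x * (W (R *\<^sub>R sgn x) \<bullet> sgn x))"
proof -
  let ?f = "\<lambda>x. indicator (sphere 0 R) x * (W x \<bullet> (x /\<^sub>R R))"
  have [measurable]: "sphere (0::'a) R \<in> sets borel" by (simp add: borel_closed)
  have [measurable]: "(\<lambda>x::'a. x /\<^sub>R R) \<in> borel_measurable borel"
    by (intro borel_measurable_continuous_onI continuous_intros)
  have m: "?f \<in> borel_measurable borel" by measurable
  have "(LINT x:sphere 0 R|surface_measure R. W x \<bullet> outward_normal R x) = (LINT x|surface_measure R. ?f x)"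
    by (simp only: set_lebesgue_integral_def outward_normal_def real_scaleR_def)
  also have "\<dots> = real DIM('a) * R ^ (DIM('a) - 1) *
      (LINT x|distr (restrict_space lborel (ball 0 1)) borel (\<lambda>x. R *\<^sub>R sgn x). ?f x)"
    unfolding surface_measure_def using R by (intro integral_scale_measure) auto
  also have "(LINT x|distr (restrict_space lborel (ball 0 1)) borel (\<lambda>x. R *\<^sub>R sgn x). ?f x)
      = (LINT x|restrict_space lborel (ball 0 1). ?f (R *\<^sub>R sgn x))"
    by (rule integral_distr[OF _ m]) (auto intro!: measurable_restrict_space1)
  also have "\<dots> = (LINT x|lborel. indicator (ball 0 1) x * ?f (R *\<^sub>R sgn x))"
    by (subst integral_restrict_space) auto
  also have "\<dots> = (LINT x|lborel. indicator (ball 0 1) x * (W (R *\<^sub>R sgn x) \<bullet> sgn x))"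
    by (rule Bochner_Integration.integral_cong[OF refl])
      (use R in \<open>auto simp: indicator_def norm_sgn split: if_splits\<close>)
  finally show ?thesis .
qed

text \<open>
  For the radial cut-off \<open>\<eta>\<close> that decreases linearly from \<open>1\<close> to \<open>0\<close> on the shell of thickness \<open>e\<close> inside the
  sphere, integration by parts equates the integral of \<open>\<eta> div W\<close> with the mean flux of \<open>W\<close> through the
  shell. There \<open>W\<close> may be replaced by its values \<open>f\<close> on the sphere, up to \<open>O(e)\<close>; and \<open>f\<close> is constant
  on rays, so its integral over a ball of radius \<open>r\<close> scales like \<open>r\<^sup>N\<close>. The factor \<open>N R\<^sup>N\<^sup>-\<^sup>1\<close> in the
  surface measure is the derivative of \<open>R\<^sup>N\<close>.
\<close>

lemma divergence_theorem_ball: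
  fixes W :: "'a::euclidean_space \<Rightarrow> 'a"
  assumes R: "R > 0" and D: "\<And>x. (W has_derivative W' x) (at x)"
    and cont: "\<And>v. continuous_on UNIV (\<lambda>x. W' x v)"
  shows "(LINT x|lborel. indicator (ball 0 R) x * (\<Sum>i\<in>Basis. W' x i \<bullet> i))
    = (LINT x:sphere 0 R|surface_measure R. W x \<bullet> outward_normal R x)"
proof -
  define N where "N = DIM('a)"
  have contW: "continuous_on UNIV W" using D by (intro has_derivative_continuous_on) auto
  have mW[measurable]: "W \<in> borel_measurable borel" by (rule borel_measurable_continuous_onI[OF contW])
  have mW'[measurable]: "(\<lambda>x. W' x v) \<in> borel_measurable borel" for v by (rule borel_measurable_continuous_onI[OF cont])
  define dv where "dv x = (\<Sum>i\<in>Basis. W' x i \<bullet> i)" for x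
  have mdv[measurable]: "dv \<in> borel_measurable borel" unfolding dv_def by measurable
  have contdv: "continuous_on UNIV dv" unfolding dv_def by (intro continuous_intros cont)
  have bound: "\<exists>B\<ge>0. \<forall>x. norm x \<le> R \<longrightarrow> norm (f x) \<le> B" if "continuous_on UNIV f" for f :: "'a \<Rightarrow> 'b::real_normed_vector"
  proof -
    have "compact (f ` cball 0 R)" by (intro compact_continuous_image continuous_on_subset[OF that]) auto
    then obtain B where "B > 0" "\<And>y. y \<in> f ` cball 0 R \<Longrightarrow> norm y \<le> B" using compact_imp_bounded bounded_pos by metis
    then show ?thesis by (intro exI[of _ B]) auto
  qed
  obtain M where M: "M \<ge> 0" "\<And>x. norm x \<le> R \<Longrightarrow> norm (W x) \<le> M" using bound[OF contW] by blast
  obtain M' where M': "M' \<ge> 0" "\<And>x. norm x \<le> R \<Longrightarrow> norm (dv x) \<le> M'" using bound[OF contdv] by blast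
  obtain L where L: "L \<ge> 0" and W'L0: "\<And>x v. x \<in> cball 0 R \<Longrightarrow> norm (W' x v) \<le> L * norm v"
    using operator_field_bounded_on_compact[OF has_derivative_linear[OF D] cont compact_cball[of 0 R]] by blast
  then have W'L: "norm (W' x v) \<le> L * norm v" if "norm x \<le> R" for x v using that by simp
  have lipW: "norm (W x - W y) \<le> L * norm (x - y)" if "norm x \<le> R" "norm y \<le> R" for x y
  proof (rule differentiable_bound[where S="cball 0 R" and f'=W'])
    show "onorm (W' z) \<le> L" if "z \<in> cball 0 R" for z using W'L that by (intro onorm_le) auto
    show "(W has_derivative W' z) (at z within cball 0 R)" for z using D has_derivative_at_withinI by blast
  qed (use that in auto)
  define f where "f x = W (R *\<^sub>R sgn x) \<bullet> sgn x" for x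
  have mf[measurable]: "f \<in> borel_measurable borel" unfolding f_def by measurable
  have fM: "\<bar>f x\<bar> \<le> M" for x
  proof (cases "x = 0")
    case False
    have "\<bar>f x\<bar> \<le> norm (W (R *\<^sub>R sgn x)) * norm (sgn x)" unfolding f_def by (rule Cauchy_Schwarz_ineq2)
    also have "\<dots> \<le> M" using M(2)[of "R *\<^sub>R sgn x"] R False by (simp add: norm_sgn)
    finally show ?thesis .
  qed (use M in \<open>simp add: f_def\<close>)
  define If where "If = (LINT x|lborel. indicator (ball 0 1) x * f x)"
  define V where "V = (LINT x|lborel. indicator (ball (0::'a) 1) x :: real)"
  have scale: "(LINT x|lborel. indicator (ball 0 r) x * g x) = r ^ N * (LINT x|lborel. indicator (ball 0 1) x * g x)"
    if "r > 0" and [measurable]: "g \<in> borel_measurable borel" and hom: "\<And>x. g (r *\<^sub>R x) = g x" for r and g :: "'a \<Rightarrow> real"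
  proof -
    have "(LINT x|lborel. indicator (ball 0 r) x * g x) = r ^ N * (LINT x|lborel. indicator (ball 0 r) (r *\<^sub>R x) * g (r *\<^sub>R x))"
      unfolding N_def
      by (rule lborel_integral_scale[OF that(1)], intro borel_measurable_times borel_measurable_indicator that(2)) simp
    also have "(LINT x|lborel. indicator (ball 0 r) (r *\<^sub>R x) * g (r *\<^sub>R x)) = (LINT x|lborel. indicator (ball 0 1) x * g x)"
      by (rule Bochner_Integration.integral_cong[OF refl]) (use that(1) hom in \<open>auto simp: indicator_def\<close>)
    finally show ?thesis .
  qed
  define sh where "sh e = ball (0::'a) R - ball 0 (R - e)" for e
  have [measurable]: "sh e \<in> sets borel" for e unfolding sh_def by auto
  have int_sh: "integrable lborel (\<lambda>x. indicator A x * g x)"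
    if "A \<in> sets borel" "A \<subseteq> ball 0 R" "g \<in> borel_measurable borel" "\<And>x. norm x \<le> R \<Longrightarrow> \<bar>g x\<bar> \<le> B" for A B and g :: "'a \<Rightarrow> real"
  proof (rule integrable_bounded_on_cball[where R=R and B="\<bar>B\<bar>"])
    show "(\<lambda>x. indicator A x * g x) \<in> borel_measurable borel" using that by measurable
  qed (use that(2,4) in \<open>fastforce simp: indicator_def\<close>)+
  have shell: "(LINT x|lborel. indicator (sh e) x * g x) = (R ^ N - (R - e) ^ N) * (LINT x|lborel. indicator (ball 0 1) x * g x)"
    if e: "0 < e" "e < R" and g: "g \<in> borel_measurable borel" "\<And>x. \<bar>g x\<bar> \<le> B" and hom: "\<And>r x. r > 0 \<Longrightarrow> g (r *\<^sub>R x) = g x"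
    for e B and g :: "'a \<Rightarrow> real"
  proof -
    have "(LINT x|lborel. indicator (sh e) x * g x)
        = (LINT x|lborel. indicator (ball 0 R) x * g x - indicator (ball 0 (R - e)) x * g x)"
      by (rule Bochner_Integration.integral_cong[OF refl]) (use e in \<open>auto simp: indicator_def sh_def\<close>)
    also have "\<dots> = (LINT x|lborel. indicator (ball 0 R) x * g x) - (LINT x|lborel. indicator (ball 0 (R - e)) x * g x)"
      by (intro Bochner_Integration.integral_diff int_sh[of _ _ B]) (use e g in auto)
    also have "\<dots> = (R ^ N - (R - e) ^ N) * (LINT x|lborel. indicator (ball 0 1) x * g x)"
      using scale[OF R g(1) hom[OF R]] scale[of "R - e" g] g(1) hom e by (simp add: left_diff_distrib)
    finally show ?thesis .
  qed
  define g where "g x = W x \<bullet> sgn x" for x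
  have mg[measurable]: "g \<in> borel_measurable borel" unfolding g_def by measurable
  have gM: "\<bar>g x\<bar> \<le> M" if "norm x \<le> R" for x
  proof -
    have "\<bar>g x\<bar> \<le> norm (W x) * norm (sgn x)" unfolding g_def by (rule Cauchy_Schwarz_ineq2)
    also have "\<dots> \<le> norm (W x)" by (simp add: norm_sgn)
    finally show ?thesis using M(2)[OF that] by linarith
  qed
  have gf: "\<bar>g x - f x\<bar> \<le> L * e" if x: "x \<in> sh e" and e: "0 < e" "e < R" for x e
  proof -
    have nx: "R - e \<le> norm x" "norm x < R" using x by (auto simp: sh_def)
    then have "x \<noteq> 0" using e by auto
    have "norm x *\<^sub>R sgn x = x" using \<open>x \<noteq> 0\<close> by (simp add: sgn_div_norm)
    then have "x - R *\<^sub>R sgn x = (norm x - R) *\<^sub>R sgn x" by (simp only: scaleR_diff_left)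
    then have d: "norm (x - R *\<^sub>R sgn x) \<le> e" using nx \<open>x \<noteq> 0\<close> by (simp add: norm_sgn)
    have "\<bar>g x - f x\<bar> \<le> norm (W x - W (R *\<^sub>R sgn x)) * norm (sgn x)"
      unfolding g_def f_def inner_diff_left[symmetric] by (rule Cauchy_Schwarz_ineq2)
    also have "\<dots> = norm (W x - W (R *\<^sub>R sgn x))" using \<open>x \<noteq> 0\<close> by (simp add: norm_sgn)
    also have "\<dots> \<le> L * norm (x - R *\<^sub>R sgn x)" using nx R \<open>x \<noteq> 0\<close> by (intro lipW) (auto simp: norm_sgn)
    also have "\<dots> \<le> L * e" using d L by (rule mult_left_mono)
    finally show ?thesis .
  qed
  define \<eta> where "\<eta> e x = max 0 (min 1 ((R - norm x) / e))" for e and x :: 'a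
  \<comment> \<open>\<open>\<eta> e\<close> is Lipschitz and differentiable off two spheres, with gradient \<open>- x / (e |x|)\<close> on the shell.\<close>
  have ibp: "(LINT x|lborel. \<eta> e x * dv x) = (1 / e) * (LINT x|lborel. indicator (sh e) x * g x)"
    if e: "0 < e" "e < R" for e
  proof -
    have \<eta>01: "0 \<le> \<eta> e x" "\<eta> e x \<le> 1" for x using e by (auto simp: \<eta>_def)
    have \<eta>out: "\<eta> e x = 0" if "norm x \<ge> R" for x
    proof -
      have "(R - norm x) / e \<le> 0" using that e by (simp add: divide_nonpos_pos)
      then show ?thesis by (simp add: \<eta>_def)
    qed
    have \<eta>lip: "\<bar>\<eta> e x - \<eta> e y\<bar> \<le> (1 / e) * norm (x - y)" for x y
    proof -
      have "\<bar>\<eta> e x - \<eta> e y\<bar> \<le> \<bar>(R - norm x) / e - (R - norm y) / e\<bar>"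
        unfolding \<eta>_def by (auto simp: max_def min_def abs_if)
      also have "\<dots> = \<bar>norm y - norm x\<bar> / e" using e by (simp add: abs_divide flip: diff_divide_distrib)
      also have "\<dots> \<le> norm (x - y) / e" using e norm_triangle_ineq3[of x y] by (intro divide_right_mono) (auto simp: abs_minus_commute)
      finally show ?thesis by simp
    qed
    have cont\<eta>: "continuous_on UNIV (\<eta> e)" unfolding \<eta>_def using e by (intro continuous_intros) auto
    have m\<eta>[measurable]: "\<eta> e \<in> borel_measurable borel" by (rule borel_measurable_continuous_onI[OF cont\<eta>])
    define \<gamma> where "\<gamma> x = - ((1 / e) * indicator (sh e) x) *\<^sub>R sgn x" for x :: 'a
    have m\<gamma>[measurable]: "\<gamma> \<in> borel_measurable borel" unfolding \<gamma>_def by measurable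
    have der\<eta>: "(\<eta> e has_derivative (\<lambda>v. \<gamma> x \<bullet> v)) (at x)"
      if x: "norm x \<noteq> R" "norm x \<noteq> R - e" for x
    proof -
      consider "norm x > R" | "norm x < R - e" | "R - e < norm x" "norm x < R" using x by linarith
      then show ?thesis
      proof cases
        case 1
        have "((\<lambda>_. 0) has_derivative (\<lambda>v. \<gamma> x \<bullet> v)) (at x)" using 1 e by (simp add: \<gamma>_def sh_def)
        then show ?thesis
          by (rule has_derivative_transform_within_open[of _ _ _ _ "- cball 0 R"]) (use 1 \<eta>out in auto)
      next
        case 2
        have "((\<lambda>_. 1) has_derivative (\<lambda>v. \<gamma> x \<bullet> v)) (at x)" using 2 e by (simp add: \<gamma>_def sh_def)
        then show ?thesis
          by (rule has_derivative_transform_within_open[of _ _ _ _ "ball 0 (R - e)"])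
            (use 2 e in \<open>auto simp: \<eta>_def field_simps max_def min_def\<close>)
      next
        case 3
        then have "x \<noteq> 0" using e by auto
        have "x \<in> sh e" using 3 by (auto simp: sh_def)
        then have "((\<lambda>x. (R - norm x) / e) has_derivative (\<lambda>v. \<gamma> x \<bullet> v)) (at x)"
          using e by (auto intro!: derivative_eq_intros has_derivative_norm[OF \<open>x \<noteq> 0\<close>] simp: \<gamma>_def inner_commute fun_eq_iff)
        then show ?thesis
          by (rule has_derivative_transform_within_open[of _ _ _ _ "ball 0 R - cball 0 (R - e)"])
            (use 3 e in \<open>auto simp: \<eta>_def field_simps max_def min_def\<close>)
      qed
    qed
    have nullR: "AE x in (lborel :: 'a measure). norm x \<noteq> r" for r
    proof -
      have "sphere (0::'a) r \<in> null_sets lborel"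
        using negligible_sphere[of "0::'a" r] by (simp add: negligible_iff_null_sets null_sets_completion_iff)
      from AE_not_in[OF this] show ?thesis by eventually_elim simp
    qed
    have part: "integrable lborel (\<lambda>x. \<eta> e x * (W' x i \<bullet> i) + (\<gamma> x \<bullet> i) * (W x \<bullet> i))"
      "(LINT x|lborel. \<eta> e x * (W' x i \<bullet> i) + (\<gamma> x \<bullet> i) * (W x \<bullet> i)) = 0" if i: "i \<in> Basis" for i
    proof -
      let ?F = "\<lambda>x. \<eta> e x * (W x \<bullet> i)"
      have Wi: "\<bar>W x \<bullet> i\<bar> \<le> M" if "norm x \<le> R" for x
        using Basis_le_norm[OF i, of "W x"] M(2)[OF that] by linarith
      have half: "\<bar>?F x - ?F y\<bar> \<le> (L + M / e) * norm (x - y)" if y: "norm y \<le> R" for x y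
      proof (cases "norm x \<le> R")
        case True
        have "?F x - ?F y = \<eta> e x * ((W x - W y) \<bullet> i) + (\<eta> e x - \<eta> e y) * (W y \<bullet> i)"
          by (simp add: inner_diff_left algebra_simps)
        also have "\<bar>\<dots>\<bar> \<le> \<bar>\<eta> e x\<bar> * \<bar>(W x - W y) \<bullet> i\<bar> + \<bar>\<eta> e x - \<eta> e y\<bar> * \<bar>W y \<bullet> i\<bar>"
          unfolding abs_mult[symmetric] by (rule abs_triangle_ineq)
        also have "\<dots> \<le> 1 * (L * norm (x - y)) + ((1 / e) * norm (x - y)) * M"
          using \<eta>01[of x] \<eta>lip[of x y] Wi[OF y] Basis_le_norm[OF i, of "W x - W y"] lipW[OF True y] e L
          by (intro add_mono mult_mono) auto
        finally show ?thesis by (simp add: algebra_simps)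
      next
        case False
        then have "\<bar>?F x - ?F y\<bar> = \<bar>\<eta> e x - \<eta> e y\<bar> * \<bar>W y \<bullet> i\<bar>" using \<eta>out[of x] by (simp add: abs_mult)
        also have "\<dots> \<le> ((1 / e) * norm (x - y)) * M" using \<eta>lip[of x y] Wi[OF y] e by (intro mult_mono) auto
        also have "\<dots> \<le> (L + M / e) * norm (x - y)" using L by (simp add: algebra_simps)
        finally show ?thesis .
      qed
      have lip: "\<bar>?F x - ?F y\<bar> \<le> (L + M / e) * norm (x - y)" for x y
      proof (cases "norm y \<le> R")
        case False
        show ?thesis
        proof (cases "norm x \<le> R")
          case True
          then show ?thesis using half[of x y] by (simp add: abs_minus_commute norm_minus_commute)
        next
          case F2: False
          then show ?thesis using False \<eta>out[of x] \<eta>out[of y] L M(1) e by simp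
        qed
      qed (rule half)
      have cF: "continuous_on UNIV ?F" by (intro continuous_intros cont\<eta> contW)
      have zF: "?F x = 0" if "x \<notin> cball 0 R" for x using \<eta>out[of x] that by simp
      have mF: "(\<lambda>x. \<eta> e x * (W' x i \<bullet> i) + (\<gamma> x \<bullet> i) * (W x \<bullet> i)) \<in> borel_measurable lborel" by measurable
      have lF: "AE x in lborel. ((\<lambda>t. (?F (x + t *\<^sub>R i) - ?F x) / t) \<longlongrightarrow> \<eta> e x * (W' x i \<bullet> i) + (\<gamma> x \<bullet> i) * (W x \<bullet> i)) (at 0)"
        using nullR[of R] nullR[of "R - e"]
      proof eventually_elim
        case (elim x)
        have "(?F has_derivative (\<lambda>v. \<eta> e x * (W' x v \<bullet> i) + (\<gamma> x \<bullet> v) * (W x \<bullet> i))) (at x)"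
          by (rule has_derivative_mult[OF der\<eta>[OF elim] has_derivative_inner_left[OF D]])
        from has_derivative_imp_directional_limit[OF this, of i] show ?case .
      qed
      show "integrable lborel (\<lambda>x. \<eta> e x * (W' x i \<bullet> i) + (\<gamma> x \<bullet> i) * (W x \<bullet> i))"
        "(LINT x|lborel. \<eta> e x * (W' x i \<bullet> i) + (\<gamma> x \<bullet> i) * (W x \<bullet> i)) = 0"
        by (rule integral_directional_derivative_eq_0[OF lip cF compact_cball[of 0 R] zF mF lF]; assumption)+
    qed
    have "0 = (\<Sum>i\<in>(Basis::'a set). LINT x|lborel. \<eta> e x * (W' x i \<bullet> i) + (\<gamma> x \<bullet> i) * (W x \<bullet> i))"
      using part(2) by simp
    also have "\<dots> = (LINT x|lborel. (\<Sum>i\<in>Basis. \<eta> e x * (W' x i \<bullet> i) + (\<gamma> x \<bullet> i) * (W x \<bullet> i)))"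
      by (rule Bochner_Integration.integral_sum[symmetric]) (rule part(1))
    also have "\<dots> = (LINT x|lborel. \<eta> e x * dv x - (1 / e) * (indicator (sh e) x * g x))"
    proof (rule Bochner_Integration.integral_cong[OF refl])
      fix x
      have "(\<Sum>i\<in>Basis. (\<gamma> x \<bullet> i) * (W x \<bullet> i)) = \<gamma> x \<bullet> W x" by (rule euclidean_inner[symmetric])
      also have "\<dots> = - (1 / e) * (indicator (sh e) x * g x)" by (simp add: \<gamma>_def g_def inner_commute)
      finally show "(\<Sum>i\<in>Basis. \<eta> e x * (W' x i \<bullet> i) + (\<gamma> x \<bullet> i) * (W x \<bullet> i)) = \<eta> e x * dv x - (1 / e) * (indicator (sh e) x * g x)"
        by (simp add: sum.distrib dv_def sum_distrib_left)
    qed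
    also have "\<dots> = (LINT x|lborel. \<eta> e x * dv x) - (LINT x|lborel. (1 / e) * (indicator (sh e) x * g x))"
    proof (rule Bochner_Integration.integral_diff)
      show "integrable lborel (\<lambda>x. \<eta> e x * dv x)"
        by (rule integrable_bounded_on_cball[where R=R and B=M'])
          (use \<eta>01 \<eta>out M' in \<open>auto simp: abs_mult intro: mult_left_le_one_le[THEN order_trans]\<close>)
      show "integrable lborel (\<lambda>x. (1 / e) * (indicator (sh e) x * g x))"
        using int_sh[of "sh e" g M] gM by (auto simp: sh_def)
    qed
    finally show ?thesis by simp
  qed
  define e where "e n = R / (real n + 2)" for n
  have e: "0 < e n" "e n < R" for n
    using R mult_strict_left_mono[of 1 "real n + 2" R] by (simp_all add: e_def divide_less_eq)
  have e0: "e \<longlonglongrightarrow> 0" unfolding e_def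
    by (rule tendsto_divide_0[OF tendsto_const]) (intro filterlim_at_top_imp_at_infinity filterlim_tendsto_add_at_top[OF tendsto_const filterlim_real_sequentially, of 2, simplified add.commute])
  have lim1: "(\<lambda>n. LINT x|lborel. \<eta> (e n) x * dv x) \<longlonglongrightarrow> (LINT x|lborel. indicator (ball 0 R) x * dv x)"
  proof (rule integral_dominated_convergence[where w="\<lambda>x. indicator (ball 0 R) x * M'"])
    show "integrable lborel (\<lambda>x. indicator (ball (0::'a) R) x * M')" by (rule int_sh[of _ _ M']) (use M' in auto)
    show "AE x in lborel. norm (\<eta> (e n) x * dv x) \<le> indicator (ball 0 R) x * M'" for n
    proof (rule AE_I2)
      fix x :: 'a
      show "norm (\<eta> (e n) x * dv x) \<le> indicator (ball 0 R) x * M'"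
      proof (cases "norm x < R")
        case True
        have "\<bar>\<eta> (e n) x\<bar> * \<bar>dv x\<bar> \<le> 1 * M'" using True M'(2)[of x] by (intro mult_mono) (auto simp: \<eta>_def)
        then show ?thesis using True by (simp add: abs_mult)
      next
        case False
        then have "(R - norm x) / e n \<le> 0" using e[of n] by (simp add: divide_nonpos_pos)
        then show ?thesis using False by (simp add: \<eta>_def)
      qed
    qed
    show "AE x in lborel. (\<lambda>n. \<eta> (e n) x * dv x) \<longlonglongrightarrow> indicator (ball 0 R) x * dv x"
    proof (intro AE_I2 tendsto_mult_right)
      fix x :: 'a
      show "(\<lambda>n. \<eta> (e n) x) \<longlonglongrightarrow> indicator (ball 0 R) x"
      proof (cases "norm x < R")
        case True
        then have "\<forall>\<^sub>F n in sequentially. e n < R - norm x" using e0 by (intro order_tendstoD) auto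
        then have "\<forall>\<^sub>F n in sequentially. indicator (ball 0 R) x = \<eta> (e n) x"
        proof eventually_elim
          case (elim n)
          then have "1 \<le> (R - norm x) / e n" using e[of n] by (simp add: field_simps)
          then show ?case using True by (simp add: \<eta>_def)
        qed
        then show ?thesis by (rule Lim_transform_eventually[OF tendsto_const])
      next
        case False
        then have le: "(R - norm x) / e n \<le> 0" for n using e[of n] by (simp add: divide_nonpos_pos)
        have "\<eta> (e n) x = 0" for n unfolding \<eta>_def by (rule max_absorb1[OF min.coboundedI2[OF le]])
        then show ?thesis using False by simp
      qed
    qed
    show "(\<lambda>x. \<eta> (e n) x * dv x) \<in> borel_measurable lborel" for n unfolding \<eta>_def by measurable
    show "(\<lambda>x. indicator (ball 0 R) x * dv x) \<in> borel_measurable lborel"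
      using mdv by (intro borel_measurable_times borel_measurable_indicator) simp_all
  qed
  have quot: "(\<lambda>n. (R ^ N - (R - e n) ^ N) / e n) \<longlonglongrightarrow> real N * R ^ (N - 1)"
  proof -
    have "((\<lambda>x. x ^ N) has_real_derivative real N * R ^ (N - Suc 0)) (at R)" by (auto intro!: derivative_eq_intros)
    then have "((\<lambda>h. ((R + h) ^ N - R ^ N) / h) \<longlongrightarrow> real N * R ^ (N - 1)) (at 0)" by (simp add: DERIV_def)
    moreover have "filterlim (\<lambda>n. - e n) (at 0) sequentially"
    proof -
      have "- e n \<noteq> 0" for n using e(1)[of n] by simp
      then show ?thesis using tendsto_minus[OF e0] by (simp add: filterlim_at)
    qed
    ultimately have "(\<lambda>n. ((R + - e n) ^ N - R ^ N) / (- e n)) \<longlonglongrightarrow> real N * R ^ (N - 1)"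
      by (rule filterlim_compose)
    moreover have "((R + - e n) ^ N - R ^ N) / (- e n) = (R ^ N - (R - e n) ^ N) / e n" for n
      using e(1)[of n] by (simp add: field_simps)
    ultimately show ?thesis by simp
  qed
  have f_hom: "f (r *\<^sub>R x) = f x" if "r > 0" for r x using that by (simp add: f_def sgn_scaleR)
  have sh_f: "(LINT x|lborel. indicator (sh (e n)) x * f x) = (R ^ N - (R - e n) ^ N) * If" for n
    unfolding If_def by (rule shell[OF e mf fM f_hom])
  have sh_1: "(LINT x|lborel. indicator (sh (e n)) x * (L * e n)) = (R ^ N - (R - e n) ^ N) * (V * (L * e n))" for n
    using shell[OF e[of n], of "\<lambda>_. L * e n" "\<bar>L * e n\<bar>"] by (simp add: V_def)
  have lim2: "(\<lambda>n. (1 / e n) * (LINT x|lborel. indicator (sh (e n)) x * g x)) \<longlonglongrightarrow> real N * R ^ (N - 1) * If"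
  proof -
    have "(\<lambda>n. (1 / e n) * (LINT x|lborel. indicator (sh (e n)) x * g x) - (R ^ N - (R - e n) ^ N) / e n * If) \<longlonglongrightarrow> 0"
    proof (rule Lim_null_comparison)
      show "\<forall>\<^sub>F n in sequentially. norm ((1 / e n) * (LINT x|lborel. indicator (sh (e n)) x * g x) - (R ^ N - (R - e n) ^ N) / e n * If)
          \<le> (R ^ N - (R - e n) ^ N) / e n * (V * (L * e n))"
      proof (rule always_eventually, rule allI)
        fix n
        have ig: "integrable lborel (\<lambda>x. indicator (sh (e n)) x * g x)" by (rule int_sh[of _ _ M]) (use gM in \<open>auto simp: sh_def\<close>)
        have if': "integrable lborel (\<lambda>x. indicator (sh (e n)) x * f x)" by (rule int_sh[of _ _ M]) (use fM in \<open>auto simp: sh_def\<close>)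
        have "\<bar>(LINT x|lborel. indicator (sh (e n)) x * g x) - (LINT x|lborel. indicator (sh (e n)) x * f x)\<bar>
            = \<bar>LINT x|lborel. indicator (sh (e n)) x * g x - indicator (sh (e n)) x * f x\<bar>" using ig if' by simp
        also have "\<dots> \<le> (LINT x|lborel. indicator (sh (e n)) x * (L * e n))"
        proof (rule integral_abs_bound_integral)
          show "integrable lborel (\<lambda>x. indicator (sh (e n)) x * (L * e n))" by (rule int_sh[of _ _ "\<bar>L * e n\<bar>"]) (auto simp: sh_def)
          show "\<bar>indicator (sh (e n)) x * g x - indicator (sh (e n)) x * f x\<bar> \<le> indicator (sh (e n)) x * (L * e n)" for x
            using gf[of x "e n"] e[of n] by (auto simp: indicator_def)
        qed (use ig if' in auto)
        finally have "\<bar>(LINT x|lborel. indicator (sh (e n)) x * g x) - (R ^ N - (R - e n) ^ N) * If\<bar> / e n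
            \<le> (R ^ N - (R - e n) ^ N) * (V * (L * e n)) / e n"
          unfolding sh_f sh_1 using e(1)[of n] by (intro divide_right_mono) auto
        moreover have "(1 / e n) * (LINT x|lborel. indicator (sh (e n)) x * g x) - (R ^ N - (R - e n) ^ N) / e n * If
            = ((LINT x|lborel. indicator (sh (e n)) x * g x) - (R ^ N - (R - e n) ^ N) * If) / e n"
          by (simp add: diff_divide_distrib left_diff_distrib)
        ultimately show "norm ((1 / e n) * (LINT x|lborel. indicator (sh (e n)) x * g x) - (R ^ N - (R - e n) ^ N) / e n * If)
          \<le> (R ^ N - (R - e n) ^ N) / e n * (V * (L * e n))" using e(1)[of n] by (simp add: abs_divide)
      qed
      show "(\<lambda>n. (R ^ N - (R - e n) ^ N) / e n * (V * (L * e n))) \<longlonglongrightarrow> 0"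
        using tendsto_mult[OF quot tendsto_mult_right_zero[OF tendsto_mult_right_zero[OF e0, of L], of V]] by simp
    qed
    from tendsto_add[OF this tendsto_mult_right[OF quot, of If]] show ?thesis by simp
  qed
  have "(LINT x|lborel. indicator (ball 0 R) x * dv x) = real N * R ^ (N - 1) * If"
    using lim1 lim2 unfolding ibp[OF e] by (rule LIMSEQ_unique)
  then show ?thesis unfolding surface_measure_integral[OF R mW] by (simp add: dv_def If_def f_def N_def)
qed

section \<open>Change of variables for an arbitrary finite index type\<close>

text \<open>
  A numbering of the index type \<open>'n\<close>. It has the same cardinality and, unlike \<open>'n\<close>, carries a
  well-order; \<open>has_absolute_integral_change_of_variables\<close> is stated for well-ordered index types and
  is transported to \<open>real ^ 'n\<close> by renumbering the coordinates.
\<close>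

typedef (overloaded) ('n::finite) ordinal_index = "{..<CARD('n)}"
  using zero_less_card_finite by blast

instantiation ordinal_index :: (finite) linorder
begin
definition less_eq_ordinal_index :: "'a ordinal_index \<Rightarrow> 'a ordinal_index \<Rightarrow> bool" where
  "i \<le> j \<longleftrightarrow> Rep_ordinal_index i \<le> Rep_ordinal_index j"
definition less_ordinal_index :: "'a ordinal_index \<Rightarrow> 'a ordinal_index \<Rightarrow> bool" where
  "i < j \<longleftrightarrow> Rep_ordinal_index i < Rep_ordinal_index j"
instance
  by standard (auto simp: less_eq_ordinal_index_def less_ordinal_index_def Rep_ordinal_index_inject)
end

instance ordinal_index :: (finite) wellorder
proof
  fix P :: "'a ordinal_index \<Rightarrow> bool" and i
  assume step: "\<And>i. (\<And>j. j < i \<Longrightarrow> P j) \<Longrightarrow> P i"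
  show "P i"
    by (induction i rule: measure_induct_rule[of Rep_ordinal_index]) (rule step, simp add: less_ordinal_index_def)
qed

instance ordinal_index :: (finite) finite
proof
  have "(UNIV :: 'a ordinal_index set) = Abs_ordinal_index ` {..<CARD('a)}"
    by (rule type_definition.Abs_image[OF type_definition_ordinal_index, symmetric])
  then show "finite (UNIV :: 'a ordinal_index set)" by (rule ssubst) simp
qed

lemma CARD_ordinal_index: "CARD('n::finite ordinal_index) = CARD('n)"
  by (simp add: type_definition.card[OF type_definition_ordinal_index])

text \<open>
  A renumbering of coordinates permutes the standard basis, hence preserves inner products and
  maps boxes to boxes of the same volume.
\<close>

lemma coordinate_renumbering:
  obtains L :: "real ^ ('n::finite) ordinal_index \<Rightarrow> real ^ 'n" and L' where
    "linear L" "linear L'" "\<And>x. L (L' x) = x" "\<And>y. L' (L y) = y" "\<And>x y. L x \<bullet> L y = x \<bullet> y"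
    "L ` Basis = Basis" "distr lborel borel L = lborel"
proof -
  obtain e :: "'n ordinal_index \<Rightarrow> 'n" where e: "bij e"
    using finite_same_card_bij[of "UNIV :: 'n ordinal_index set" "UNIV :: 'n set"] CARD_ordinal_index[where 'n='n] by auto
  define e' where "e' = inv e"
  have ee: "e (e' i) = i" "e' (e j) = j" for i j
    using e by (auto simp: e'_def bij_is_inj bij_is_surj surj_f_inv_f)
  define L :: "real ^ 'n ordinal_index \<Rightarrow> real ^ 'n" where "L y = (\<chi> i. y $ e' i)" for y
  define L' :: "real ^ 'n \<Rightarrow> real ^ 'n ordinal_index" where "L' x = (\<chi> j. x $ e j)" for x
  have lin: "linear L" "linear L'" by (auto simp: L_def L'_def linear_iff vec_eq_iff)
  have inv: "L (L' x) = x" "L' (L y) = y" for x y by (auto simp: L_def L'_def vec_eq_iff ee)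
  have bij': "bij e'" using e unfolding e'_def by (rule bij_imp_bij_inv)
  have inner: "L x \<bullet> L y = x \<bullet> y" for x y
    unfolding inner_vec_def L_def using sum.reindex_bij_betw[OF bij', of "\<lambda>j. x $ j * y $ j"] by simp
  have ax: "L (axis j 1) = axis (e j) 1" for j by (auto simp: L_def axis_def vec_eq_iff) (metis ee)+
  have basis: "L ` Basis = Basis"
  proof -
    have "L ` Basis = range (\<lambda>j. axis (e j) 1)" by (auto simp: Basis_vec_def ax image_iff)
    also have "\<dots> = (\<lambda>i. axis i 1) ` range e" by auto
    also have "range e = UNIV" using e by (rule bij_is_surj)
    also have "range (\<lambda>i::'n. axis i (1::real)) = Basis" by (auto simp: Basis_vec_def)
    finally show ?thesis .
  qed
  have "lborel = distr lborel borel L"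
  proof (rule lborel_eqI)
    fix l u :: "real ^ 'n" assume le: "\<And>b. b \<in> Basis \<Longrightarrow> l \<bullet> b \<le> u \<bullet> b"
    have m: "L \<in> borel \<rightarrow>\<^sub>M borel" using lin(1) by (intro borel_measurable_continuous_onI linear_continuous_on) (simp add: linear_conv_bounded_linear)
    have comp: "y \<bullet> b = L y \<bullet> L b" for y b by (simp add: inner)
    have vim: "L -` box l u = box (L' l) (L' u)"
    proof -
      have "L y \<in> box l u \<longleftrightarrow> y \<in> box (L' l) (L' u)" for y
      proof -
        have "y \<in> box (L' l) (L' u) \<longleftrightarrow> (\<forall>b\<in>Basis. l \<bullet> L b < L y \<bullet> L b \<and> L y \<bullet> L b < u \<bullet> L b)"
          by (simp add: mem_box comp inv)
        also have "\<dots> \<longleftrightarrow> (\<forall>b\<in>L ` Basis. l \<bullet> b < L y \<bullet> b \<and> L y \<bullet> b < u \<bullet> b)" by simp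
        also have "\<dots> \<longleftrightarrow> L y \<in> box l u" unfolding basis by (simp add: mem_box)
        finally show ?thesis by simp
      qed
      then show ?thesis by auto
    qed
    have injL: "inj L" using inv(2) by (metis injI)
    have le': "b \<in> Basis \<Longrightarrow> L' l \<bullet> b \<le> L' u \<bullet> b" for b
      using le[of "L b"] basis by (auto simp: comp inv)
    have "emeasure (distr lborel borel L) (box l u) = emeasure lborel (L -` box l u)"
      using m by (subst emeasure_distr) auto
    also have "\<dots> = (\<Prod>b\<in>Basis. (L' u - L' l) \<bullet> b)" unfolding vim using le' by simp
    also have "(\<Prod>b\<in>Basis. (L' u - L' l) \<bullet> b) = (\<Prod>b\<in>Basis. (u - l) \<bullet> L b)"
      by (rule prod.cong[OF refl]) (simp add: comp inv linear_diff[OF lin(1)])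
    also have "\<dots> = (\<Prod>b\<in>L ` Basis. (u - l) \<bullet> b)"
      using injL by (subst prod.reindex) (auto intro: inj_on_subset)
    finally show "emeasure (distr lborel borel L) (box l u) = (\<Prod>b\<in>Basis. (u - l) \<bullet> b)" unfolding basis .
  qed simp
  then show ?thesis using that[OF lin inv inner basis] by simp
qed

lemma integral_image_wellorder:
  fixes g :: "real ^ 'm::{finite,wellorder} \<Rightarrow> real ^ 'm::_"
  assumes S: "S \<in> sets borel" and der: "\<And>x. (g has_derivative g' x) (at x)"
    and cont: "\<And>v. continuous_on UNIV (\<lambda>x. g' x v)" and inj: "inj_on g S" and gS: "g ` S \<in> sets borel"
    and f: "f \<in> borel_measurable borel" and int: "integrable lborel (\<lambda>y. indicator (g ` S) y * f y)"
  shows "integrable lborel (\<lambda>x. indicator S x * (\<bar>det (matrix (g' x))\<bar> * f (g x)))"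
    "(LINT y|lborel. indicator (g ` S) y * f y) = (LINT x|lborel. indicator S x * (\<bar>det (matrix (g' x))\<bar> * f (g x)))"
proof -
  have cg: "continuous_on UNIV g" using der by (intro has_derivative_continuous_on) auto
  have mg: "g \<in> borel_measurable borel" by (rule borel_measurable_continuous_onI[OF cg])
  have "continuous_on UNIV (\<lambda>x. det (matrix (g' x)))"
    unfolding det_def matrix_def by (intro continuous_intros) (simp add: continuous_on_component cont)
  then have mJ: "(\<lambda>x. det (matrix (g' x))) \<in> borel_measurable borel" by (rule borel_measurable_continuous_onI)
  have mr: "(\<lambda>x. indicator S x * (\<bar>det (matrix (g' x))\<bar> * f (g x))) \<in> borel_measurable borel"
    using mJ measurable_compose[OF mg f] S by (intro borel_measurable_times borel_measurable_abs borel_measurable_indicator) auto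
  have ml: "(\<lambda>y. indicator (g ` S) y * f y) \<in> borel_measurable borel"
    using f gS by (intro borel_measurable_times borel_measurable_indicator)
  let ?f = "\<lambda>y. vec (f y) :: real ^ 1"
  have "(\<lambda>y. ?f y $ 1) absolutely_integrable_on g ` S"
    unfolding absolutely_integrable_on_def set_integrable_def using int ml by (simp add: integrable_completion)
  then have ab: "?f absolutely_integrable_on g ` S" unfolding absolutely_integrable_on_1_iff .
  have Sl: "S \<in> sets lebesgue" using S by simp
  have cv: "(\<lambda>x. \<bar>det (matrix (g' x))\<bar> *\<^sub>R ?f (g x)) absolutely_integrable_on S \<and>
      integral S (\<lambda>x. \<bar>det (matrix (g' x))\<bar> *\<^sub>R ?f (g x)) = integral (g ` S) ?f"
    using has_absolute_integral_change_of_variables[OF Sl has_derivative_at_withinI[OF der] inj, of ?f "integral (g ` S) ?f"] ab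
    by blast
  have "(\<lambda>x. \<bar>det (matrix (g' x))\<bar> * f (g x)) absolutely_integrable_on S"
    using cv unfolding absolutely_integrable_on_1_iff by simp
  then show ir: "integrable lborel (\<lambda>x. indicator S x * (\<bar>det (matrix (g' x))\<bar> * f (g x)))"
    unfolding absolutely_integrable_on_def set_integrable_def using mr by (simp add: integrable_completion)
  have conv: "(LINT x|lborel. indicator T x * h x) = integral T h"
    if "integrable lborel (\<lambda>x. indicator T x * h x)" for T and h :: "real ^ 'm::_ \<Rightarrow> real"
    using set_borel_integral_eq_integral(2)[of T h] that by (simp add: set_integrable_def set_lebesgue_integral_def)
  have "integral S (\<lambda>x. \<bar>det (matrix (g' x))\<bar> * f (g x)) = integral (g ` S) f"
    using conjunct2[OF cv] unfolding integral_on_1_eq by (simp add: vec_eq_iff)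
  then show "(LINT y|lborel. indicator (g ` S) y * f y) = (LINT x|lborel. indicator S x * (\<bar>det (matrix (g' x))\<bar> * f (g x)))"
    unfolding conv[OF int] conv[OF ir] by simp
qed

text \<open>
  A permutation other than the identity moves at least two indices, so its product in the Leibniz
  formula vanishes to second order at the identity matrix.
\<close>

lemma det_has_derivative_at_identity:
  "((det :: real ^ 'm ^ 'm \<Rightarrow> real) has_derivative (\<lambda>X. \<Sum>i\<in>UNIV. X $ i $ i)) (at (mat 1))"
proof -
  let ?P = "{p. p permutes (UNIV :: 'm set)}"
  let ?I = "mat 1 :: real ^ 'm ^ 'm"
  have comp: "((\<lambda>A::real^'m^'m. A $ i $ j) has_derivative (\<lambda>X. X $ i $ j)) (at ?I)" for i j
    by (auto intro!: bounded_linear_imp_has_derivative bounded_linear_compose[OF bounded_linear_vec_nth bounded_linear_vec_nth])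
  have D: "((det :: real ^ 'm ^ 'm \<Rightarrow> real) has_derivative
      (\<lambda>X. \<Sum>p\<in>?P. of_int (sign p) * (\<Sum>i\<in>UNIV. X $ i $ p i * (\<Prod>j\<in>UNIV - {i}. ?I $ j $ p j)))) (at ?I)"
    unfolding det_def[abs_def] by (intro has_derivative_sum has_derivative_mult_right has_derivative_prod comp)
  have off: "(\<Sum>i\<in>UNIV. X $ i $ p i * (\<Prod>j\<in>UNIV - {i}. ?I $ j $ p j)) = 0" if p: "p permutes UNIV" "p \<noteq> id" for X :: "real^'m^'m" and p
  proof (rule sum.neutral, rule ballI)
    fix i
    have "\<exists>j. j \<noteq> i \<and> p j \<noteq> j"
    proof (rule ccontr)
      assume "\<not> ?thesis"
      then have fix': "p j = j" if "j \<noteq> i" for j using that by blast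
      moreover have "p i = i"
      proof (rule ccontr)
        assume "p i \<noteq> i"
        then have "p (p i) = p i" by (rule fix')
        then show False using \<open>p i \<noteq> i\<close> permutes_inj[OF p(1)] by (auto dest: injD)
      qed
      ultimately have "p j = j" for j by (cases "j = i") auto
      then show False using p(2) by auto
    qed
    then obtain j where "j \<noteq> i" "p j \<noteq> j" by blast
    then have "(\<Prod>j\<in>UNIV - {i}. ?I $ j $ p j) = 0" by (intro prod_zero bexI[of _ j]) (auto simp: mat_def)
    then show "X $ i $ p i * (\<Prod>j\<in>UNIV - {i}. ?I $ j $ p j) = 0" by simp
  qed
  have "(\<Sum>p\<in>?P. of_int (sign p) * (\<Sum>i\<in>UNIV. X $ i $ p i * (\<Prod>j\<in>UNIV - {i}. ?I $ j $ p j))) = (\<Sum>i\<in>UNIV. X $ i $ i)" for X :: "real^'m^'m"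
  proof -
    have "(\<Sum>p\<in>?P. of_int (sign p) * (\<Sum>i\<in>UNIV. X $ i $ p i * (\<Prod>j\<in>UNIV - {i}. ?I $ j $ p j)))
      = (\<Sum>p\<in>{id}. of_int (sign p) * (\<Sum>i\<in>UNIV. X $ i $ p i * (\<Prod>j\<in>UNIV - {i}. ?I $ j $ p j)))"
      by (rule sum.mono_neutral_right) (auto simp: off permutes_id finite_permutations)
    also have "\<dots> = (\<Sum>i\<in>UNIV. X $ i $ i)" by (simp add: sign_id mat_def)
    finally show ?thesis .
  qed
  with D show ?thesis by simp
qed

lemma det_near_identity:
  assumes "e > 0"
  obtains d where "d > 0" "\<And>A s. linear A \<Longrightarrow> 0 \<le> s \<Longrightarrow> s < d \<Longrightarrow> (\<And>v::real^'m. norm (A v - v) \<le> s * norm v) \<Longrightarrow>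
    \<bar>det (matrix A) - 1 - (\<Sum>b\<in>Basis. (A b - b) \<bullet> b)\<bar> \<le> e * s"
proof -
  define c where "c = real CARD('m) * real CARD('m)"
  have "real CARD('m) \<ge> 1" using zero_less_card_finite[where 'a='m] by linarith
  then have c: "c \<ge> 1" unfolding c_def using mult_mono[of 1 "real CARD('m)" 1 "real CARD('m)"] by simp
  have ex: "\<forall>e>0. \<exists>d>0. \<forall>Y::real^'m^'m. norm (Y - mat 1) < d \<longrightarrow>
      norm (det Y - 1 - (\<Sum>i\<in>UNIV. (Y - mat 1) $ i $ i)) \<le> e * norm (Y - mat 1)"
    using iffD1[OF has_derivative_at_alt det_has_derivative_at_identity[where 'm='m], THEN conjunct2]
    by (simp only: det_I)
  have "e / c > 0" using assms c by simp
  from ex[rule_format, OF this] obtain d where d: "d > 0" "\<And>Y::real^'m^'m. norm (Y - mat 1) < d \<Longrightarrow>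
      norm (det Y - 1 - (\<Sum>i\<in>UNIV. (Y - mat 1) $ i $ i)) \<le> (e / c) * norm (Y - mat 1)"
    by blast
  show ?thesis
  proof (rule that[of "d / c"])
    show "d / c > 0" using d(1) c by simp
    fix A :: "real^'m \<Rightarrow> real^'m" and s :: real
    assume lin: "linear A" and s: "0 \<le> s" "s < d / c" and A: "\<And>v. norm (A v - v) \<le> s * norm v"
    let ?X = "matrix A - mat 1"
    have entry: "?X $ i $ j = (A (axis j 1) - axis j 1) $ i" for i j
      by (auto simp: matrix_def mat_def axis_def)
    have "\<bar>?X $ i $ j\<bar> \<le> s" for i j
      using component_le_norm_cart[of "A (axis j 1) - axis j 1" i] A[of "axis j 1"] unfolding entry by simp
    then have row: "norm (?X $ i) \<le> real CARD('m) * s" for i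
      using norm_le_l1_cart[of "?X $ i"] sum_bounded_above[of UNIV "\<lambda>j. \<bar>?X $ i $ j\<bar>" s] by fastforce
    have "norm ?X \<le> (\<Sum>i\<in>UNIV. norm (?X $ i))" by (simp add: norm_vec_def L2_set_le_sum)
    also have "\<dots> \<le> real CARD('m) * (real CARD('m) * s)" using sum_bounded_above[of UNIV "\<lambda>i. norm (?X $ i)"] row by simp
    finally have X: "norm ?X \<le> c * s" by (simp add: c_def)
    have "c * s < d" using s c by (simp add: field_simps)
    then have "norm (det (matrix A) - 1 - (\<Sum>i\<in>UNIV. ?X $ i $ i)) \<le> (e / c) * norm ?X"
      using X by (intro d(2)) simp
    also have "\<dots> \<le> (e / c) * (c * s)" using X assms c by (intro mult_left_mono) auto
    also have "\<dots> = e * s" using c by simp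
    also have "(\<Sum>i\<in>UNIV. ?X $ i $ i) = (\<Sum>b\<in>Basis. (A b - b) \<bullet> b)"
    proof -
      have "(\<Sum>b\<in>Basis. (A b - b) \<bullet> b) = (\<Sum>b\<in>range (\<lambda>i. axis i 1). (A b - b) \<bullet> b)"
        by (rule sum.cong) (auto simp: Basis_vec_def)
      also have "\<dots> = (\<Sum>i\<in>UNIV. (A (axis i 1) - axis i 1) \<bullet> axis i 1)"
        by (subst sum.reindex) (auto simp: inj_on_def axis_eq_axis)
      also have "\<dots> = (\<Sum>i\<in>UNIV. ?X $ i $ i)" by (simp only: entry) (simp add: inner_axis)
      finally show ?thesis by simp
    qed
    finally show "\<bar>det (matrix A) - 1 - (\<Sum>b\<in>Basis. (A b - b) \<bullet> b)\<bar> \<le> e * s" by simp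
  qed
qed

section \<open>Deformations close to the identity\<close>

text \<open>
  The only properties of \<open>\<Phi>(t)\<close> that the energy estimates use; the parameter \<open>\<beta>\<close> is proportional
  to \<open>t\<close>. They make the map a bi-Lipschitz bijection that preserves the unit ball.
\<close>

locale near_identity =
  fixes F :: "'a::euclidean_space \<Rightarrow> 'a" and \<beta> :: real
  assumes beta: "0 \<le> \<beta>" "\<beta> \<le> 1 / 2"
    and displacement: "\<And>x y. norm ((F x - x) - (F y - y)) \<le> \<beta> * norm (x - y)"
    and outside: "\<And>x. x \<notin> Omega \<Longrightarrow> F x = x"
begin

lemma Lipschitz: "norm (F x - F y) \<le> 3 / 2 * norm (x - y)"
proof -
  have "norm (F x - F y) \<le> norm ((F x - x) - (F y - y)) + norm (x - y)"
    using norm_triangle_ineq[of "(F x - x) - (F y - y)" "x - y"] by (simp add: algebra_simps)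
  also have "\<dots> \<le> 1 / 2 * norm (x - y) + norm (x - y)"
    using displacement[of x y] mult_right_mono[OF beta(2), of "norm (x - y)"] by simp
  finally show ?thesis by simp
qed

lemma lower_Lipschitz: "norm (x - y) \<le> 2 * norm (F x - F y)"
proof -
  have "norm (x - y) \<le> norm (F x - F y) + norm ((F x - x) - (F y - y))"
    using norm_triangle_ineq4[of "F x - F y" "(F x - x) - (F y - y)"] by (simp add: algebra_simps)
  also have "\<dots> \<le> norm (F x - F y) + 1 / 2 * norm (x - y)"
    using displacement[of x y] mult_right_mono[OF beta(2), of "norm (x - y)"] by simp
  finally show ?thesis by simp
qed

text \<open>
  Solving \<open>F x = y\<close> means finding a fixed point of the contraction \<open>x \<mapsto> y - (F x - x)\<close>.
\<close>

lemma bij: "bij F"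
proof (rule bijI)
  show "inj F"
  proof (rule injI)
    fix x y assume "F x = F y"
    then show "x = y" using lower_Lipschitz[of x y] by simp
  qed
  have "\<exists>x. F x = y" for y
  proof -
    have "\<exists>!x. y - (F x - x) = x"
    proof (rule banach_fix_type[of \<beta>])
      show "\<forall>x x'. dist (y - (F x - x)) (y - (F x' - x')) \<le> \<beta> * dist x x'"
        using displacement by (simp add: dist_norm norm_minus_commute algebra_simps)
    qed (use beta in auto)
    then obtain x where "y - (F x - x) = x" by blast
    then have "F x = y" by (simp add: algebra_simps)
    then show ?thesis by blast
  qed
  then show "surj F" by (metis surjI)
qed

lemma F_inv [simp]: "F (inv F y) = y" and inv_F [simp]: "inv F (F x) = x"
  using bij by (simp_all add: bij_is_surj surj_f_inv_f bij_is_inj)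

lemma inv_Lipschitz: "norm (inv F y - inv F y') \<le> 2 * norm (y - y')"
  using lower_Lipschitz[of "inv F y" "inv F y'"] by simp

lemma in_Omega_iff: "F x \<in> Omega \<longleftrightarrow> x \<in> Omega"
proof
  assume "F x \<in> Omega"
  then show "x \<in> Omega" using outside[of x] by (cases "x \<in> Omega") simp_all
next
  assume x: "x \<in> Omega"
  show "F x \<in> Omega"
  proof (rule ccontr)
    assume "F x \<notin> Omega"
    then have "F (F x) = F x" by (rule outside)
    then have "inv F (F (F x)) = inv F (F x)" by (rule arg_cong)
    then have "F x = x" by simp
    with x \<open>F x \<notin> Omega\<close> show False by simp
  qed
qed

lemma continuous_F: "continuous_on S F"
  by (rule continuous_on_of_Lipschitz[OF Lipschitz]) simp

lemma continuous_inv: "continuous_on S (inv F)"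
  by (rule continuous_on_of_Lipschitz[OF inv_Lipschitz]) simp

lemma image_eq_vimage: "F ` S = inv F -` S"
  by (auto simp: image_iff) (metis F_inv)

lemma open_image: "open S \<Longrightarrow> open (F ` S)"
  unfolding image_eq_vimage by (rule open_vimage[OF _ continuous_inv])

lemma negligible_image_sphere: "negligible (F ` sphere 0 R)"
proof (rule negligible_locally_Lipschitz_image[OF _ negligible_sphere])
  show "\<exists>T B. open T \<and> x \<in> T \<and> (\<forall>y\<in>sphere 0 R \<inter> T. norm (F y - F x) \<le> B * norm (y - x))" for x
    using Lipschitz by (intro exI[of _ UNIV] exI[of _ "3 / 2"]) auto
qed simp

lemma negligible_boundary: "negligible (closure (F ` ball 0 R) - F ` ball 0 R)"
proof -
  have "closure (F ` ball 0 R) \<subseteq> F ` cball 0 R"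
  proof (rule closure_minimal)
    show "closed (F ` cball 0 R)" by (intro compact_imp_closed compact_continuous_image continuous_F compact_cball)
  qed auto
  then have "closure (F ` ball 0 R) - F ` ball 0 R \<subseteq> F ` sphere 0 R" by force
  then show ?thesis by (rule negligible_subset[OF negligible_image_sphere])
qed

text \<open>
  Unit vectors are fixed, and they are at distance at most \<open>2\<close> from the points of the unit ball.
\<close>

lemma displacement_le: assumes "norm x \<le> 1" shows "norm (F x - x) \<le> 2 * \<beta>"
proof -
  obtain i :: 'a where i: "i \<in> Basis" by fastforce
  then have "i \<notin> Omega" by (simp add: Omega_def)
  then have "norm (F x - x) \<le> \<beta> * norm (x - i)" using displacement[of x i] outside[of i] by simp
  also have "\<dots> \<le> \<beta> * 2" using norm_triangle_ineq4[of x i] i assms beta by (intro mult_left_mono) auto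
  finally show ?thesis by simp
qed

text \<open>
  The torsion function of a centred ball is piecewise a constant minus a multiple of \<open>|x|\<^sup>2\<close>. This
  estimate says that transporting it by \<open>F\<close> changes its gradient by \<open>O(\<beta>)\<close> only.
\<close>

lemma norm_square_shift:
  assumes "norm x \<le> 1" "norm x' \<le> 1"
  shows "\<bar>((norm (F x))\<^sup>2 - (norm x)\<^sup>2) - ((norm (F x'))\<^sup>2 - (norm x')\<^sup>2)\<bar> \<le> 8 * \<beta> * norm (x - x')"
proof -
  define \<xi> \<xi>' where "\<xi> = F x - x" and "\<xi>' = F x' - x'"
  have F: "F x = x + \<xi>" "F x' = x' + \<xi>'" by (simp_all add: \<xi>_def \<xi>'_def)
  have d: "norm (\<xi> - \<xi>') \<le> \<beta> * norm (x - x')" "norm \<xi> \<le> 2 * \<beta>" "norm \<xi>' \<le> 2 * \<beta>"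
    using displacement[of x x'] displacement_le assms by (simp_all add: \<xi>_def \<xi>'_def)
  have "((norm (F x))\<^sup>2 - (norm x)\<^sup>2) - ((norm (F x'))\<^sup>2 - (norm x')\<^sup>2)
      = (\<xi> - \<xi>') \<bullet> (2 *\<^sub>R x + \<xi>) + \<xi>' \<bullet> (2 *\<^sub>R (x - x') + (\<xi> - \<xi>'))"
    unfolding F power2_norm_eq_inner
    by (simp add: inner_add_left inner_add_right inner_diff_left inner_diff_right inner_commute algebra_simps)
  also have "\<bar>\<dots>\<bar> \<le> \<bar>(\<xi> - \<xi>') \<bullet> (2 *\<^sub>R x + \<xi>)\<bar> + \<bar>\<xi>' \<bullet> (2 *\<^sub>R (x - x') + (\<xi> - \<xi>'))\<bar>" by (rule abs_triangle_ineq)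
  also have "\<dots> \<le> (\<beta> * norm (x - x')) * 3 + (2 * \<beta>) * (5 / 2 * norm (x - x'))"
  proof (rule add_mono)
    have "norm (2 *\<^sub>R x + \<xi>) \<le> 3" using norm_triangle_ineq[of "2 *\<^sub>R x" \<xi>] assms d(2) beta by simp
    then show "\<bar>(\<xi> - \<xi>') \<bullet> (2 *\<^sub>R x + \<xi>)\<bar> \<le> (\<beta> * norm (x - x')) * 3"
      using d(1) beta by (intro order_trans[OF Cauchy_Schwarz_ineq2] mult_mono) auto
    have "norm (2 *\<^sub>R (x - x') + (\<xi> - \<xi>')) \<le> 2 * norm (x - x') + 1 / 2 * norm (x - x')"
      using norm_triangle_ineq[of "2 *\<^sub>R (x - x')" "\<xi> - \<xi>'"] d(1) mult_right_mono[OF beta(2), of "norm (x - x')"] by simp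
    then show "\<bar>\<xi>' \<bullet> (2 *\<^sub>R (x - x') + (\<xi> - \<xi>'))\<bar> \<le> (2 * \<beta>) * (5 / 2 * norm (x - x'))"
      using d(3) beta by (intro order_trans[OF Cauchy_Schwarz_ineq2] mult_mono) auto
  qed
  finally show ?thesis by (simp add: algebra_simps)
qed

text \<open>
  The competitors are mollifications of the torsion function of the centred ball, transported by
  \<open>F\<close>, that is, of \<open>w y = U (|F\<^sup>-\<^sup>1 y|)\<close>. By transport, the kink of \<open>w\<close> sits exactly on the interface of
  the deformed inclusion \<open>\<omega>\<close>. Off the interface, \<open>w\<close> therefore differs locally from \<open>- |y|\<^sup>2 / (2 N a)\<close>, up to an additive
  constant, by an \<open>O(\<beta>)\<close>-Lipschitz function, and the gradient error is \<open>O(\<beta>)\<close> pointwise. Its square is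
  \<open>O(\<beta>\<^sup>2)\<close>, which is negligible to first order.
\<close>

lemma torsional_rigidity_lower_bound:
  assumes R: "0 < R" "R < 1" and \<sigma>: "\<sigma>m > 0" "\<sigma>p > 0"
  defines "\<omega> \<equiv> F ` ball 0 R" and "N \<equiv> real DIM('a)"
  shows "(LINT x|lebesgue_on Omega. (norm x)\<^sup>2 / (N\<^sup>2 * conductivity \<sigma>m \<sigma>p \<omega> x))
      - 64 * \<beta>\<^sup>2 / (N\<^sup>2 * min \<sigma>m \<sigma>p) * measure lebesgue (Omega :: 'a set)
    \<le> torsional_rigidity \<sigma>m \<sigma>p \<omega>"
proof -
  let ?M = "lebesgue_on Omega :: 'a measure"
  interpret M: finite_measure ?M by (rule finite_measure_lebesgue_on[OF Omega_lmeasurable])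
  have N: "N \<ge> 1" "N > 0" unfolding N_def using DIM_positive[where 'a='a] by simp_all
  define a where "a = conductivity \<sigma>m \<sigma>p \<omega>"
  have \<omega>o: "open \<omega>" unfolding \<omega>_def by (intro open_image open_ball)
  have \<omega>n: "negligible (closure \<omega> - \<omega>)" unfolding \<omega>_def by (rule negligible_boundary)
  define U where "U s = (1 - (max R (min s 1))\<^sup>2) / (2 * N * \<sigma>p) + (R\<^sup>2 - (min s R)\<^sup>2) / (2 * N * \<sigma>m)" for s
  define L where "L = 1 / (N * \<sigma>p) + 1 / (N * \<sigma>m)"
  have L: "L \<ge> 0" using N \<sigma> by (simp add: L_def)
  have sq: "\<bar>p\<^sup>2 - q\<^sup>2\<bar> \<le> 2 * \<bar>p - q\<bar>" if "0 \<le> p" "p \<le> 1" "0 \<le> q" "q \<le> 1" for p q :: real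
  proof -
    have "\<bar>p\<^sup>2 - q\<^sup>2\<bar> = \<bar>p + q\<bar> * \<bar>p - q\<bar>" by (simp add: power2_eq_square algebra_simps flip: abs_mult)
    also have "\<dots> \<le> 2 * \<bar>p - q\<bar>" using that by (intro mult_right_mono) auto
    finally show ?thesis .
  qed
  have Ulip: "\<bar>U s - U s'\<bar> \<le> L * \<bar>s - s'\<bar>" if "0 \<le> s" "0 \<le> s'" for s s'
  proof -
    have 1: "\<bar>(max R (min s 1))\<^sup>2 - (max R (min s' 1))\<^sup>2\<bar> \<le> 2 * \<bar>s - s'\<bar>"
      by (rule order_trans[OF sq]) (use R that in \<open>auto simp: max_def min_def abs_if\<close>)
    have 2: "\<bar>(min s R)\<^sup>2 - (min s' R)\<^sup>2\<bar> \<le> 2 * \<bar>s - s'\<bar>"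
      by (rule order_trans[OF sq]) (use R that in \<open>auto simp: max_def min_def abs_if\<close>)
    have tri: "\<bar>- P / p - Q / q\<bar> \<le> \<bar>P\<bar> / p + \<bar>Q\<bar> / q" if "p > 0" "q > 0" for P Q p q :: real
      using abs_triangle_ineq4[of "- P / p" "Q / q"] that by (simp add: abs_divide)
    have "U s - U s' = - ((max R (min s 1))\<^sup>2 - (max R (min s' 1))\<^sup>2) / (2 * N * \<sigma>p) - ((min s R)\<^sup>2 - (min s' R)\<^sup>2) / (2 * N * \<sigma>m)"
      by (simp add: U_def diff_divide_distrib)
    also have "\<bar>\<dots>\<bar> \<le> \<bar>(max R (min s 1))\<^sup>2 - (max R (min s' 1))\<^sup>2\<bar> / (2 * N * \<sigma>p) + \<bar>(min s R)\<^sup>2 - (min s' R)\<^sup>2\<bar> / (2 * N * \<sigma>m)"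
      by (rule tri) (use N \<sigma> in auto)
    also have "\<dots> \<le> 2 * \<bar>s - s'\<bar> / (2 * N * \<sigma>p) + 2 * \<bar>s - s'\<bar> / (2 * N * \<sigma>m)"
      using N \<sigma> 1 2 by (intro add_mono divide_right_mono) auto
    also have "\<dots> = L * \<bar>s - s'\<bar>" using N \<sigma> by (simp add: L_def field_simps)
    finally show ?thesis .
  qed
  have U1: "U s = 0" if "s \<ge> 1" for s using that R by (simp add: U_def max_def min_def)
  define w where "w y = U (norm (inv F y))" for y
  have wlip: "\<bar>w y - w y'\<bar> \<le> 2 * L * norm (y - y')" for y y'
  proof -
    have "\<bar>w y - w y'\<bar> \<le> L * \<bar>norm (inv F y) - norm (inv F y')\<bar>" unfolding w_def by (rule Ulip) auto
    also have "\<dots> \<le> L * (2 * norm (y - y'))"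
      using norm_triangle_ineq3[of "inv F y" "inv F y'"] inv_Lipschitz[of y y'] L by (intro mult_left_mono) auto
    finally show ?thesis by (simp add: mult.left_commute)
  qed
  define \<delta> where "\<delta> k = inverse (real (Suc k))" for k
  have \<delta>: "\<delta> k > 0" "\<delta> k \<le> 1" for k by (auto simp: \<delta>_def field_simps)
  have \<delta>0: "\<delta> \<longlonglongrightarrow> 0" unfolding \<delta>_def by (rule LIMSEQ_inverse_real_of_nat)
  define v where "v k y = max 0 (w y - \<delta> k)" for k y
  have vlip: "\<bar>v k y - v k y'\<bar> \<le> 2 * L * norm (y - y')" for k y y'
  proof -
    have "\<bar>v k y - v k y'\<bar> \<le> \<bar>w y - w y'\<bar>" unfolding v_def by (auto simp: max_def abs_if)
    then show ?thesis using wlip[of y y'] by linarith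
  qed
  have contU: "continuous_on UNIV U" unfolding U_def using N \<sigma> by (intro continuous_intros) auto
  \<comment> \<open>Truncating at level \<open>\<delta> k\<close> moves the support away from the unit sphere, where \<open>w\<close> vanishes.\<close>
  have ex: "\<exists>\<phi>. test_function Omega \<phi> \<and> (\<forall>x g c. c \<ge> 0 \<longrightarrow> (\<forall>y\<in>ball x (\<delta> k). \<forall>z\<in>ball x (\<delta> k).
        \<bar>v k y - v k z - g \<bullet> (y - z)\<bar> \<le> c * norm (y - z)) \<longrightarrow> norm (grad \<phi> x - g) \<le> c)" for k
  proof -
    define C where "C = F ` {x \<in> cball 0 1. \<delta> k \<le> U (norm x)}"
    have "closed {x :: 'a. \<delta> k \<le> U (norm x)}"
      by (intro closed_Collect_le continuous_intros continuous_on_compose2[OF contU]) auto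
    then have "compact (cball (0::'a) 1 \<inter> {x. \<delta> k \<le> U (norm x)})" by (intro compact_Int_closed compact_cball)
    then have "compact {x \<in> cball (0::'a) 1. \<delta> k \<le> U (norm x)}" by (simp add: Int_def)
    then have C: "compact C" unfolding C_def by (intro compact_continuous_image continuous_F)
    have "C \<subseteq> Omega"
    proof
      fix y assume "y \<in> C"
      then obtain x where x: "y = F x" "\<delta> k \<le> U (norm x)" by (auto simp: C_def)
      have "norm x < 1" using U1[of "norm x"] x(2) \<delta>(1)[of k] by (cases "norm x < 1") auto
      then show "y \<in> Omega" unfolding x(1) in_Omega_iff by (simp add: Omega_def)
    qed
    have out: "v k y = 0" if "y \<notin> C" for y
    proof (rule ccontr)
      assume "v k y \<noteq> 0"
      then have "\<delta> k \<le> U (norm (inv F y))" by (simp add: v_def w_def max_def split: if_splits)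
      moreover from this have "norm (inv F y) \<le> 1" using U1[of "norm (inv F y)"] \<delta>(1)[of k] by (cases "norm (inv F y) \<le> 1") auto
      ultimately have "F (inv F y) \<in> C" unfolding C_def by (intro imageI) auto
      then show False using that by simp
    qed
    show ?thesis
    proof (rule mollification[OF vlip open_Omega C \<open>C \<subseteq> Omega\<close> out \<delta>(1)[of k]])
      fix \<phi> assume t: "test_function Omega \<phi>"
        and g: "\<And>x g c. c \<ge> 0 \<Longrightarrow> (\<And>y z. y \<in> ball x (\<delta> k) \<Longrightarrow> z \<in> ball x (\<delta> k) \<Longrightarrow>
          \<bar>v k y - v k z - g \<bullet> (y - z)\<bar> \<le> c * norm (y - z)) \<Longrightarrow> norm (grad \<phi> x - g) \<le> c"
      show ?thesis
        by (intro exI[of _ \<phi>] conjI t allI impI) (rule g, assumption, blast)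
    qed
  qed
  define \<phi> where "\<phi> k = (SOME \<phi>. test_function Omega \<phi> \<and> (\<forall>x g c. c \<ge> 0 \<longrightarrow> (\<forall>y\<in>ball x (\<delta> k). \<forall>z\<in>ball x (\<delta> k).
        \<bar>v k y - v k z - g \<bullet> (y - z)\<bar> \<le> c * norm (y - z)) \<longrightarrow> norm (grad \<phi> x - g) \<le> c))" for k
  note some = someI_ex[OF ex, folded \<phi>_def]
  have \<phi>: "\<And>k. test_function Omega (\<phi> k)"
    "\<And>k x g c. c \<ge> 0 \<Longrightarrow> (\<And>y z. y \<in> ball x (\<delta> k) \<Longrightarrow> z \<in> ball x (\<delta> k) \<Longrightarrow>
        \<bar>v k y - v k z - g \<bullet> (y - z)\<bar> \<le> c * norm (y - z)) \<Longrightarrow> norm (grad (\<phi> k) x - g) \<le> c"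
    using some by blast+
  have gbound: "norm (grad (\<phi> k) x) \<le> 2 * L" for k x
    using \<phi>(2)[of "2 * L" x k 0] vlip[of k] L by simp
  define m where "m = min \<sigma>m \<sigma>p"
  have m: "m > 0" "m \<le> \<sigma>m" "m \<le> \<sigma>p" using \<sigma> by (auto simp: m_def)
  define f where "f k y = a y * (norm (grad (\<phi> k) y + (1 / (N * a y)) *\<^sub>R y))\<^sup>2" for k y
  define b where "b k = (8 * \<beta> + \<delta> k)\<^sup>2 / (N\<^sup>2 * m)" for k
  \<comment> \<open>Near \<open>y\<close> the truncated function is \<open>\<kappa> - |F\<^sup>-\<^sup>1 y|\<^sup>2 / (2 N s) - \<delta> k\<close>. Replacing \<open>F\<^sup>-\<^sup>1 y\<close> by \<open>y\<close> costs
      \<open>8 \<beta>\<close>, linearising the square over the radius \<open>\<delta> k\<close> costs \<open>\<delta> k\<close>,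
      each divided by \<open>N s\<close>.\<close>
  have point: "\<forall>\<^sub>F k in sequentially. f k y \<le> b k"
    if x: "norm x < 1" "norm x \<noteq> R" and yF: "y = F x" and ay: "a y = (if norm x < R then \<sigma>m else \<sigma>p)" for x y
  proof -
    define s where "s = a y"
    have s: "s > 0" "m \<le> s" using ay m by (auto simp: s_def)
    define \<kappa> where "\<kappa> = (if norm x < R then (1 - R\<^sup>2) / (2 * N * \<sigma>p) + R\<^sup>2 / (2 * N * \<sigma>m) else 1 / (2 * N * \<sigma>p))"
    define Z where "Z = (if norm x < R then ball (0::'a) R else ball 0 1 - cball 0 R)"
    have Z: "open Z" "x \<in> Z" "Z \<subseteq> ball 0 1" using x R by (auto simp: Z_def)
    have UZ: "U (norm z) = \<kappa> - (norm z)\<^sup>2 / (2 * N * s)" if "z \<in> Z" for z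
    proof (cases "norm x < R")
      case True
      then show ?thesis using that R ay by (simp add: Z_def U_def \<kappa>_def s_def diff_divide_distrib)
    next
      case False
      then show ?thesis using that R ay by (simp add: Z_def U_def \<kappa>_def s_def diff_divide_distrib)
    qed
    have Ux: "U (norm x) > 0"
    proof (cases "norm x < R")
      case True
      have "(norm x)\<^sup>2 < R\<^sup>2" using True R by (intro power_strict_mono) auto
      moreover have "R\<^sup>2 < 1" using R by (simp add: power_less_one_iff)
      ultimately show ?thesis using True Z R N \<sigma> by (auto simp: U_def intro!: add_pos_pos divide_pos_pos)
    next
      case False
      have "(norm x)\<^sup>2 < 1" using x by (simp add: power_less_one_iff)
      then show ?thesis using False x Z R N \<sigma> by (auto simp: U_def intro!: divide_pos_pos)
    qed
    define O' where "O' = F ` (Z \<inter> {z. U (norm x) / 2 < U (norm z)})"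
    have "open {z :: 'a. U (norm x) / 2 < U (norm z)}"
      by (intro open_Collect_less continuous_intros continuous_on_compose2[OF contU]) auto
    then have "open O'" unfolding O'_def by (intro open_image open_Int Z)
    moreover have "y \<in> O'" unfolding O'_def yF using Z Ux by (intro imageI) auto
    ultimately obtain r where r: "r > 0" "ball y r \<subseteq> O'" using openE by blast
    have "\<forall>\<^sub>F k in sequentially. \<delta> k < r" "\<forall>\<^sub>F k in sequentially. \<delta> k < U (norm x) / 2"
      by (rule order_tendstoD(2)[OF \<delta>0], use r Ux in simp)+
    then show ?thesis
    proof eventually_elim
      case (elim k)
      have loc: "z \<in> Z" "v k (F z) = \<kappa> - (norm z)\<^sup>2 / (2 * N * s) - \<delta> k" if "F z \<in> ball y (\<delta> k)" for z
      proof -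
        have "F z \<in> O'" using that r(2) elim by auto
        then have z: "z \<in> Z" "U (norm x) / 2 < U (norm z)" unfolding O'_def using bij by (auto dest: injD[OF bij_is_inj])
        then show "z \<in> Z" by simp
        show "v k (F z) = \<kappa> - (norm z)\<^sup>2 / (2 * N * s) - \<delta> k"
          using z elim UZ[OF z(1)] by (simp add: v_def w_def)
      qed
      define c where "c = (8 * \<beta> + \<delta> k) / (N * s)"
      have c: "c \<ge> 0" using beta \<delta>(1)[of k] N s by (simp add: c_def)
      have "norm (grad (\<phi> k) y - (- (1 / (N * s))) *\<^sub>R y) \<le> c"
      proof (rule \<phi>(2)[OF c])
        fix y1 y2 assume y12: "y1 \<in> ball y (\<delta> k)" "y2 \<in> ball y (\<delta> k)"
        define x1 x2 where "x1 = inv F y1" and "x2 = inv F y2"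
        have y: "y1 = F x1" "y2 = F x2" by (simp_all add: x1_def x2_def)
        have n1: "norm x1 \<le> 1" "norm x2 \<le> 1" using loc(1) y12 Z(3) unfolding y by (force)+
        have vv: "v k y1 = \<kappa> - (norm x1)\<^sup>2 / (2 * N * s) - \<delta> k" "v k y2 = \<kappa> - (norm x2)\<^sup>2 / (2 * N * s) - \<delta> k"
          using loc(2)[of x1] loc(2)[of x2] y12 unfolding y by blast+
        have "v k y1 - v k y2 - ((- (1 / (N * s))) *\<^sub>R y) \<bullet> (y1 - y2)
            = ((norm x2)\<^sup>2 - (norm x1)\<^sup>2 + 2 * (y \<bullet> (y1 - y2))) / (2 * N * s)"
          unfolding vv inner_scaleR_left using N s by (simp add: field_simps)
        also have "(norm x2)\<^sup>2 - (norm x1)\<^sup>2 + 2 * (y \<bullet> (y1 - y2))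
          = (((norm y1)\<^sup>2 - (norm x1)\<^sup>2) - ((norm y2)\<^sup>2 - (norm x2)\<^sup>2)) - ((y1 - y) + (y2 - y)) \<bullet> (y1 - y2)"
          unfolding power2_norm_eq_inner by (simp add: inner_diff_left inner_diff_right inner_add_left inner_commute algebra_simps)
        also have "\<bar>(\<dots>) / (2 * N * s)\<bar> \<le> ((16 * \<beta> + 2 * \<delta> k) * norm (y1 - y2)) / (2 * N * s)"
        proof -
          have "\<bar>((norm y1)\<^sup>2 - (norm x1)\<^sup>2) - ((norm y2)\<^sup>2 - (norm x2)\<^sup>2)\<bar> \<le> 8 * \<beta> * norm (x1 - x2)"
            unfolding y by (rule norm_square_shift[OF n1])
          also have "\<dots> \<le> 8 * \<beta> * (2 * norm (y1 - y2))"
            using inv_Lipschitz[of y1 y2] beta by (intro mult_left_mono) (auto simp: x1_def x2_def)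
          finally have 1: "\<bar>((norm y1)\<^sup>2 - (norm x1)\<^sup>2) - ((norm y2)\<^sup>2 - (norm x2)\<^sup>2)\<bar> \<le> 16 * \<beta> * norm (y1 - y2)" by simp
          have "norm ((y1 - y) + (y2 - y)) \<le> 2 * \<delta> k"
            using norm_triangle_ineq[of "y1 - y" "y2 - y"] y12 by (simp add: dist_norm norm_minus_commute)
          then have 2: "\<bar>((y1 - y) + (y2 - y)) \<bullet> (y1 - y2)\<bar> \<le> 2 * \<delta> k * norm (y1 - y2)"
            by (intro order_trans[OF Cauchy_Schwarz_ineq2] mult_right_mono) auto
          have "\<bar>(((norm y1)\<^sup>2 - (norm x1)\<^sup>2) - ((norm y2)\<^sup>2 - (norm x2)\<^sup>2)) - ((y1 - y) + (y2 - y)) \<bullet> (y1 - y2)\<bar>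
            \<le> (16 * \<beta> + 2 * \<delta> k) * norm (y1 - y2)"
            using order_trans[OF abs_triangle_ineq4 add_mono[OF 1 2]] by (simp add: distrib_right)
          then show ?thesis using N s by (simp add: abs_divide abs_mult divide_right_mono)
        qed
        also have "\<dots> = c * norm (y1 - y2)" using N s by (simp add: c_def field_simps)
        finally show "\<bar>v k y1 - v k y2 - ((- (1 / (N * s))) *\<^sub>R y) \<bullet> (y1 - y2)\<bar> \<le> c * norm (y1 - y2)" .
      qed
      then have "norm (grad (\<phi> k) y + (1 / (N * s)) *\<^sub>R y) \<le> c" by simp
      then have "f k y \<le> s * c\<^sup>2" unfolding f_def s_def[symmetric] using s by (intro mult_left_mono power_mono) auto
      also have "\<dots> = (8 * \<beta> + \<delta> k)\<^sup>2 / (N\<^sup>2 * s)" using s N by (simp add: c_def power_divide power2_eq_square)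
      also have "\<dots> \<le> b k" unfolding b_def using s m N by (intro divide_left_mono mult_left_mono mult_pos_pos) auto
      finally show ?case .
    qed
  qed
  have ae: "AE y in ?M. a y \<ge> m \<and> (\<forall>\<^sub>F k in sequentially. f k y \<le> b k)"
  proof -
    show ?thesis
      using AE_conductivity[OF \<omega>n, of \<sigma>m \<sigma>p] AE_lebesgue_on_Omega_not_in[OF negligible_image_sphere[of R]] AE_space
    proof eventually_elim
      case (elim y)
      define x where "x = inv F y"
      have yF: "y = F x" by (simp add: x_def)
      have nR: "norm x \<noteq> R" using elim(2) unfolding yF by auto
      have "y \<in> Omega" using elim(3) by simp
      then have n1: "norm x < 1" unfolding yF in_Omega_iff by (simp add: Omega_def)
      have "y \<in> \<omega> \<longleftrightarrow> norm x < R"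
        unfolding \<omega>_def yF using bij by (auto simp: inj_image_mem_iff bij_is_inj)
      with elim(1) have ay: "a y = (if norm x < R then \<sigma>m else \<sigma>p)" by (simp add: a_def)
      then show ?case using point[OF n1 nR yF ay] m by auto
    qed
  qed
  have am[measurable]: "a \<in> borel_measurable ?M"
    unfolding a_def using \<omega>o by (intro conductivity_measurable) simp
  have gm[measurable]: "grad (\<phi> k) \<in> borel_measurable ?M" for k
    by (rule borel_measurable_lebesgue_on_continuous[OF test_function_continuous_grad[OF \<phi>(1)]])
  have idm[measurable]: "(\<lambda>x. x) \<in> borel_measurable ?M"
    by (rule borel_measurable_lebesgue_on_continuous[OF continuous_on_id])
  have fm[measurable]: "f k \<in> borel_measurable ?M" for k unfolding f_def by measurable
  define A where "A = (\<sigma>m + \<sigma>p) * (2 * L + 1 / m)\<^sup>2"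
  have fA: "AE y in ?M. 0 \<le> f k y \<and> f k y \<le> A" for k
    using ae AE_space
  proof eventually_elim
    case (elim y)
    have ay: "0 < a y" "m \<le> a y" "a y \<le> \<sigma>m + \<sigma>p"
      using elim m \<sigma> by (auto simp: a_def conductivity_def indicator_def)
    have "norm ((1 / (N * a y)) *\<^sub>R y) \<le> 1 / m"
    proof -
      have "1 * m \<le> N * a y" using N ay m by (intro mult_mono) auto
      moreover have "norm y \<le> 1" using elim by (simp add: Omega_def)
      moreover have "norm ((1 / (N * a y)) *\<^sub>R y) = norm y / (N * a y)" using N ay by simp
      ultimately show ?thesis using m by (simp add: frac_le)
    qed
    then have "norm (grad (\<phi> k) y + (1 / (N * a y)) *\<^sub>R y) \<le> 2 * L + 1 / m"
      by (intro order_trans[OF norm_triangle_ineq] add_mono gbound)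
    then show ?case unfolding f_def A_def using ay by (auto intro!: mult_mono power_mono)
  qed
  have fint: "integrable ?M (f k)" for k
    by (rule M.integrable_const_bound[of _ A]) (use fA[of k] in \<open>auto elim: eventually_mono\<close>)
  \<comment> \<open>The bound \<open>b k\<close> holds from a \<open>k\<close> on that depends on \<open>y\<close>; the excess over it tends to \<open>0\<close> in the mean.\<close>
  have "(\<lambda>k. LINT y|?M. max 0 (f k y - b k)) \<longlonglongrightarrow> (LINT y|?M. 0)"
  proof (rule integral_dominated_convergence[where w="\<lambda>_. A"])
    show "AE y in ?M. norm (max 0 (f k y - b k)) \<le> A" for k
      using fA[of k]
    proof eventually_elim
      case (elim y)
      have "b k \<ge> 0" using m N by (simp add: b_def)
      then show ?case using elim by auto
    qed
    show "AE y in ?M. (\<lambda>k. max 0 (f k y - b k)) \<longlonglongrightarrow> 0"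
      using ae
    proof eventually_elim
      case (elim y)
      then have "\<forall>\<^sub>F k in sequentially. 0 = max 0 (f k y - b k)" by (auto elim: eventually_mono)
      then show ?case by (rule Lim_transform_eventually[OF tendsto_const])
    qed
  qed auto
  then have lim0: "(\<lambda>k. LINT y|?M. max 0 (f k y - b k)) \<longlonglongrightarrow> 0" by simp
  define V where "V = measure lebesgue (Omega :: 'a set)"
  have V: "measure ?M (space ?M) = V"
    using fmeasurableD[OF Omega_lmeasurable] measure_restrict_space[of "Omega :: 'a set" lebesgue Omega]
    by (simp add: V_def)
  have fle: "(LINT y|?M. f k y) \<le> (LINT y|?M. max 0 (f k y - b k)) + b k * V" for k
  proof -
    have i: "integrable ?M (\<lambda>y. max 0 (f k y - b k))" using fint by simp
    have "(LINT y|?M. f k y) \<le> (LINT y|?M. max 0 (f k y - b k) + b k)"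
      by (rule integral_mono) (use fint i in auto)
    also have "\<dots> = (LINT y|?M. max 0 (f k y - b k)) + b k * V" using i V by simp
    finally show ?thesis .
  qed
  let ?G = "LINT x|?M. (norm x)\<^sup>2 / (N\<^sup>2 * a x)"
  have low: "?G - ((LINT y|?M. max 0 (f k y - b k)) + b k * V) \<le> torsional_rigidity \<sigma>m \<sigma>p \<omega>" for k
  proof -
    have "\<omega> \<in> sets lebesgue" using \<omega>o by simp
    from torsional_rigidity_bounds(2)[OF \<sigma> this \<omega>n \<phi>(1)[of k]]
    have "?G - (LINT y|?M. f k y) \<le> torsional_rigidity \<sigma>m \<sigma>p \<omega>"
      by (simp only: f_def a_def N_def)
    then show ?thesis using fle[of k] by linarith
  qed
  have "b \<longlonglongrightarrow> (8 * \<beta> + 0)\<^sup>2 / (N\<^sup>2 * m)" unfolding b_def using N m by (intro tendsto_intros \<delta>0) auto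
  then have "(\<lambda>k. ?G - ((LINT y|?M. max 0 (f k y - b k)) + b k * V)) \<longlonglongrightarrow> ?G - (0 + (8 * \<beta> + 0)\<^sup>2 / (N\<^sup>2 * m) * V)"
    by (intro tendsto_intros lim0)
  from LIMSEQ_le_const2[OF this] low
  have "?G - (0 + (8 * \<beta> + 0)\<^sup>2 / (N\<^sup>2 * m) * V) \<le> torsional_rigidity \<sigma>m \<sigma>p \<omega>" by blast
  then show ?thesis by (simp add: a_def V_def m_def power_mult_distrib)
qed

end

section \<open>The second moment of the inclusion\<close>

text \<open>
  The leading term of both bounds for the rigidity depends on the inclusion only through its
  second moment.
\<close>

lemma (in near_identity) weighted_moment:
  assumes R: "0 < R" "R < 1" and \<sigma>: "\<sigma>m > 0" "\<sigma>p > 0"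
  defines "\<omega> \<equiv> F ` ball 0 R" and "N \<equiv> real DIM('a)"
  shows "(LINT x|lebesgue_on Omega. (norm x)\<^sup>2 / (N\<^sup>2 * conductivity \<sigma>m \<sigma>p \<omega> x))
    = (1 / (N\<^sup>2 * \<sigma>p)) * (LINT x|lebesgue_on Omega. (norm (x::'a))\<^sup>2)
      + (1 / N\<^sup>2) * (1 / \<sigma>m - 1 / \<sigma>p) * (LINT x|lborel. indicator \<omega> x * (norm x)\<^sup>2)"
proof -
  let ?M = "lebesgue_on Omega :: 'a measure"
  have N: "N > 0" unfolding N_def by simp
  have \<omega>o: "open \<omega>" unfolding \<omega>_def by (intro open_image open_ball)
  have \<omega>n: "negligible (closure \<omega> - \<omega>)" unfolding \<omega>_def by (rule negligible_boundary)
  have "ball 0 R \<subseteq> (Omega :: 'a set)" using R by (auto simp: Omega_def)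
  then have sub: "\<omega> \<subseteq> Omega" unfolding \<omega>_def using in_Omega_iff by auto
  have cs: "continuous_on UNIV (\<lambda>x::'a. (norm x)\<^sup>2)" by (intro continuous_intros)
  have bm: "(\<lambda>x. indicator \<omega> x * (norm x)\<^sup>2) \<in> borel_measurable borel"
    using \<omega>o by (intro borel_measurable_times borel_measurable_indicator borel_measurable_continuous_onI[OF cs]) auto
  have mM: "(\<lambda>x. indicator \<omega> x * (norm x)\<^sup>2) \<in> borel_measurable ?M"
    using bm by (intro measurable_restrict_space1 measurable_completion) simp
  have nM[measurable]: "(\<lambda>x. (norm x)\<^sup>2) \<in> borel_measurable ?M" by (rule borel_measurable_lebesgue_on_continuous[OF cs])
  have am[measurable]: "conductivity \<sigma>m \<sigma>p \<omega> \<in> borel_measurable ?M"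
    using \<omega>o by (intro conductivity_measurable) simp
  interpret M: finite_measure ?M by (rule finite_measure_lebesgue_on[OF Omega_lmeasurable])
  have i1: "integrable ?M (\<lambda>x. (norm x)\<^sup>2)"
    by (rule M.integrable_const_bound[OF _ nM, of 1]) (auto simp: Omega_def abs_square_le_1)
  have i2: "integrable ?M (\<lambda>x. indicator \<omega> x * (norm x)\<^sup>2)"
    by (rule M.integrable_const_bound[OF _ mM, of 1]) (auto simp: Omega_def abs_square_le_1 indicator_def)
  have ae: "AE x in ?M. (norm x)\<^sup>2 / (N\<^sup>2 * conductivity \<sigma>m \<sigma>p \<omega> x)
      = (1 / (N\<^sup>2 * \<sigma>p)) * (norm x)\<^sup>2 + (1 / N\<^sup>2) * (1 / \<sigma>m - 1 / \<sigma>p) * (indicator \<omega> x * (norm x)\<^sup>2)"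
    using AE_conductivity[OF \<omega>n, of \<sigma>m \<sigma>p]
  proof eventually_elim
    case (elim x)
    then show ?case using \<sigma> N by (cases "x \<in> \<omega>") (simp_all add: field_simps)
  qed
  have "(LINT x|?M. (norm x)\<^sup>2 / (N\<^sup>2 * conductivity \<sigma>m \<sigma>p \<omega> x))
    = (LINT x|?M. (1 / (N\<^sup>2 * \<sigma>p)) * (norm x)\<^sup>2 + (1 / N\<^sup>2) * (1 / \<sigma>m - 1 / \<sigma>p) * (indicator \<omega> x * (norm x)\<^sup>2))"
    by (rule integral_cong_AE[OF _ _ ae]) (use mM in measurable)
  also have "\<dots> = (1 / (N\<^sup>2 * \<sigma>p)) * (LINT x|?M. (norm x)\<^sup>2)
      + (1 / N\<^sup>2) * (1 / \<sigma>m - 1 / \<sigma>p) * (LINT x|?M. indicator \<omega> x * (norm x)\<^sup>2)"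
    using i1 i2 by (simp only: Bochner_Integration.integral_add integrable_mult_right integral_mult_right_zero)
  also have "(LINT x|?M. indicator \<omega> x * (norm x)\<^sup>2) = (LINT x|lborel. indicator \<omega> x * (norm x)\<^sup>2)"
    by (rule integral_lebesgue_on_eq_lborel[OF _ bm]) (use sub fmeasurableD[OF Omega_lmeasurable] in \<open>auto simp: indicator_def\<close>)
  finally show ?thesis .
qed

text \<open>
  The change of variables formula, for \<open>J A\<close> in the role of \<open>|det A|\<close>. It and the expansion of \<open>J\<close> at
  the identity are the only facts about determinants that the second moment requires; the abstract
  formulation hides the renumbering of coordinates in which the determinant is computed.
\<close>

definition volume_scaling :: "((real ^ 'n::finite \<Rightarrow> real ^ 'n) \<Rightarrow> real) \<Rightarrow> bool" where
  "volume_scaling J \<longleftrightarrow> (\<forall>g g' S f. S \<in> sets borel \<longrightarrow> (\<forall>x. (g has_derivative g' x) (at x)) \<longrightarrow>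
    (\<forall>v. continuous_on UNIV (\<lambda>x. g' x v)) \<longrightarrow> inj g \<longrightarrow> g ` S \<in> sets borel \<longrightarrow>
    (f :: real ^ 'n \<Rightarrow> real) \<in> borel_measurable borel \<longrightarrow> integrable lborel (\<lambda>y. indicator (g ` S) y * f y) \<longrightarrow>
    integrable lborel (\<lambda>x. indicator S x * (J (g' x) * f (g x))) \<and>
    (LINT y|lborel. indicator (g ` S) y * f y) = (LINT x|lborel. indicator S x * (J (g' x) * f (g x))))"

lemma volume_scaling_exists:
  obtains J :: "(real ^ 'n::finite \<Rightarrow> real ^ 'n) \<Rightarrow> real" where "volume_scaling J"
    "\<forall>e>0. \<exists>d>0. \<forall>A s. linear A \<longrightarrow> 0 \<le> s \<longrightarrow> s < d \<longrightarrow> (\<forall>v. norm (A v - v) \<le> s * norm v) \<longrightarrow>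
      \<bar>J A - 1 - (\<Sum>b\<in>Basis. (A b - b) \<bullet> b)\<bar> \<le> e * s"
proof -
  obtain L :: "real ^ 'n ordinal_index \<Rightarrow> real ^ 'n" and L' where
    L: "linear L" "linear L'" "\<And>x. L (L' x) = x" "\<And>y. L' (L y) = y" "\<And>x y. L x \<bullet> L y = x \<bullet> y"
      "L ` Basis = Basis" "distr lborel borel L = lborel"
    by (rule coordinate_renumbering) (rule that; assumption)
  have bl: "bounded_linear L" "bounded_linear L'" using L(1,2) by (simp_all add: linear_conv_bounded_linear)
  have contL: "continuous_on A L" "continuous_on B L'" for A B using bl by (auto intro: linear_continuous_on)
  have mL[measurable]: "L \<in> borel_measurable borel" "L' \<in> borel_measurable borel"
    by (auto intro!: borel_measurable_continuous_onI contL)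
  have adj: "L' w \<bullet> y = w \<bullet> L y" for w y using L(5)[of "L' w" y] by (simp add: L(3))
  have normL: "norm (L y) = norm y" "norm (L' x) = norm x" for x y
    using L(5)[of y y] L(5)[of "L' x" "L' x"] by (simp_all add: norm_eq_sqrt_inner L(3))
  define J where "J A = \<bar>det (matrix (L' \<circ> A \<circ> L))\<bar>" for A :: "real ^ 'n \<Rightarrow> real ^ 'n"
  have vim: "indicator (L' ` S) y = indicator S (L y)" for S and y
  proof -
    have "y \<in> L' ` S \<longleftrightarrow> L y \<in> S" using L(3,4) by (metis image_iff)
    then show ?thesis by (simp add: indicator_def)
  qed
  have vim_sets: "L' ` S \<in> sets borel" if "S \<in> sets borel" for S
  proof -
    have "L' ` S = L -` S \<inter> space borel" using L(3,4) by (auto simp: image_iff) metis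
    then show ?thesis using measurable_sets[OF mL(1) that] by simp
  qed
  have transfer: "(LINT x|lborel. k x) = (LINT y|lborel. k (L y))"
    and transfer_i: "integrable lborel (\<lambda>y. k (L y)) \<longleftrightarrow> integrable lborel k"
    if "k \<in> borel_measurable borel" for k :: "real ^ 'n \<Rightarrow> real"
  proof -
    have m: "L \<in> lborel \<rightarrow>\<^sub>M borel" by simp
    show "(LINT x|lborel. k x) = (LINT y|lborel. k (L y))"
      using integral_distr[OF m that] L(7) by simp
    show "integrable lborel (\<lambda>y. k (L y)) \<longleftrightarrow> integrable lborel k"
      using integrable_distr_eq[OF m that] L(7) by simp
  qed
  have "volume_scaling J"
    unfolding volume_scaling_def
  proof (intro allI impI)
    fix g :: "real ^ 'n \<Rightarrow> real ^ 'n" and g' S and f :: "real ^ 'n \<Rightarrow> real"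
    assume S: "S \<in> sets borel" and "\<forall>x. (g has_derivative g' x) (at x)"
      and "\<forall>v. continuous_on UNIV (\<lambda>x. g' x v)" and inj: "inj g" and gS: "g ` S \<in> sets borel"
      and f: "f \<in> borel_measurable borel" and int: "integrable lborel (\<lambda>y. indicator (g ` S) y * f y)"
    then have der: "\<And>x. (g has_derivative g' x) (at x)" and cont: "\<And>v. continuous_on UNIV (\<lambda>x. g' x v)" by auto
    define G where "G = L' \<circ> g \<circ> L"
    define G' where "G' y = L' \<circ> g' (L y) \<circ> L" for y
    have dG: "(G has_derivative G' y) (at y)" for y
    proof -
      have dL: "(L has_derivative L) (at y)" for y by (rule bounded_linear_imp_has_derivative[OF bl(1)])
      have dL': "(L' has_derivative L') (at x)" for x by (rule bounded_linear_imp_has_derivative[OF bl(2)])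
      show ?thesis unfolding G_def G'_def comp_def
        by (rule has_derivative_compose[OF has_derivative_compose[OF dL der] dL'])
    qed
    have cG: "continuous_on UNIV (\<lambda>y. G' y v)" for v
      unfolding G'_def comp_def
      by (intro continuous_on_compose2[OF contL(2)[of UNIV]] continuous_on_compose2[OF cont] contL) auto
    have img: "G ` (L' ` S) = L' ` (g ` S)" by (simp add: G_def image_comp comp_def L(3))
    have iG: "inj_on G (L' ` S)"
    proof (rule inj_onI)
      fix y y' assume "G y = G y'"
      then have "L (G y) = L (G y')" by simp
      then have "g (L y) = g (L y')" by (simp add: G_def L(3))
      then have "L' (L y) = L' (L y')" using inj by (simp add: inj_eq)
      then show "y = y'" by (simp add: L(4))
    qed
    have m1: "(\<lambda>y. indicator (g ` S) y * f y) \<in> borel_measurable borel"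
      using f gS by (intro borel_measurable_times borel_measurable_indicator)
    have int': "integrable lborel (\<lambda>y. indicator (G ` (L' ` S)) y * f (L y))"
      unfolding img vim using transfer_i[OF m1] int by simp
    have fL: "(\<lambda>y. f (L y)) \<in> borel_measurable borel" by (rule measurable_compose[OF mL(1) f])
    note cv = integral_image_wellorder[OF vim_sets[OF S] dG cG iG _ fL int']
    have GS: "G ` (L' ` S) \<in> sets borel" unfolding img by (rule vim_sets[OF gS])
    have eq: "(\<lambda>y. indicator (L' ` S) y * (\<bar>det (matrix (G' y))\<bar> * f (L (G y)))) = (\<lambda>y. (\<lambda>x. indicator S x * (J (g' x) * f (g x))) (L y))"
      by (simp add: vim J_def G'_def G_def L(3))
    have contJ: "continuous_on UNIV (\<lambda>x. J (g' x))"
      unfolding J_def det_def matrix_def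
      by (intro continuous_intros; simp; intro continuous_on_component continuous_on_compose2[OF contL(2)[of UNIV]] cont) auto
    have cg: "continuous_on UNIV g" using der by (intro has_derivative_continuous_on) auto
    have m2: "(\<lambda>x. indicator S x * (J (g' x) * f (g x))) \<in> borel_measurable borel"
      using S borel_measurable_continuous_onI[OF contJ] measurable_compose[OF borel_measurable_continuous_onI[OF cg] f]
      by (intro borel_measurable_times borel_measurable_indicator)
    have "integrable lborel (\<lambda>x. indicator S x * (J (g' x) * f (g x)))"
      using cv(1)[OF GS] unfolding eq transfer_i[OF m2] .
    moreover have "(LINT y|lborel. indicator (g ` S) y * f y) = (LINT x|lborel. indicator S x * (J (g' x) * f (g x)))"
    proof -
      have "(LINT y|lborel. indicator (g ` S) y * f y) = (LINT y|lborel. indicator (g ` S) (L y) * f (L y))"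
        by (rule transfer[OF m1])
      also have "\<dots> = (LINT y|lborel. indicator (G ` (L' ` S)) y * f (L y))" unfolding img vim ..
      also have "\<dots> = (LINT y|lborel. (\<lambda>x. indicator S x * (J (g' x) * f (g x))) (L y))"
        unfolding cv(2)[OF GS] eq ..
      also have "\<dots> = (LINT x|lborel. indicator S x * (J (g' x) * f (g x)))" by (rule transfer[OF m2, symmetric])
      finally show ?thesis .
    qed
    ultimately show "integrable lborel (\<lambda>x. indicator S x * (J (g' x) * f (g x))) \<and>
      (LINT y|lborel. indicator (g ` S) y * f y) = (LINT x|lborel. indicator S x * (J (g' x) * f (g x)))" by blast
  qed
  moreover have "\<exists>d>0. \<forall>A s. linear A \<longrightarrow> 0 \<le> s \<longrightarrow> s < d \<longrightarrow> (\<forall>v. norm (A v - v) \<le> s * norm v) \<longrightarrow>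
      \<bar>J A - 1 - (\<Sum>b\<in>Basis. (A b - b) \<bullet> b)\<bar> \<le> e * s" if "e > 0" for e :: real
  proof -
    from that
    obtain d where d: "d > 0" "\<And>A s. linear A \<Longrightarrow> 0 \<le> s \<Longrightarrow> s < d \<Longrightarrow>
        (\<And>v::real^'n ordinal_index. norm (A v - v) \<le> s * norm v) \<Longrightarrow> \<bar>det (matrix A) - 1 - (\<Sum>b\<in>Basis. (A b - b) \<bullet> b)\<bar> \<le> e * s"
      by (rule det_near_identity) blast
    define n where "n = real CARD('n)"
    have n: "n > 0" by (simp add: n_def)
    show ?thesis
    proof (intro exI[of _ "min d (1 / n)"] conjI allI impI)
      show "min d (1 / n) > 0" using d(1) n by simp
      fix A :: "real ^ 'n \<Rightarrow> real ^ 'n" and s :: real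
      assume lin: "linear A" and s: "0 \<le> s" "s < min d (1 / n)" and A: "\<forall>v. norm (A v - v) \<le> s * norm v"
      let ?A = "L' \<circ> A \<circ> L"
      have diff: "?A y - y = L' (A (L y) - L y)" for y by (simp add: linear_diff[OF L(2)] L(4))
      have "linear ?A" by (intro linear_compose L(1,2) lin)
      moreover have "norm (?A y - y) \<le> s * norm y" for y
        unfolding diff normL using A[rule_format, of "L y"] by (simp add: normL)
      ultimately have 1: "\<bar>det (matrix ?A) - 1 - (\<Sum>b\<in>Basis. (?A b - b) \<bullet> b)\<bar> \<le> e * s"
        using s by (intro d(2)) auto
      have "(\<Sum>b\<in>Basis. (?A b - b) \<bullet> b) = (\<Sum>b\<in>Basis. (A (L b) - L b) \<bullet> L b)"
        unfolding diff adj ..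
      also have "\<dots> = (\<Sum>b\<in>L ` Basis. (A b - b) \<bullet> b)"
        by (subst sum.reindex) (auto intro!: inj_on_inverseI[of _ L'] simp: L(4))
      finally have tr: "(\<Sum>b\<in>Basis. (?A b - b) \<bullet> b) = (\<Sum>b\<in>Basis. (A b - b) \<bullet> b)" unfolding L(6) .
      let ?T = "\<Sum>b\<in>Basis. (A b - b) \<bullet> b"
      have "\<bar>?T\<bar> \<le> (\<Sum>b\<in>(Basis :: (real ^ 'n) set). s)"
      proof (rule order_trans[OF sum_abs sum_mono])
        fix b :: "real ^ 'n" assume b: "b \<in> Basis"
        have "\<bar>(A b - b) \<bullet> b\<bar> \<le> norm (A b - b)" by (rule Basis_le_norm[OF b])
        then show "\<bar>(A b - b) \<bullet> b\<bar> \<le> s" using A[rule_format, of b] b by simp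
      qed
      also have "\<dots> = n * s" by (simp add: n_def)
      also have "\<dots> \<le> 1" using s n by (simp add: field_simps)
      finally have "0 \<le> 1 + ?T" by linarith
      then show "\<bar>J A - 1 - ?T\<bar> \<le> e * s" using 1 unfolding tr J_def by linarith
    qed
  qed
  ultimately show ?thesis using that by blast
qed

lemma near_identity_of_expansion:
  fixes \<Phi> :: "real \<Rightarrow> 'a::euclidean_space \<Rightarrow> 'a"
  assumes \<Phi>0: "\<Phi> 0 = id"
    and deriv: "\<And>t x. t \<in> {0..<1} \<Longrightarrow> (\<Phi> t has_derivative D t x) (at x)"
    and H: "\<And>x v. norm (H x v) \<le> C * norm v" "C \<ge> 0"
    and exp: "\<And>e. e > 0 \<Longrightarrow> \<exists>d>0. d < 1 \<and> (\<forall>t\<in>{0<..<d}. \<forall>x v. norm (D t x v - v - t *\<^sub>R H x v) \<le> e * t * norm v)"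
    and out: "\<And>t x. t \<in> {0..<1} \<Longrightarrow> x \<notin> Omega \<Longrightarrow> \<Phi> t x = x"
  obtains d where "0 < d" "d < 1" "\<And>t. t \<in> {0..<d} \<Longrightarrow> near_identity (\<Phi> t) ((C + 1) * t)"
    "\<And>t x v. t \<in> {0<..<d} \<Longrightarrow> norm (D t x v - v) \<le> ((C + 1) * t) * norm v"
proof -
  obtain d1 where d1: "d1 > 0" "d1 < 1" "\<And>t x v. t \<in> {0<..<d1} \<Longrightarrow> norm (D t x v - v - t *\<^sub>R H x v) \<le> 1 * t * norm v"
    using exp[of 1] by (auto simp del: mult_1)
  define d where "d = min d1 (1 / (2 * (C + 1)))"
  have d: "d > 0" "d < 1" "d \<le> d1" using d1 H(2) by (auto simp: d_def)
  have Dest: "norm (D t x v - v) \<le> ((C + 1) * t) * norm v" if t: "t \<in> {0<..<d}" for t x v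
  proof -
    have "norm (D t x v - v) \<le> norm (D t x v - v - t *\<^sub>R H x v) + norm (t *\<^sub>R H x v)"
      using norm_triangle_ineq[of "D t x v - v - t *\<^sub>R H x v" "t *\<^sub>R H x v"] by simp
    also have "\<dots> \<le> t * norm v + t * (C * norm v)"
      using d1(3)[of t x v] t d H(1)[of x v] by (intro add_mono) (auto intro: mult_left_mono)
    finally show ?thesis by (simp add: algebra_simps)
  qed
  show ?thesis
  proof (rule that[OF d(1,2) _ Dest])
    fix t assume t: "t \<in> {0..<d}"
    show "near_identity (\<Phi> t) ((C + 1) * t)"
    proof
      show "0 \<le> (C + 1) * t" using t H(2) by simp
      have "t \<le> 1 / (2 * (C + 1))" using t by (simp add: d_def)
      then show "(C + 1) * t \<le> 1 / 2" using H(2) by (simp add: field_simps)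
      show "\<Phi> t x = x" if "x \<notin> Omega" for x using out that t d by auto
      fix x y
      show "norm ((\<Phi> t x - x) - (\<Phi> t y - y)) \<le> (C + 1) * t * norm (x - y)"
      proof (cases "t = 0")
        case True
        then show ?thesis by (simp add: \<Phi>0)
      next
        case False
        then have t': "t \<in> {0<..<d}" using t by auto
        show ?thesis
        proof (rule differentiable_bound[where S=UNIV and f'="\<lambda>x v. D t x v - v"])
          show "((\<lambda>x. \<Phi> t x - x) has_derivative (\<lambda>v. D t z v - v)) (at z within UNIV)" for z
            using deriv[of t z] t d by (auto intro!: derivative_eq_intros)
          show "onorm (\<lambda>v. D t z v - v) \<le> (C + 1) * t" for z by (intro onorm_le Dest t')
        qed auto
      qed
    qed
  qed
qed

text \<open>
  After the change of variables the domain is fixed and the integrand \<open>J (D t x) |\<Phi>(t) x|\<^sup>2\<close> is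
  differentiated pointwise: \<open>J\<close> contributes the divergence of \<open>h\<close> and \<open>|\<Phi>(t) x|\<^sup>2\<close> contributes \<open>2 x \<bullet> h x\<close>.
  The difference quotients are bounded uniformly because both \<open>D\<^sub>x\<Phi>(t) - I\<close> and \<open>\<Phi>(t) - Id\<close> are \<open>O(t)\<close>.
\<close>

lemma second_moment_derivative:
  fixes \<Phi> :: "real \<Rightarrow> real ^ 'n \<Rightarrow> real ^ 'n"
  assumes R: "0 < R" "R < 1" and \<Phi>0: "\<Phi> 0 = id"
    and deriv: "\<And>t x. t \<in> {0..<1} \<Longrightarrow> (\<Phi> t has_derivative D t x) (at x)"
    and contD: "\<And>t v. t \<in> {0..<1} \<Longrightarrow> continuous_on UNIV (\<lambda>x. D t x v)"
    and exp: "\<And>e. e > 0 \<Longrightarrow> \<exists>d>0. d < 1 \<and> (\<forall>t\<in>{0<..<d}. \<forall>x v. norm (D t x v - v - t *\<^sub>R H x v) \<le> e * t * norm v)"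
    and h: "\<And>x. ((\<lambda>t. (\<Phi> t x - (x + t *\<^sub>R h x)) /\<^sub>R t) \<longlongrightarrow> 0) (at_right 0)"
    and B: "B > 0" and d: "0 < d" "d < 1" and ni: "\<And>t. t \<in> {0..<d} \<Longrightarrow> near_identity (\<Phi> t) (B * t)"
    and Dest: "\<And>t x v. t \<in> {0<..<d} \<Longrightarrow> norm (D t x v - v) \<le> (B * t) * norm v"
  shows "((\<lambda>t. LINT y|lborel. indicator (\<Phi> t ` ball 0 R) y * (norm y)\<^sup>2) has_real_derivative
    (LINT x|lborel. indicator (ball 0 R) x * ((norm x)\<^sup>2 * (\<Sum>b\<in>Basis. H x b \<bullet> b) + 2 * (x \<bullet> h x)))) (at_right 0)"
proof -
  define N where "N = real CARD('n)"
  obtain J :: "(real ^ 'n \<Rightarrow> real ^ 'n) \<Rightarrow> real" where cv: "volume_scaling J"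
    and J: "\<forall>e>0. \<exists>d>0. \<forall>A s. linear A \<longrightarrow> 0 \<le> s \<longrightarrow> s < d \<longrightarrow> (\<forall>v. norm (A v - v) \<le> s * norm v) \<longrightarrow>
      \<bar>J A - 1 - (\<Sum>b\<in>Basis. (A b - b) \<bullet> b)\<bar> \<le> e * s"
    by (rule volume_scaling_exists)
  let ?B = "ball (0 :: real ^ 'n) R"
  define m where "m t = (LINT y|lborel. indicator (\<Phi> t ` ?B) y * (norm y)\<^sup>2)" for t
  define c where "c x = (norm x)\<^sup>2 * (\<Sum>b\<in>Basis. H x b \<bullet> b) + 2 * (x \<bullet> h x)" for x
  have cs: "continuous_on UNIV (\<lambda>x::real^'n. (norm x)\<^sup>2)" by (intro continuous_intros)
  have bs: "(\<lambda>x::real^'n. (norm x)\<^sup>2) \<in> borel_measurable borel" by (rule borel_measurable_continuous_onI[OF cs])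
  have B\<Omega>: "?B \<subseteq> Omega" using R by (auto simp: Omega_def)
  define k where "k t x = J (D t x) * (norm (\<Phi> t x))\<^sup>2" for t x
  have m: "integrable lborel (\<lambda>x. indicator ?B x * k t x)" "m t = (LINT x|lborel. indicator ?B x * k t x)"
    if t: "t \<in> {0<..<d}" for t
  proof -
    interpret near_identity "\<Phi> t" "B * t" using ni t by auto
    have o: "open (\<Phi> t ` ?B)" by (intro open_image open_ball)
    have sub: "\<Phi> t ` ?B \<subseteq> ball 0 1" using B\<Omega> in_Omega_iff by (auto simp: Omega_def)
    have i: "integrable lborel (\<lambda>y. indicator (\<Phi> t ` ?B) y * (norm y)\<^sup>2)"
    proof (rule integrable_bounded_on_cball[where R=1 and B=1])
      show "(\<lambda>y. indicator (\<Phi> t ` ?B) y * (norm y)\<^sup>2) \<in> borel_measurable borel"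
        using o by (intro borel_measurable_times borel_measurable_indicator bs) auto
      show "indicator (\<Phi> t ` ?B) y * (norm y)\<^sup>2 = 0" if "norm y > 1" for y
        using that sub by (auto simp: indicator_def)
    qed (auto simp: indicator_def abs_square_le_1)
    have t1: "t \<in> {0..<1}" using t d by auto
    show "integrable lborel (\<lambda>x. indicator ?B x * k t x)" "m t = (LINT x|lborel. indicator ?B x * k t x)"
      using cv[unfolded volume_scaling_def, rule_format, OF _ deriv[OF t1] contD[OF t1] bij_is_inj[OF bij] _ bs i] o
      unfolding k_def m_def by auto
  qed
  have m0: "m 0 = (LINT x|lborel. indicator ?B x * (norm x)\<^sup>2)" by (simp add: m_def \<Phi>0)
  have int0: "integrable lborel (\<lambda>x::real^'n. indicator ?B x * (norm x)\<^sup>2)"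
  proof (rule integrable_bounded_on_cball[where R=1 and B=1])
    show "(\<lambda>x::real^'n. indicator ?B x * (norm x)\<^sup>2) \<in> borel_measurable borel"
      by (intro borel_measurable_times borel_measurable_indicator bs) auto
    show "indicator ?B x * (norm x)\<^sup>2 = 0" if "norm x > 1" for x :: "real ^ 'n" using that R by (auto simp: indicator_def)
  qed (auto simp: indicator_def abs_square_le_1)
  have trace: "\<bar>\<Sum>b\<in>Basis. (D t x b - b) \<bullet> b\<bar> \<le> N * (B * t)" if t: "t \<in> {0<..<d}" for t x
  proof -
    have "\<bar>\<Sum>b\<in>Basis. (D t x b - b) \<bullet> b\<bar> \<le> (\<Sum>b\<in>(Basis :: (real ^ 'n) set). B * t)"
    proof (rule order_trans[OF sum_abs sum_mono])
      fix b :: "real ^ 'n" assume b: "b \<in> Basis"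
      show "\<bar>(D t x b - b) \<bullet> b\<bar> \<le> B * t"
        using Basis_le_norm[OF b, of "D t x b - b"] Dest[OF t, of x b] b by simp
    qed
    then show ?thesis by (simp add: N_def)
  qed
  have lin: "linear (D t x)" if "t \<in> {0<..<d}" for t x
    using deriv[of t x] that d by (intro has_derivative_linear) auto
  have Jest: "\<exists>r>0. r < d \<and> (\<forall>t\<in>{0<..<r}. \<forall>x. \<bar>J (D t x) - 1 - (\<Sum>b\<in>Basis. (D t x b - b) \<bullet> b)\<bar> \<le> e * (B * t))"
    if "e > 0" for e
  proof -
    obtain q where q: "q > 0" "\<forall>A s. linear A \<longrightarrow> 0 \<le> s \<longrightarrow> s < q \<longrightarrow> (\<forall>v. norm (A v - v) \<le> s * norm v) \<longrightarrow>
      \<bar>J A - 1 - (\<Sum>b\<in>Basis. (A b - b) \<bullet> b)\<bar> \<le> e * s" using J \<open>e > 0\<close> by blast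
    show ?thesis
    proof (intro exI[of _ "min (d / 2) (q / B)"] conjI ballI allI)
      show "min (d / 2) (q / B) > 0" "min (d / 2) (q / B) < d" using d q B by auto
      fix t x assume t: "t \<in> {0<..<min (d / 2) (q / B)}"
      then have t': "t \<in> {0<..<d}" using d by auto
      have "B * t < q" using t B by (simp add: field_simps)
      then show "\<bar>J (D t x) - 1 - (\<Sum>b\<in>Basis. (D t x b - b) \<bullet> b)\<bar> \<le> e * (B * t)"
        using q(2)[rule_format, of "D t x" "B * t"] lin[OF t'] Dest[OF t'] t B by simp
    qed
  qed
  have limh: "((\<lambda>t. (\<Phi> t x - x) /\<^sub>R t) \<longlongrightarrow> h x) (at_right 0)" for x
  proof -
    have "((\<lambda>t. (\<Phi> t x - (x + t *\<^sub>R h x)) /\<^sub>R t + h x) \<longlongrightarrow> h x) (at_right 0)"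
      using tendsto_add[OF h[of x] tendsto_const[of "h x"]] by (simp only: add_0)
    then show ?thesis
    proof (rule Lim_transform_eventually)
      show "\<forall>\<^sub>F t in at_right 0. (\<Phi> t x - (x + t *\<^sub>R h x)) /\<^sub>R t + h x = (\<Phi> t x - x) /\<^sub>R t"
        unfolding eventually_at_right_field
        by (intro exI[of _ 1]) (auto simp: scaleR_diff_right scaleR_add_right)
    qed
  qed
  have limD: "((\<lambda>t. (D t x v - v) /\<^sub>R t) \<longlongrightarrow> H x v) (at_right 0)" for x v
  proof (rule tendstoI)
    fix e :: real assume "e > 0"
    define w where "w = norm v + 1"
    define e' where "e' = e / (2 * w)"
    have nv: "w > 0" by (simp add: w_def add_nonneg_pos)
    have e': "e' > 0" using \<open>e > 0\<close> nv by (simp add: e'_def)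
    have e'v: "e' * norm v < e"
    proof -
      have "e' * norm v \<le> e' * w" using e' by (simp add: w_def)
      also have "\<dots> = e / 2" using nv by (simp add: e'_def)
      finally show ?thesis using \<open>e > 0\<close> by simp
    qed
    obtain r where r: "r > 0" "\<forall>t\<in>{0<..<r}. \<forall>x v. norm (D t x v - v - t *\<^sub>R H x v) \<le> e' * t * norm v"
      using exp[OF e'] by blast
    show "\<forall>\<^sub>F t in at_right 0. dist ((D t x v - v) /\<^sub>R t) (H x v) < e"
      unfolding eventually_at_right_field
    proof (intro exI[of _ r] conjI allI impI)
      fix t assume t: "0 < t" "t < r"
      have "(D t x v - v) /\<^sub>R t - H x v = (D t x v - v - t *\<^sub>R H x v) /\<^sub>R t"
        using t by (simp add: scaleR_diff_right)
      then have "dist ((D t x v - v) /\<^sub>R t) (H x v) = norm (D t x v - v - t *\<^sub>R H x v) / t"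
        using t by (simp add: dist_norm divide_inverse mult.commute)
      also have "\<dots> \<le> e' * norm v" using r(2)[rule_format, of t x v] t by (simp add: pos_divide_le_eq mult_ac)
      finally show "dist ((D t x v - v) /\<^sub>R t) (H x v) < e" using e'v by linarith
    qed (rule r(1))
  qed
  have limtr: "((\<lambda>t. (\<Sum>b\<in>Basis. (D t x b - b) \<bullet> b) / t) \<longlongrightarrow> (\<Sum>b\<in>Basis. H x b \<bullet> b)) (at_right 0)" for x
  proof -
    have "((\<lambda>t. \<Sum>b\<in>Basis. ((D t x b - b) /\<^sub>R t) \<bullet> b) \<longlongrightarrow> (\<Sum>b\<in>Basis. H x b \<bullet> b)) (at_right 0)"
      by (intro tendsto_sum tendsto_inner limD tendsto_const)
    moreover have "(\<Sum>b\<in>Basis. ((D t x b - b) /\<^sub>R t) \<bullet> b) = (\<Sum>b\<in>Basis. (D t x b - b) \<bullet> b) / t" for t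
      by (simp add: sum_distrib_left divide_inverse mult.commute)
    ultimately show ?thesis by simp
  qed
  have limJ: "((\<lambda>t. (J (D t x) - 1) / t) \<longlongrightarrow> (\<Sum>b\<in>Basis. H x b \<bullet> b)) (at_right 0)" for x
  proof -
    have "((\<lambda>t. (J (D t x) - 1) / t - (\<Sum>b\<in>Basis. (D t x b - b) \<bullet> b) / t) \<longlongrightarrow> 0) (at_right 0)"
    proof (rule tendstoI)
      fix e :: real assume "e > 0"
      then obtain r where r: "r > 0" "r < d" "\<forall>t\<in>{0<..<r}. \<forall>x. \<bar>J (D t x) - 1 - (\<Sum>b\<in>Basis. (D t x b - b) \<bullet> b)\<bar> \<le> (e / (2 * B)) * (B * t)"
        using Jest[of "e / (2 * B)"] B by auto
      show "\<forall>\<^sub>F t in at_right 0. dist ((J (D t x) - 1) / t - (\<Sum>b\<in>Basis. (D t x b - b) \<bullet> b) / t) 0 < e"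
        unfolding eventually_at_right_field
      proof (intro exI[of _ r] conjI allI impI)
        fix t assume t: "0 < t" "t < r"
        have "\<bar>J (D t x) - 1 - (\<Sum>b\<in>Basis. (D t x b - b) \<bullet> b)\<bar> \<le> (e / 2) * t"
          using r(3)[rule_format, of t x] t B by simp
        then have "\<bar>(J (D t x) - 1 - (\<Sum>b\<in>Basis. (D t x b - b) \<bullet> b)) / t\<bar> \<le> e / 2"
          using t by (simp add: abs_divide divide_le_eq)
        then show "dist ((J (D t x) - 1) / t - (\<Sum>b\<in>Basis. (D t x b - b) \<bullet> b) / t) 0 < e"
          using \<open>e > 0\<close> by (simp add: diff_divide_distrib)
      qed (rule r(1))
    qed
    from tendsto_add[OF this limtr[of x]] show ?thesis by simp
  qed
  have lim\<Phi>: "((\<lambda>t. \<Phi> t x) \<longlongrightarrow> x) (at_right 0)" for x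
  proof -
    have "((\<lambda>t. x + t *\<^sub>R ((\<Phi> t x - x) /\<^sub>R t)) \<longlongrightarrow> x + 0 *\<^sub>R h x) (at_right 0)"
      by (intro tendsto_intros limh)
    then have "((\<lambda>t. x + t *\<^sub>R ((\<Phi> t x - x) /\<^sub>R t)) \<longlongrightarrow> x) (at_right 0)" by simp
    then show ?thesis
      by (rule Lim_transform_eventually) (auto simp: eventually_at_right_field intro!: exI[of _ 1])
  qed
  have split: "(k t x - (norm x)\<^sup>2) / t = ((J (D t x) - 1) / t) * (norm (\<Phi> t x))\<^sup>2 + ((\<Phi> t x - x) /\<^sub>R t) \<bullet> (\<Phi> t x + x)"
    if "t > 0" for t x
  proof -
    have "(\<Phi> t x - x) \<bullet> (\<Phi> t x + x) = (norm (\<Phi> t x))\<^sup>2 - (norm x)\<^sup>2"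
      by (simp add: power2_norm_eq_inner inner_diff_left inner_add_right inner_commute[of x "\<Phi> t x"])
    then have "((\<Phi> t x - x) /\<^sub>R t) \<bullet> (\<Phi> t x + x) = ((norm (\<Phi> t x))\<^sup>2 - (norm x)\<^sup>2) / t"
      unfolding inner_scaleR_left by (simp add: divide_inverse mult.commute)
    then show ?thesis using that by (simp only: k_def) (simp add: field_simps)
  qed
  have limk: "((\<lambda>t. (k t x - (norm x)\<^sup>2) / t) \<longlongrightarrow> c x) (at_right 0)" for x
  proof -
    have "((\<lambda>t. ((J (D t x) - 1) / t) * (norm (\<Phi> t x))\<^sup>2 + ((\<Phi> t x - x) /\<^sub>R t) \<bullet> (\<Phi> t x + x))
        \<longlongrightarrow> (\<Sum>b\<in>Basis. H x b \<bullet> b) * (norm x)\<^sup>2 + h x \<bullet> (x + x)) (at_right 0)"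
      by (intro tendsto_intros limJ limh lim\<Phi>)
    moreover have "(\<Sum>b\<in>Basis. H x b \<bullet> b) * (norm x)\<^sup>2 + h x \<bullet> (x + x) = c x"
      unfolding c_def inner_add_right by (simp add: inner_commute[of "h x" x] mult.commute)
    ultimately have "((\<lambda>t. ((J (D t x) - 1) / t) * (norm (\<Phi> t x))\<^sup>2 + ((\<Phi> t x - x) /\<^sub>R t) \<bullet> (\<Phi> t x + x)) \<longlongrightarrow> c x) (at_right 0)"
      by simp
    then show ?thesis
      by (rule Lim_transform_eventually) (auto simp: eventually_at_right_field split intro!: exI[of _ 1])
  qed
  obtain r where r: "r > 0" "r < d" "\<forall>t\<in>{0<..<r}. \<forall>x. \<bar>J (D t x) - 1 - (\<Sum>b\<in>Basis. (D t x b - b) \<bullet> b)\<bar> \<le> 1 * (B * t)"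
    using Jest[of 1] by auto
  define A where "A = (1 + N) * B + 4 * B"
  have dom: "\<bar>(k t x - (norm x)\<^sup>2) / t\<bar> \<le> A" if t: "t \<in> {0<..<r}" and x: "norm x < 1" for t x
  proof -
    have t': "t \<in> {0<..<d}" using t r by auto
    interpret near_identity "\<Phi> t" "B * t" using ni t' by auto
    have "x \<in> Omega" using x by (simp add: Omega_def)
    then have "\<Phi> t x \<in> Omega" by (simp add: in_Omega_iff)
    then have n1: "norm (\<Phi> t x) \<le> 1" by (simp add: Omega_def)
    have "\<bar>J (D t x) - 1\<bar> \<le> (1 + N) * (B * t)"
      using r(3)[rule_format, of t x] t trace[OF t', of x] by (simp add: distrib_right)
    then have "\<bar>(J (D t x) - 1) / t\<bar> \<le> (1 + N) * B" using t by (simp add: abs_divide divide_le_eq mult.assoc)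
    then have "\<bar>((J (D t x) - 1) / t) * (norm (\<Phi> t x))\<^sup>2\<bar> \<le> ((1 + N) * B) * 1"
      unfolding abs_mult using n1 B by (intro mult_mono) (auto simp: N_def abs_square_le_1)
    moreover have "\<bar>((\<Phi> t x - x) /\<^sub>R t) \<bullet> (\<Phi> t x + x)\<bar> \<le> (2 * B) * 2"
    proof -
      have "norm ((\<Phi> t x - x) /\<^sub>R t) = norm (\<Phi> t x - x) / t"
        unfolding norm_scaleR using t by (simp add: divide_inverse mult.commute)
      also have "\<dots> \<le> 2 * B" using displacement_le[of x] x t by (simp add: pos_divide_le_eq mult_ac)
      finally have "norm ((\<Phi> t x - x) /\<^sub>R t) \<le> 2 * B" .
      moreover have "norm (\<Phi> t x + x) \<le> 2" using norm_triangle_ineq[of "\<Phi> t x" x] n1 x by simp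
      ultimately show ?thesis using B by (intro order_trans[OF Cauchy_Schwarz_ineq2] mult_mono) auto
    qed
    ultimately have "\<bar>((J (D t x) - 1) / t) * (norm (\<Phi> t x))\<^sup>2 + ((\<Phi> t x - x) /\<^sub>R t) \<bullet> (\<Phi> t x + x)\<bar> \<le> A"
      unfolding A_def by linarith
    moreover have "t > 0" using t by simp
    ultimately show ?thesis by (simp only: split)
  qed
  have "((\<lambda>t. (m t - m 0) / t) \<longlongrightarrow> (LINT x|lborel. indicator ?B x * c x)) (at_right 0)"
    unfolding tendsto_at_iff_sequentially
  proof (intro allI impI)
    fix X :: "nat \<Rightarrow> real" assume Xp: "\<forall>i. X i \<in> {0<..} - {0}" and X0: "X \<longlonglongrightarrow> 0"
    have "\<forall>\<^sub>F n in sequentially. X n < r" using X0 r(1) by (rule order_tendstoD)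
    then obtain n0 where n0: "\<And>n. n \<ge> n0 \<Longrightarrow> X n < r" by (auto simp: eventually_sequentially)
    \<comment> \<open>The uniform bound holds only for small \<open>t\<close>, hence the shift of the sequence.\<close>
    define Y where "Y n = X (n + n0)" for n
    have Y: "Y n \<in> {0<..<r}" for n using Xp n0 by (simp add: Y_def)
    then have Yd: "Y n \<in> {0<..<d}" for n using r(2) by (meson greaterThanLessThan_iff less_trans)
    have Y0: "Y \<longlonglongrightarrow> 0" unfolding Y_def using X0 by (rule LIMSEQ_ignore_initial_segment)
    have Yr: "filterlim Y (at_right 0) sequentially"
    proof -
      have "Y n \<noteq> 0 \<and> Y n \<in> {0<..}" for n using Y[of n] by auto
      then show ?thesis using Y0 by (auto simp: filterlim_at)
    qed
    have pt: "(\<lambda>n. (k (Y n) x - (norm x)\<^sup>2) / Y n) \<longlonglongrightarrow> c x" for x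
      by (rule filterlim_compose[OF limk Yr])
    have meas: "(\<lambda>x. indicator ?B x * ((k (Y n) x - (norm x)\<^sup>2) / Y n)) \<in> borel_measurable borel" for n
    proof -
      have "(\<lambda>x. (indicator ?B x * k (Y n) x - indicator ?B x * (norm x)\<^sup>2) / Y n) \<in> borel_measurable borel"
        using borel_measurable_integrable[OF m(1)[OF Yd[of n]]] borel_measurable_integrable[OF int0] by simp
      then show ?thesis by (simp add: right_diff_distrib)
    qed
    have pt': "(\<lambda>n. indicator ?B x * ((k (Y n) x - (norm x)\<^sup>2) / Y n)) \<longlonglongrightarrow> indicator ?B x * c x" for x
      by (intro tendsto_mult_left pt)
    have "(\<lambda>n. LINT x|lborel. indicator ?B x * ((k (Y n) x - (norm x)\<^sup>2) / Y n)) \<longlonglongrightarrow> (LINT x|lborel. indicator ?B x * c x)"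
    proof (rule integral_dominated_convergence[where w="\<lambda>x. indicator ?B x * A"])
      show "(\<lambda>x. indicator ?B x * c x) \<in> borel_measurable lborel"
        using borel_measurable_LIMSEQ_real[OF pt' meas] by simp
      show "integrable lborel (\<lambda>x. indicator ?B x * A)"
        by (intro integrable_mult_left integrable_real_indicator) (use emeasure_lborel_ball_finite[of "0 :: real ^ 'n" R] in auto)
      show "AE x in lborel. norm (indicator ?B x * ((k (Y n) x - (norm x)\<^sup>2) / Y n)) \<le> indicator ?B x * A" for n
        using dom[OF Y[of n]] R by (intro AE_I2) (auto simp: indicator_def simp del: abs_divide)
    qed (use meas pt' in auto)
    moreover have "(LINT x|lborel. indicator ?B x * ((k (Y n) x - (norm x)\<^sup>2) / Y n)) = (m (Y n) - m 0) / Y n" for n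
    proof -
      have "(LINT x|lborel. indicator ?B x * ((k (Y n) x - (norm x)\<^sup>2) / Y n))
        = (LINT x|lborel. (indicator ?B x * k (Y n) x - indicator ?B x * (norm x)\<^sup>2) / Y n)"
        by (simp add: right_diff_distrib)
      also have "\<dots> = (m (Y n) - m 0) / Y n"
        unfolding m(2)[OF Yd] m0 using m(1)[OF Yd[of n]] int0 by simp
      finally show ?thesis .
    qed
    ultimately have "(\<lambda>n. (m (Y n) - m 0) / Y n) \<longlonglongrightarrow> (LINT x|lborel. indicator ?B x * c x)"
      by (simp only:)
    then have "(\<lambda>n. (m (X (n + n0)) - m 0) / X (n + n0)) \<longlonglongrightarrow> (LINT x|lborel. indicator ?B x * c x)"
      unfolding Y_def .
    then show "((\<lambda>t. (m t - m 0) / t) \<circ> X) \<longlonglongrightarrow> (LINT x|lborel. indicator ?B x * c x)"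
      unfolding comp_def by (rule LIMSEQ_offset)
  qed
  then show ?thesis by (simp add: has_field_derivative_iff m_def c_def)
qed

section \<open>The shape derivative\<close>

theorem theorem1p2:
  fixes \<Phi> :: "real \<Rightarrow> real ^ 'n \<Rightarrow> real ^ 'n" and h :: "real ^ 'n \<Rightarrow> real ^ 'n"
    and R \<sigma>m \<sigma>p :: real
  assumes "CARD('n) \<ge> 2" and "0 < R" and "R < 1" and "0 < \<sigma>m" and "0 < \<sigma>p"
    and "\<Phi> \<in> admissible"
    and "first_order_field \<Phi> h"
    and "(LINT x:sphere 0 R|surface_measure R. h x \<bullet> outward_normal R x) = 0"
  shows "((\<lambda>t. torsional_rigidity \<sigma>m \<sigma>p (\<Phi> t ` ball 0 R)) has_real_derivative 0) (at_right 0)"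
proof -
  note R = assms(2,3) and \<sigma> = assms(4,5) and adm = assms(6) and fo = assms(7)
  have \<Phi>0: "\<Phi> 0 = id" using adm by (simp add: admissible_def)
  obtain D H K where
    DD: "\<And>t x. t \<in> {0..<1} \<Longrightarrow> (\<Phi> t has_derivative D t x) (at x)"
    and contD: "\<And>t v. t \<in> {0..<1} \<Longrightarrow> continuous_on UNIV (\<lambda>x. D t x v)"
    and hH: "\<And>x. (h has_derivative H x) (at x)"
    and contH: "\<And>v. continuous_on UNIV (\<lambda>x. H x v)"
    and exp: "\<And>e. e > 0 \<Longrightarrow> \<exists>d>0. d < 1 \<and> (\<forall>t\<in>{0<..<d}. \<forall>x v. norm (D t x v - v - t *\<^sub>R H x v) \<le> e * t * norm v)"
    and K: "compact K" "K \<subseteq> Omega" and hout: "\<And>x. x \<notin> K \<Longrightarrow> h x = 0" and Hout: "\<And>x v. x \<notin> K \<Longrightarrow> H x v = 0"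
    and out: "\<And>t x. t \<in> {0..<1} \<Longrightarrow> x \<notin> K \<Longrightarrow> \<Phi> t x = x"
    by (rule admissible_expansion[OF adm fo]) (rule that; assumption)
  obtain C where C0: "C \<ge> 0" "\<And>x v. x \<in> K \<Longrightarrow> norm (H x v) \<le> C * norm v"
    using operator_field_bounded_on_compact[OF has_derivative_linear[OF hH] contH K(1)] by blast
  have C: "C \<ge> 0" "norm (H x v) \<le> C * norm v" for x v
    using C0 Hout[of x v] by (cases "x \<in> K"; simp)+
  have out': "\<Phi> t x = x" if "t \<in> {0..<1}" "x \<notin> Omega" for t x using out that K(2) by blast
  obtain d where d: "0 < d" "d < 1" and ni: "\<And>t. t \<in> {0..<d} \<Longrightarrow> near_identity (\<Phi> t) ((C + 1) * t)"
    and Dest: "\<And>t x v. t \<in> {0<..<d} \<Longrightarrow> norm (D t x v - v) \<le> ((C + 1) * t) * norm v"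
    by (rule near_identity_of_expansion[where \<Phi>=\<Phi> and D=D and H=H and C=C])
      (rule \<Phi>0 C | erule DD exp | erule (1) out' | (rule that; assumption))+
  define m where "m t = (LINT y|lborel. indicator (\<Phi> t ` ball 0 R) y * (norm y)\<^sup>2)" for t
  \<comment> \<open>The derivative of the second moment is the integral of the divergence of \<open>|x|\<^sup>2 h\<close>, hence \<open>R\<^sup>2\<close> times the flux of \<open>h\<close>.\<close>
  have "((\<lambda>x. (norm x)\<^sup>2 *\<^sub>R h x) has_derivative (\<lambda>v. (norm x)\<^sup>2 *\<^sub>R H x v + (2 * (x \<bullet> v)) *\<^sub>R h x)) (at x)" for x
  proof -
    have "((\<lambda>x. x \<bullet> x) has_derivative (\<lambda>v. 2 * (x \<bullet> v))) (at x)"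
      by (auto intro!: derivative_eq_intros simp: inner_commute)
    then have "((\<lambda>x. (norm x)\<^sup>2) has_derivative (\<lambda>v. 2 * (x \<bullet> v))) (at x)" by (simp add: power2_norm_eq_inner)
    from has_derivative_scaleR[OF this hH] show ?thesis .
  qed
  moreover have "continuous_on UNIV (\<lambda>x. (norm x)\<^sup>2 *\<^sub>R H x v + (2 * (x \<bullet> v)) *\<^sub>R h x)" for v
    using hH by (intro continuous_intros contH has_derivative_continuous_on) auto
  ultimately have "(LINT x|lborel. indicator (ball 0 R) x * (\<Sum>i\<in>Basis. ((norm x)\<^sup>2 *\<^sub>R H x i + (2 * (x \<bullet> i)) *\<^sub>R h x) \<bullet> i))
      = (LINT x:sphere 0 R|surface_measure R. ((norm x)\<^sup>2 *\<^sub>R h x) \<bullet> outward_normal R x)"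
    by (rule divergence_theorem_ball[OF R(1)])
  moreover have "(\<Sum>i\<in>Basis. ((norm x)\<^sup>2 *\<^sub>R H x i + (2 * (x \<bullet> i)) *\<^sub>R h x) \<bullet> i)
      = (norm x)\<^sup>2 * (\<Sum>b\<in>Basis. H x b \<bullet> b) + 2 * (x \<bullet> h x)" for x
  proof -
    have "(\<Sum>i\<in>Basis. (x \<bullet> i) * (h x \<bullet> i)) = x \<bullet> h x" by (rule euclidean_inner[symmetric])
    then show ?thesis by (simp add: inner_add_left sum.distrib sum_distrib_left mult.assoc flip: sum_distrib_left)
  qed
  moreover have "(LINT x:sphere 0 R|surface_measure R. ((norm x)\<^sup>2 *\<^sub>R h x) \<bullet> outward_normal R x)
      = R\<^sup>2 * (LINT x:sphere 0 R|surface_measure R. h x \<bullet> outward_normal R x)"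
  proof -
    have "(LINT x:sphere 0 R|surface_measure R. ((norm x)\<^sup>2 *\<^sub>R h x) \<bullet> outward_normal R x)
      = (LINT x|surface_measure R. R\<^sup>2 * (indicator (sphere 0 R) x * (h x \<bullet> outward_normal R x)))"
      unfolding set_lebesgue_integral_def
      by (rule Bochner_Integration.integral_cong[OF refl]) (simp add: indicator_def)
    then show ?thesis by (simp add: set_lebesgue_integral_def)
  qed
  ultimately have flux: "(LINT x|lborel. indicator (ball 0 R) x * ((norm x)\<^sup>2 * (\<Sum>b\<in>Basis. H x b \<bullet> b) + 2 * (x \<bullet> h x))) = 0"
    using assms(8) by simp
  have hlim: "((\<lambda>t. (\<Phi> t x - (x + t *\<^sub>R h x)) /\<^sub>R t) \<longlongrightarrow> 0) (at_right 0)" for x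
    using fo by (simp add: first_order_field_def)
  have "C + 1 > 0" using C(1) by simp
  from second_moment_derivative[OF R \<Phi>0 DD contD exp hlim this d ni Dest] flux
  have "(m has_real_derivative 0) (at_right 0)" by (simp add: m_def[abs_def])
  then have mlim: "((\<lambda>t. (m t - m 0) / t) \<longlongrightarrow> 0) (at_right 0)" by (simp add: has_field_derivative_iff)
  define N where "N = real DIM(real ^ 'n)"
  define E where "E t = torsional_rigidity \<sigma>m \<sigma>p (\<Phi> t ` ball 0 R)" for t
  define c0 where "c0 = (1 / (N\<^sup>2 * \<sigma>p)) * (LINT x|lebesgue_on Omega. (norm (x :: real ^ 'n))\<^sup>2)"
  define c1 where "c1 = (1 / N\<^sup>2) * (1 / \<sigma>m - 1 / \<sigma>p)"
  define P where "P = 64 * (C + 1)\<^sup>2 / (N\<^sup>2 * min \<sigma>m \<sigma>p) * measure lebesgue (Omega :: (real ^ 'n) set)"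
  have bounds: "E t \<le> c0 + c1 * m t" "c0 + c1 * m t - P * t\<^sup>2 \<le> E t" if t: "t \<in> {0..<d}" for t
  proof -
    interpret near_identity "\<Phi> t" "(C + 1) * t" by (rule ni[OF t])
    have G: "(LINT x|lebesgue_on Omega. (norm x)\<^sup>2 / (N\<^sup>2 * conductivity \<sigma>m \<sigma>p (\<Phi> t ` ball 0 R) x)) = c0 + c1 * m t"
      unfolding c0_def c1_def m_def N_def by (rule weighted_moment[OF R \<sigma>])
    have "\<Phi> t ` ball 0 R \<in> sets lebesgue" using open_image[OF open_ball, of 0 R] by simp
    from torsional_rigidity_bounds(1)[OF \<sigma> this negligible_boundary]
    show "E t \<le> c0 + c1 * m t" unfolding E_def N_def[symmetric] G .
    have P: "64 * ((C + 1) * t)\<^sup>2 / (N\<^sup>2 * min \<sigma>m \<sigma>p) * measure lebesgue (Omega :: (real ^ 'n) set) = P * t\<^sup>2"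
      by (simp add: P_def power_mult_distrib)
    show "c0 + c1 * m t - P * t\<^sup>2 \<le> E t"
      using torsional_rigidity_lower_bound[OF R \<sigma>] unfolding E_def N_def[symmetric] G P .
  qed
  \<comment> \<open>At \<open>t = 0\<close> the two bounds coincide, so the rigidity of the ball itself is known exactly.\<close>
  have E0: "E 0 = c0 + c1 * m 0" using bounds[of 0] d by simp
  have "((\<lambda>t. (E t - E 0) / t - c1 * ((m t - m 0) / t)) \<longlongrightarrow> 0) (at_right 0)"
  proof (rule Lim_null_comparison)
    show "\<forall>\<^sub>F t in at_right 0. norm ((E t - E 0) / t - c1 * ((m t - m 0) / t)) \<le> P * t"
      unfolding eventually_at_right_field
    proof (intro exI[of _ d] conjI allI impI d(1))
      fix t assume t: "0 < t" "t < d"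
      have "(E t - E 0) / t - c1 * ((m t - m 0) / t) = (E t - (c0 + c1 * m t)) / t"
        using t by (simp add: E0 field_simps)
      moreover have "\<bar>E t - (c0 + c1 * m t)\<bar> \<le> P * t\<^sup>2" using bounds[of t] t by auto
      ultimately show "norm ((E t - E 0) / t - c1 * ((m t - m 0) / t)) \<le> P * t"
        using t by (simp add: abs_divide divide_le_eq power2_eq_square mult.assoc)
    qed
    show "((\<lambda>t. P * t) \<longlongrightarrow> 0) (at_right 0)"
      by (rule tendsto_mult_right_zero) (rule tendsto_ident_at)
  qed
  from tendsto_add[OF this tendsto_mult_right_zero[OF mlim, of c1]]
  have "((\<lambda>t. (E t - E 0) / t) \<longlongrightarrow> 0) (at_right 0)" by simp
  then show ?thesis by (simp add: has_field_derivative_iff E_def)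
qed

end
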